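(* Suppose that (A1) every element $E\in\mathcal{T}_h$ has at most one face on $\Gamma_N$, and (A2) $\mathcal{T}_h$ can be agglomerated into a conforming mesh of $k_1\times k_2\times k_3$ macroelements, $k_1,k_2,k_3\in\{2,3\}$. Consider the algebraic system of the MSMFE-1 method with matrices $(A_{\sigma\sigma})_{ij}=(A\tau_j,\tau_i)_Q$, $(A_{\sigma u})_{ij}=(\operatorname{div}\tau_j,v_i)$, $(A_{\sigma\gamma})_{ij}=(\tau_j,w_i)_Q$, where $\{\tau_j\}$ is the basis of $\mathbb{X}_h$ dual to the vertex degrees of freedom, $\{v_i\}$ is a basis of $V_h$ and $\{w_i\}$ is the nodal (vertex) basis of $\mathbb{W}_h^1$. Then $A_{\sigma\sigma}$ is block-diagonal with blocks associated with the mesh vertices (of size $36\times 36$ for an interior vertex); the rotation matrix $A_{\sigma\gamma}A_{\sigma\sigma}^{-1}A_{\sigma\gamma}^T$ is block-diagonal with $3\times3$ blocks associated with the mesh vertices; the displacement-rotation matrix $$\begin{pmatrix} A_{\sigma u}A_{\sigma\sigma}^{-1}A_{\sigma u}^T & A_{\sigma u}A_{\sigma\sigma}^{-1}A_{\sigma\gamma}^T\\ A_{\sigma\gamma}A_{\sigma\sigma}^{-1}A_{\sigma u}^T & A_{\sigma\gamma}A_{\sigma\sigma}^{-1}A_{\sigma\gamma}^T\end{pmatrix}$$ is symmetric and positive definite; and the matrix of the cell-centered displacement system obtained by eliminating the stress and then the rotation, $$A_{\sigma u}A_{\sigma\sigma}^{-1}A_{\sigma u}^T-A_{\sigma u}A_{\sigma\sigma}^{-1}A_{\sigma\gamma}^T\big(A_{\sigma\gamma}A_{\sigma\sigma}^{-1}A_{\sigma\gamma}^T\big)^{-1}A_{\sigma\gamma}A_{\sigma\sigma}^{-1}A_{\sigma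 u}^T,$$ is symmetric and positive definite.
   Context: **Setting.** $\Omega\subset\mathbb{R}^3$ is a simply connected bounded domain, $\partial\Omega=\Gamma_D\cup\Gamma_N$ with $\Gamma_D\neq\emptyset$. $\mathbb{M}$ and $\mathbb{N}$ denote the real $3\times3$ matrices and the skew-symmetric $3\times 3$ matrices. $\operatorname{div}$ and $\operatorname{curl}$ act row-wise on matrix fields. $(\cdot,\cdot)$, $\|\cdot\|$ are the $L^2(\Omega)$ inner product and norm ($:$ is the Frobenius product). The compliance tensor $A=A(\mathbf{x})$ is a symmetric, bounded, uniformly positive definite linear operator $\mathbb{M}\to\mathbb{M}$, element-wise continuous on the mesh below. **Mesh.** $\mathcal{T}_h$ is a shape-regular, conforming (face-to-face) partition of $\Omega$ into cuboids (rectangular boxes); $\Gamma_D$ and $\Gamma_N$ are unions of element faces. A $k_1\times k_2\times k_3$ macroelement is a cuboid that is the union of a $k_1\times k_2\times k_3$ array of elements of $\mathcal{T}_h$. $\hat E=[0,1]^3$ is the reference cube with vertices $\hat{\mathbf r}_1=(0,0,0)$, $\hat{\mathbf r}_2=(1,0,0)$, $\hat{\mathbf r}_3=(1,1,0)$, $\hat{\mathbf r}_4=(0,1,0)$, $\hat{\mathbf r}_5=(0,0,1)$, $\hat{\mathbf r}_6=(1,0,1)$, $\hat{\mathbf r}_7=(1,1,1)$, $\hat{\mathbf r}_8=(0,1,1)$. For an element $E$ with corresponding vertices $\mathbf r_1,\dots,\mathbf r_8$, $F_E:\hat E\to E$ is the affine bijection $F_E(\hat{\mathbf{x}})=\mathbf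 r_1+(\mathbf r_2-\mathbf r_1)\hat x+(\mathbf r_4-\mathbf r_1)\hat y+(\mathbf r_5-\mathbf r_1)\hat z$, with Jacobian matrix $DF_E$ and $J_E=|\det DF_E|$. **Enhanced Raviart-Thomas space.** $\mathcal{RT}_0(\hat E)=\{(\alpha_1+\beta_1\hat x,\alpha_2+\beta_2\hat y,\alpha_3+\beta_3\hat z)^T:\alpha_i,\beta_i\in\mathbb{R}\}$. $\mathcal B(\hat E)$ is the span of the vectors $(b,0,0)^T$ with $b\in\{\hat y,\hat z,\hat x\hat y,\hat x\hat z,\hat y\hat z,\hat x\hat y\hat z\}$, $(0,b,0)^T$ with $b\in\{\hat x,\hat z,\hat x\hat y,\hat x\hat z,\hat y\hat z,\hat x\hat y\hat z\}$, and $(0,0,b)^T$ with $b\in\{\hat x,\hat y,\hat x\hat y,\hat x\hat z,\hat y\hat z,\hat x\hat y\hat z\}$. Then $\mathcal{ERT}_0(\hat E)=\mathcal{RT}_0(\hat E)+\operatorname{curl}(\hat{\mathbf x}\times\mathcal B(\hat E))$, where $\hat{\mathbf x}=(\hat x,\hat y,\hat z)^T$ and $\times$ is the cross product. The degrees of freedom of $\mathcal{ERT}_0(\hat E)$ are the values of the normal component at the four vertices of each of the six faces. **Discrete spaces.** $\mathbb{X}_h$ is the set of $\tau\in L^2(\Omega,\mathbb{M})$ with $\operatorname{div}\tau\in L^2(\Omega,\mathbb{R}^3)$, $\tau n=0$ on $\Gamma_N$, such that on each $E$, $\tau^T=\frac1{J_E}DF_E\,\hat\tau^T\circ F_E^{-1}$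 for some $\hat\tau$ whose three rows belong to $\mathcal{ERT}_0(\hat E)$ (row-wise Piola transform). Its degrees of freedom are the values of the three components of $\tau n_f$ at the four vertices of each mesh face $f$ not on $\Gamma_N$; each degree of freedom is associated with the vertex at which it is evaluated. $V_h$ is the space of $\mathbb{R}^3$-valued functions constant on each element. $\mathbb{W}_h^1$ is the space of continuous $\mathbb{N}$-valued functions $w$ on $\Omega$ such that, for each $E$, every entry of $w\circ F_E$ is a polynomial of degree at most 1 in each variable. **Vertex quadrature.** $(A\tau,\chi)_Q=\sum_{E}\frac{|E|}{8}\sum_{i=1}^8 A(\mathbf r_i)\tau(\mathbf r_i):\chi(\mathbf r_i)$ and $(\tau,w)_Q=(w,\tau)_Q=\sum_{E}\frac{|E|}{8}\sum_{i=1}^8\tau(\mathbf r_i):w(\mathbf r_i)$, where for each $E\in\mathcal{T}_h$ the $\mathbf r_i$ are its vertices and all values are taken from within $E$. **MSMFE-1 method.** Find $(\sigma_h,u_h,\gamma_h)\in \mathbb{X}_h\times V_h\times \mathbb{W}_h^1$ with $(A\sigma_h,\tau)_Q+(u_h,\operatorname{div}\tau)+(\gamma_h,\tau)_Q=0$ for all $\tau\in\mathbb{X}_h$, $(\operatorname{div}\sigma_h,v)=(f,v)$ for all $v\in V_h$, and $(\sigma_h,w)_Q=0$ for all $w\in\mathbb{W}_h^1$. *)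

theory Defs
  imports "HOL-Analysis.Analysis"
begin

section \<open>Cuboids and cuboid meshes\<close>

definition ref_cube :: "(real^3) set" where
  "ref_cube = cbox 0 1"

definition ref_vertex :: "nat \<Rightarrow> real^3" where
  "ref_vertex i = vector
     ([[0,0,0], [1,0,0], [1,1,0], [0,1,0], [0,0,1], [1,0,1], [1,1,1], [0,1,1]] ! (i - 1))"

definition elem_map :: "(nat \<Rightarrow> real^3) \<Rightarrow> real^3 \<Rightarrow> real^3" where
  "elem_map \<rho> x = \<rho> 1 + x$1 *\<^sub>R (\<rho> 2 - \<rho> 1) + x$2 *\<^sub>R (\<rho> 4 - \<rho> 1) + x$3 *\<^sub>R (\<rho> 5 - \<rho> 1)"

definition elem_DF :: "(nat \<Rightarrow> real^3) \<Rightarrow> real^3^3" where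
  "elem_DF \<rho> = transpose (vector [\<rho> 2 - \<rho> 1, \<rho> 4 - \<rho> 1, \<rho> 5 - \<rho> 1])"

definition elem_J :: "(nat \<Rightarrow> real^3) \<Rightarrow> real" where
  "elem_J \<rho> = \<bar>det (elem_DF \<rho>)\<bar>"

text \<open>The set E is the (non-degenerate) rectangular box with vertices
  \<open>\<rho> 1, \<dots>, \<rho> 8\<close>, numbered like those of the reference cube. Boxes need not be
  axis-parallel and the numbering may reverse the orientation.\<close>

definition cuboid :: "(nat \<Rightarrow> real^3) \<Rightarrow> (real^3) set \<Rightarrow> bool" where
  "cuboid \<rho> E \<longleftrightarrow>
     \<rho> 2 - \<rho> 1 \<noteq> 0 \<and> \<rho> 4 - \<rho> 1 \<noteq> 0 \<and> \<rho> 5 - \<rho> 1 \<noteq> 0 \<and>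
     orthogonal (\<rho> 2 - \<rho> 1) (\<rho> 4 - \<rho> 1) \<and> orthogonal (\<rho> 2 - \<rho> 1) (\<rho> 5 - \<rho> 1) \<and>
     orthogonal (\<rho> 4 - \<rho> 1) (\<rho> 5 - \<rho> 1) \<and>
     (\<forall>i\<in>{1..8}. \<rho> i = elem_map \<rho> (ref_vertex i)) \<and>
     E = elem_map \<rho> ` ref_cube"

text \<open>The condition \<open>\<Omega> = interior (\<Union>T)\<close> says that the domain lies on one side of its
  boundary, i.e. that no mesh face inside the closure has been slit out of it.\<close>

definition conforming_mesh :: "(real^3) set \<Rightarrow> (real^3) set set \<Rightarrow> bool" where
  "conforming_mesh \<Omega> T \<longleftrightarrow>
     finite T \<and> (\<forall>E\<in>T. \<exists>\<rho>. cuboid \<rho> E) \<and>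
     closure \<Omega> = \<Union>T \<and> \<Omega> = interior (\<Union>T) \<and>
     (\<forall>E\<in>T. \<forall>E'\<in>T. E \<noteq> E' \<longrightarrow>
        interior E \<inter> interior E' = {} \<and> (E \<inter> E') face_of E \<and> (E \<inter> E') face_of E')"

definition shape_regular :: "real \<Rightarrow> (real^3) set set \<Rightarrow> bool" where
  "shape_regular \<kappa> T \<longleftrightarrow>
     (\<forall>E\<in>T. \<exists>x \<rho>. 0 < \<rho> \<and> cball x \<rho> \<subseteq> E \<and> diameter E \<le> \<kappa> * \<rho>)"

definition mesh_faces :: "(real^3) set set \<Rightarrow> (real^3) set set" where
  "mesh_faces T = {f. \<exists>E\<in>T. f facet_of E}"

definition mesh_vertices :: "(real^3) set set \<Rightarrow> ((real^3) set \<Rightarrow> nat \<Rightarrow> real^3) \<Rightarrow> (real^3) set" where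
  "mesh_vertices T r = (\<Union>E\<in>T. r E ` {1..8})"

definition unit_normal :: "(real^3) set \<Rightarrow> real^3 \<Rightarrow> bool" where
  "unit_normal f n \<longleftrightarrow> norm n = 1 \<and> (\<forall>x\<in>f. \<forall>y\<in>f. n \<bullet> (x - y) = 0)"

text \<open>The breakpoints \<open>t d 0 < \<dots> < t d (k d)\<close> cut the macroelement into the
  \<open>k 1 \<times> k 2 \<times> k 3\<close> array of its elements.\<close>

definition macroelement :: "(real^3) set set \<Rightarrow> (real^3) set \<Rightarrow> bool" where
  "macroelement T M \<longleftrightarrow>
     (\<exists>\<rho> (k :: 3 \<Rightarrow> nat) (t :: 3 \<Rightarrow> nat \<Rightarrow> real).
        cuboid \<rho> M \<and>
        (\<forall>d. k d \<in> {2, 3} \<and> t d 0 = 0 \<and> t d (k d) = 1 \<and> (\<forall>m < k d. t d m < t d (Suc m))) \<and>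
        (\<forall>i. (\<forall>d. i d < k d) \<longrightarrow>
           elem_map \<rho> ` cbox (\<chi> d. t d (i d)) (\<chi> d. t d (Suc (i d))) \<in> T))"

definition agglomerable :: "(real^3) set \<Rightarrow> (real^3) set set \<Rightarrow> bool" where
  "agglomerable \<Omega> T \<longleftrightarrow> (\<exists>\<M>. conforming_mesh \<Omega> \<M> \<and> (\<forall>M\<in>\<M>. macroelement T M))"


section \<open>Square integrability and weak divergence\<close>

definition L2 :: "(real^3) set \<Rightarrow> (real^3 \<Rightarrow> 'b::euclidean_space) \<Rightarrow> bool" where
  "L2 \<Omega> g \<longleftrightarrow> g \<in> borel_measurable (lebesgue_on \<Omega>) \<and>
     integrable (lebesgue_on \<Omega>) (\<lambda>x. (norm (g x))\<^sup>2)"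

definition L2_inner ::
  "(real^3) set \<Rightarrow> (real^3 \<Rightarrow> 'b::euclidean_space) \<Rightarrow> (real^3 \<Rightarrow> 'b) \<Rightarrow> real" where
  "L2_inner \<Omega> g h = integral\<^sup>L (lebesgue_on \<Omega>) (\<lambda>x. g x \<bullet> h x)"

definition C1_test_field :: "(real^3) set \<Rightarrow> (real^3 \<Rightarrow> real^3) \<Rightarrow> (real^3 \<Rightarrow> (real^3) \<Rightarrow>\<^sub>L (real^3)) \<Rightarrow> bool" where
  "C1_test_field \<Omega> \<phi> D \<longleftrightarrow>
     (\<forall>x. (\<phi> has_derivative blinfun_apply (D x)) (at x)) \<and> continuous_on UNIV D \<and>
     (\<exists>K. compact K \<and> K \<subseteq> \<Omega> \<and> (\<forall>x. x \<notin> K \<longrightarrow> \<phi> x = 0))"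

text \<open>Row-wise divergence in the weak sense. By mollification, compactly supported
  \<open>C\<^sup>1\<close> test fields give the same notion as smooth ones. The inner product of
  matrices is the Frobenius product.\<close>

definition weak_div :: "(real^3) set \<Rightarrow> (real^3 \<Rightarrow> real^3^3) \<Rightarrow> (real^3 \<Rightarrow> real^3) \<Rightarrow> bool" where
  "weak_div \<Omega> \<tau> g \<longleftrightarrow>
     (\<forall>\<phi> D. C1_test_field \<Omega> \<phi> D \<longrightarrow>
        L2_inner \<Omega> g \<phi> = - L2_inner \<Omega> \<tau> (\<lambda>x. matrix (blinfun_apply (D x))))"

text \<open>Unique up to null sets, so inner products with it do not depend on the choice.\<close>

definition the_div :: "(real^3) set \<Rightarrow> (real^3 \<Rightarrow> real^3^3) \<Rightarrow> real^3 \<Rightarrow> real^3" where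
  "the_div \<Omega> \<tau> = (SOME g. L2 \<Omega> g \<and> weak_div \<Omega> \<tau> g)"


section \<open>The enhanced Raviart-Thomas space\<close>

definition curl3 :: "(real^3 \<Rightarrow> real^3) \<Rightarrow> real^3 \<Rightarrow> real^3" where
  "curl3 g x = (let d = (\<lambda>j i. frechet_derivative g (at x) (axis j 1) $ i) in
     vector [d 2 3 - d 3 2, d 3 1 - d 1 3, d 1 2 - d 2 1])"

definition RT0_hat :: "(real^3 \<Rightarrow> real^3) set" where
  "RT0_hat = {q. \<exists>\<alpha> \<beta> :: real^3. q = (\<lambda>x. \<chi> d. \<alpha>$d + \<beta>$d * x$d)}"

text \<open>A set D of coordinate indices encodes the monomial \<open>\<Prod>j\<in>D. x$j\<close>; in component d
  all such monomials occur except 1 and \<open>x$d\<close>.\<close>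

definition B_hat :: "(real^3 \<Rightarrow> real^3) set" where
  "B_hat = {b. \<exists>c :: 3 \<Rightarrow> 3 set \<Rightarrow> real.
     b = (\<lambda>x. \<chi> d. \<Sum>D\<in>UNIV - {{}, {d}}. c d D * (\<Prod>j\<in>D. x$j))}"

definition ERT0_hat :: "(real^3 \<Rightarrow> real^3) set" where
  "ERT0_hat = {(\<lambda>x. q x + curl3 (\<lambda>y. cross3 y (b y)) x) |q b. q \<in> RT0_hat \<and> b \<in> B_hat}"

definition Q1_hat :: "(real^3 \<Rightarrow> real) set" where
  "Q1_hat = {p. \<exists>c :: 3 set \<Rightarrow> real. p = (\<lambda>x. \<Sum>D\<in>UNIV. c D * (\<Prod>j\<in>D. x$j))}"


section \<open>Discrete spaces\<close>

text \<open>Value at x, a point of the closed element E, taken from within E.\<close>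

definition from_within :: "(real^3) set \<Rightarrow> (real^3 \<Rightarrow> 'b::t2_space) \<Rightarrow> real^3 \<Rightarrow> 'b" where
  "from_within E g x = Lim (at x within interior E) g"

text \<open>Discontinuous piecewise polynomial fields are represented by the member of their
  \<open>L\<^sup>2\<close> class that is polynomial in the interior of each element and zero elsewhere,
  so that equality in the spaces below is equality of functions. The Piola identity
  is stated after composition with the element map.\<close>

definition Xh ::
  "(real^3) set \<Rightarrow> (real^3) set \<Rightarrow> (real^3) set set \<Rightarrow> ((real^3) set \<Rightarrow> nat \<Rightarrow> real^3)
     \<Rightarrow> (real^3 \<Rightarrow> real^3^3) set" where
  "Xh \<Omega> \<Gamma>\<^sub>N T r = {\<tau>.
     L2 \<Omega> \<tau> \<and> (\<exists>g. L2 \<Omega> g \<and> weak_div \<Omega> \<tau> g) \<and>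
     (\<forall>E\<in>T. \<exists>\<tau>' :: real^3 \<Rightarrow> real^3^3.
        (\<forall>d. (\<lambda>y. row d (\<tau>' y)) \<in> ERT0_hat) \<and>
        (\<forall>y\<in>interior ref_cube. transpose (\<tau> (elem_map (r E) y)) =
           (1 / elem_J (r E)) *\<^sub>R (elem_DF (r E) ** transpose (\<tau>' y)))) \<and>
     (\<forall>x. x \<notin> (\<Union>E\<in>T. interior E) \<longrightarrow> \<tau> x = 0) \<and>
     (\<forall>E\<in>T. \<forall>f n. f facet_of E \<and> f \<subseteq> \<Gamma>\<^sub>N \<and> unit_normal f n \<longrightarrow>
        (\<forall>x\<in>f. from_within E \<tau> x *v n = 0))}"

definition Vh :: "(real^3) set set \<Rightarrow> (real^3 \<Rightarrow> real^3) set" where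
  "Vh T = {v. (\<forall>E\<in>T. \<exists>c. \<forall>x\<in>interior E. v x = c) \<and>
     (\<forall>x. x \<notin> (\<Union>E\<in>T. interior E) \<longrightarrow> v x = 0)}"

definition skew_matrices :: "(real^3^3) set" where
  "skew_matrices = {S. transpose S = - S}"

definition Wh1 ::
  "(real^3) set \<Rightarrow> (real^3) set set \<Rightarrow> ((real^3) set \<Rightarrow> nat \<Rightarrow> real^3) \<Rightarrow> (real^3 \<Rightarrow> real^3^3) set" where
  "Wh1 \<Omega> T r = {w. continuous_on (closure \<Omega>) w \<and> (\<forall>x. w x \<in> skew_matrices) \<and>
     (\<forall>x. x \<notin> closure \<Omega> \<longrightarrow> w x = 0) \<and>
     (\<forall>E\<in>T. \<forall>i j. \<exists>p\<in>Q1_hat. \<forall>y\<in>ref_cube. w (elem_map (r E) y) $ i $ j = p y)}"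

definition is_basis ::
  "('x \<Rightarrow> 'b::real_vector) set \<Rightarrow> ('i::finite \<Rightarrow> 'x \<Rightarrow> 'b) \<Rightarrow> bool" where
  "is_basis V b \<longleftrightarrow> (\<forall>i. b i \<in> V) \<and>
     (\<forall>c. (\<forall>x. (\<Sum>i\<in>UNIV. c i *\<^sub>R b i x) = 0) \<longrightarrow> (\<forall>i. c i = 0)) \<and>
     (\<forall>g\<in>V. \<exists>c. g = (\<lambda>x. \<Sum>i\<in>UNIV. c i *\<^sub>R b i x))"

text \<open>A degree of freedom is indexed by a face not on \<open>\<Gamma>\<^sub>N\<close>, a vertex of that face, and
  a component.\<close>

definition dof_set :: "(real^3) set \<Rightarrow> (real^3) set set \<Rightarrow> ((real^3) set \<times> (real^3) \<times> 3) set" where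
  "dof_set \<Gamma>\<^sub>N T = {(f, x, c). f \<in> mesh_faces T \<and> \<not> f \<subseteq> \<Gamma>\<^sub>N \<and> x extreme_point_of f}"

definition dof_vertex :: "(real^3) set \<times> (real^3) \<times> 3 \<Rightarrow> real^3" where
  "dof_vertex d = fst (snd d)"

text \<open>Since \<open>\<tau> n\<close> is continuous across faces for \<open>\<tau>\<close> in \<open>Xh\<close>, the values of the degree
  of freedom taken from within the elements on either side of the face agree.\<close>

definition dof_value ::
  "(real^3) set set \<Rightarrow> ((real^3) set \<Rightarrow> real^3) \<Rightarrow> (real^3) set \<times> (real^3) \<times> 3
     \<Rightarrow> (real^3 \<Rightarrow> real^3^3) \<Rightarrow> real \<Rightarrow> bool" where
  "dof_value T n d \<tau> a \<longleftrightarrow> (case d of (f, x, c) \<Rightarrow>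
     \<forall>E\<in>T. f facet_of E \<longrightarrow> (from_within E \<tau> x *v n f) $ c = a)"


section \<open>Quadrature forms and matrices\<close>

definition quad_A ::
  "(real^3) set set \<Rightarrow> ((real^3) set \<Rightarrow> nat \<Rightarrow> real^3) \<Rightarrow> (real^3 \<Rightarrow> (real^3^3) \<Rightarrow>\<^sub>L (real^3^3))
     \<Rightarrow> (real^3 \<Rightarrow> real^3^3) \<Rightarrow> (real^3 \<Rightarrow> real^3^3) \<Rightarrow> real" where
  "quad_A T r A \<tau> \<chi>' = (\<Sum>E\<in>T. measure lebesgue E / 8 *
     (\<Sum>i=1..8. blinfun_apply (from_within E A (r E i)) (from_within E \<tau> (r E i))
                 \<bullet> from_within E \<chi>' (r E i)))"

definition quad ::
  "(real^3) set set \<Rightarrow> ((real^3) set \<Rightarrow> nat \<Rightarrow> real^3)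
     \<Rightarrow> (real^3 \<Rightarrow> real^3^3) \<Rightarrow> (real^3 \<Rightarrow> real^3^3) \<Rightarrow> real" where
  "quad T r \<tau> w = (\<Sum>E\<in>T. measure lebesgue E / 8 *
     (\<Sum>i=1..8. from_within E \<tau> (r E i) \<bullet> from_within E w (r E i)))"

definition compliance_tensor ::
  "(real^3) set \<Rightarrow> (real^3) set set \<Rightarrow> (real^3 \<Rightarrow> (real^3^3) \<Rightarrow>\<^sub>L (real^3^3)) \<Rightarrow> bool" where
  "compliance_tensor \<Omega> T A \<longleftrightarrow>
     (\<forall>x\<in>\<Omega>. \<forall>\<sigma> \<tau>. blinfun_apply (A x) \<sigma> \<bullet> \<tau> = \<sigma> \<bullet> blinfun_apply (A x) \<tau>) \<and>
     (\<exists>\<beta>. \<forall>x\<in>\<Omega>. norm (A x) \<le> \<beta>) \<and>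
     (\<exists>\<alpha>>0. \<forall>x\<in>\<Omega>. \<forall>\<tau>. blinfun_apply (A x) \<tau> \<bullet> \<tau> \<ge> \<alpha> * (norm \<tau>)\<^sup>2) \<and>
     (\<forall>E\<in>T. \<exists>A'. continuous_on E A' \<and> (\<forall>x\<in>interior E. A x = A' x))"

definition block_matrix ::
  "real^'a^'a \<Rightarrow> real^'b^'a \<Rightarrow> real^'a^'b \<Rightarrow> real^'b^'b \<Rightarrow> real^('a + 'b)^('a + 'b)" where
  "block_matrix P Q R S = (\<chi> i j. case i of
       Inl a \<Rightarrow> (case j of Inl a' \<Rightarrow> P $ a $ a' | Inr b' \<Rightarrow> Q $ a $ b')
     | Inr b \<Rightarrow> (case j of Inl a' \<Rightarrow> R $ b $ a' | Inr b' \<Rightarrow> S $ b $ b'))"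

text \<open>The blocks are the fibres of the labelling \<open>blk\<close> of the indices.\<close>

definition block_diagonal :: "('n \<Rightarrow> 'k) \<Rightarrow> real^'n^'n \<Rightarrow> bool" where
  "block_diagonal blk M \<longleftrightarrow> (\<forall>i j. blk i \<noteq> blk j \<longrightarrow> M $ i $ j = 0)"

definition sym_pos_def :: "real^'n^'n \<Rightarrow> bool" where
  "sym_pos_def M \<longleftrightarrow> transpose M = M \<and> (\<forall>x. x \<noteq> 0 \<longrightarrow> x \<bullet> (M *v x) > 0)"

end

(* For every mesh vertex a stress is determined there by its normal components on the facets of each
   element, so the basis field of a degree of freedom vanishes at all other vertices; this gives the
   block structure, and twelve facets meet at an interior vertex because the eight octants around it
   fill a small ball.

   Positive definiteness reduces to the statement that a pair (u, W) annihilated by all stresses is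
   zero. Testing with the basis field of (f, x) gives u_A - W(x) c_A = u_B - W(x) c_B for the centres
   of the two elements at f, or u_A + W(x) (c_f - c_A) = 0 if f belongs to A only. Hence W(x) n_f is the
   same at all vertices x of f. As at most one facet of an element lies on the Neumann boundary, W is
   constant on each element, hence globally, and u is an infinitesimal rigid motion that vanishes at the
   centres of the remaining boundary facets. Let w be the rotation axis of W and x a vertex of the
   convex hull of the domain maximizing w.x. At least two of the three boundary facets at x are not
   Neumann facets, and the difference of their centres would be parallel to w, against the maximality. *)

theory Submission
  imports Defs
begin

section \<open>Cuboids\<close>

text \<open>All definiteness claims rest on two facts: the stress matrix is positive definite, and
  the transposes of the two coupling matrices are jointly injective. Block matrix and Schur
  complement then have quadratic forms inherited from the inverse stress matrix. The obstacle is to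
  express both couplings by vertex values. The divergence is a weak one, selected by choice, so its
  element integrals are extracted by testing with cutoffs instead of a boundary formula. For an
  enhanced Raviart-Thomas field the integral is a signed sum of vertex normal components, since the
  curls add no divergence. The Frobenius product with a rotation splits along the three orthogonal
  edges. Both sums carry the same weight, a quarter of a facet area up to sign, except that the
  rotation acts on the offset from the element centre to the facet centre; this is why centres
  appear. Facets are sets and the vertex numberings of neighbours are unrelated, so centre and area
  of a facet have to be shown to depend on the set alone.\<close>

definition edge :: "(nat \<Rightarrow> real^3) \<Rightarrow> 3 \<Rightarrow> real^3" where
  "edge \<rho> d = (vector [\<rho> 2 - \<rho> 1, \<rho> 4 - \<rho> 1, \<rho> 5 - \<rho> 1] :: real^3^3) $ d"

text \<open>The inverse of \<open>elem_map\<close> on a cuboid: the edges are orthogonal, so every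
  local coordinate is a scaled projection.\<close>

definition lcoord :: "(nat \<Rightarrow> real^3) \<Rightarrow> real^3 \<Rightarrow> real^3" where
  "lcoord \<rho> x = (\<chi> d. edge \<rho> d \<bullet> (x - \<rho> 1) / (edge \<rho> d \<bullet> edge \<rho> d))"

lemma elem_map_sum: "elem_map \<rho> x = \<rho> 1 + (\<Sum>d\<in>UNIV. x $ d *\<^sub>R edge \<rho> d)"
  by (simp add: elem_map_def edge_def sum_3 add_ac)

lemma elem_DF_mult: "elem_DF \<rho> *v y = (\<Sum>d\<in>UNIV. y $ d *\<^sub>R edge \<rho> d)"
  by (simp add: elem_DF_def matrix_vector_mult_def transpose_def edge_def vec_eq_iff sum_3 mult_ac)

lemma elem_map_DF: "elem_map \<rho> y = \<rho> 1 + elem_DF \<rho> *v y"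
  by (simp add: elem_map_sum elem_DF_mult)

lemma elem_DF_column: "elem_DF \<rho> $ i $ j = edge \<rho> j $ i"
  by (simp add: elem_DF_def edge_def transpose_def)

lemma cuboid_edge_nonzero:
  assumes "cuboid \<rho> E" shows "edge \<rho> d \<noteq> 0"
  using assms exhaust_3[of d] by (auto simp: cuboid_def edge_def)

lemma cuboid_edge_orthogonal:
  assumes "cuboid \<rho> E" "j \<noteq> k" shows "edge \<rho> j \<bullet> edge \<rho> k = 0"
  using assms exhaust_3[of j] exhaust_3[of k]
  by (auto simp: cuboid_def edge_def orthogonal_def inner_commute)

lemma cuboid_edge_inner_sum:
  assumes "cuboid \<rho> E"
  shows "edge \<rho> k \<bullet> (\<Sum>d\<in>UNIV. y d *\<^sub>R edge \<rho> d) = y k * (edge \<rho> k \<bullet> edge \<rho> k)"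
proof -
  have "edge \<rho> k \<bullet> (\<Sum>d\<in>UNIV. y d *\<^sub>R edge \<rho> d) = (\<Sum>d\<in>UNIV. if d = k then y k * (edge \<rho> k \<bullet> edge \<rho> k) else 0)"
    unfolding inner_sum_right by (rule sum.cong) (auto simp: cuboid_edge_orthogonal[OF assms])
  then show ?thesis by simp
qed

lemma lcoord_elem_map [simp]:
  assumes "cuboid \<rho> E" shows "lcoord \<rho> (elem_map \<rho> y) = y"
  using cuboid_edge_nonzero[OF assms]
  by (simp add: lcoord_def elem_map_sum cuboid_edge_inner_sum[OF assms] vec_eq_iff)

lemma cuboid_DF_inj:
  assumes "cuboid \<rho> E" shows "inj ((*v) (elem_DF \<rho>))"
proof (rule injI)
  fix x y assume "elem_DF \<rho> *v x = elem_DF \<rho> *v y"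
  then have "elem_map \<rho> x = elem_map \<rho> y" by (simp add: elem_map_DF)
  then show "x = y" by (metis lcoord_elem_map[OF assms])
qed

text \<open>An injective linear map of a finite-dimensional space to itself is onto, so the left
  inverse is also a right inverse.\<close>

lemma elem_map_lcoord [simp]:
  assumes "cuboid \<rho> E" shows "elem_map \<rho> (lcoord \<rho> x) = x"
proof -
  have "surj ((*v) (elem_DF \<rho>))"
    using cuboid_DF_inj[OF assms] by (simp add: linear_injective_imp_surjective)
  then obtain y where "x - \<rho> 1 = elem_DF \<rho> *v y" by (metis surjD)
  then have "x = elem_map \<rho> y" by (simp add: elem_map_DF algebra_simps)
  then show ?thesis by (simp add: lcoord_elem_map[OF assms])
qed

lemma cuboid_expansion:
  assumes "cuboid \<rho> E"
  shows "x = (\<Sum>d\<in>UNIV. (edge \<rho> d \<bullet> x / (edge \<rho> d \<bullet> edge \<rho> d)) *\<^sub>R edge \<rho> d)"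
  using elem_map_lcoord[OF assms, of "\<rho> 1 + x"] by (simp add: elem_map_sum lcoord_def)

lemma cuboid_eq_0_iff:
  assumes "cuboid \<rho> E" "\<And>d. edge \<rho> d \<bullet> x = 0" shows "x = 0"
  using cuboid_expansion[OF assms(1), of x] assms(2) by simp

lemma cuboid_iff:
  assumes "cuboid \<rho> E"
  shows "x \<in> E \<longleftrightarrow> (\<forall>d. 0 \<le> lcoord \<rho> x $ d \<and> lcoord \<rho> x $ d \<le> 1)"
proof -
  have "x \<in> E \<longleftrightarrow> lcoord \<rho> x \<in> ref_cube"
    using assms lcoord_elem_map[OF assms] elem_map_lcoord[OF assms]
    unfolding cuboid_def by (metis image_iff)
  then show ?thesis by (auto simp: ref_cube_def mem_box_cart)
qed

lemma cuboid_linear_image: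
  assumes "cuboid \<rho> E" shows "E = (+) (\<rho> 1) ` ((*v) (elem_DF \<rho>) ` ref_cube)"
proof -
  have "E = elem_map \<rho> ` ref_cube" using assms by (simp only: cuboid_def)
  then show ?thesis by (simp add: elem_map_DF image_image)
qed

section \<open>Interior, limits from within and volume of a cuboid\<close>

lemma cuboid_interior_image:
  assumes "cuboid \<rho> E" shows "interior E = elem_map \<rho> ` interior ref_cube"
proof -
  note cuboid_linear_image[OF assms]
  then have "interior E = (+) (\<rho> 1) ` ((*v) (elem_DF \<rho>) ` interior ref_cube)"
    by (simp add: interior_translation interior_injective_linear_image cuboid_DF_inj[OF assms])
  then show ?thesis by (auto simp: elem_map_DF image_image)
qed

lemma mem_interior_ref_cube: "y \<in> interior ref_cube \<longleftrightarrow> (\<forall>d. 0 < y $ d \<and> y $ d < 1)"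
  by (simp add: ref_cube_def mem_box_cart)

lemma cuboid_interior_iff:
  assumes "cuboid \<rho> E"
  shows "x \<in> interior E \<longleftrightarrow> (\<forall>d. 0 < lcoord \<rho> x $ d \<and> lcoord \<rho> x $ d < 1)"
  using lcoord_elem_map[OF assms] elem_map_lcoord[OF assms]
  by (metis (no_types, lifting) cuboid_interior_image[OF assms] image_iff mem_interior_ref_cube)

lemma continuous_on_elem_map [continuous_intros]: "continuous_on S (elem_map \<rho>)"
  unfolding elem_map_def by (intro continuous_intros)

lemma continuous_on_lcoord [continuous_intros]: "continuous_on S (lcoord \<rho>)"
  unfolding lcoord_def divide_inverse by (intro continuous_intros)

lemma cuboid_compact:
  assumes "cuboid \<rho> E" shows "compact E"
proof -
  have "E = elem_map \<rho> ` ref_cube" using assms by (simp only: cuboid_def)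
  then show ?thesis by (simp add: ref_cube_def compact_continuous_image continuous_on_elem_map)
qed

lemma lcoord_nth: "lcoord \<rho> x $ d = edge \<rho> d \<bullet> (x - \<rho> 1) / (edge \<rho> d \<bullet> edge \<rho> d)"
  by (simp add: lcoord_def)

lemma lcoord_add:
  assumes "cuboid \<rho> E"
  shows "lcoord \<rho> (x + t *\<^sub>R edge \<rho> k) $ d = lcoord \<rho> x $ d + (if d = k then t else 0)"
proof -
  have "x + t *\<^sub>R edge \<rho> k - \<rho> 1 = (x - \<rho> 1) + t *\<^sub>R edge \<rho> k" by simp
  then show ?thesis using cuboid_edge_nonzero[OF assms] cuboid_edge_orthogonal[OF assms, of d k]
    unfolding lcoord_nth by (simp only: inner_add_right add_divide_distrib) simp
qed

lemma cuboid_convex: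
  assumes "cuboid \<rho> E" shows "convex E"
proof -
  have "convex ((+) (\<rho> 1) ` ((*v) (elem_DF \<rho>) ` ref_cube))"
    by (simp only: convex_translation_eq) (simp add: ref_cube_def convex_linear_image)
  then show ?thesis using cuboid_linear_image[OF assms] by simp
qed

lemma cuboid_interior_nonempty:
  assumes "cuboid \<rho> E" shows "interior E \<noteq> {}"
proof -
  have "elem_map \<rho> (\<chi> d. 1/2) \<in> interior E"
    by (simp add: cuboid_interior_iff[OF assms] lcoord_elem_map[OF assms])
  then show ?thesis by blast
qed

lemma cuboid_closure_interior:
  assumes "cuboid \<rho> E" shows "closure (interior E) = E"
  using convex_closure_interior[OF cuboid_convex[OF assms] cuboid_interior_nonempty[OF assms]]
    cuboid_compact[OF assms] by (simp add: compact_imp_closed)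

lemma cuboid_islimpt:
  assumes "cuboid \<rho> E" "x \<in> E" shows "at x within interior E \<noteq> bot"
proof (cases "x \<in> interior E")
  case True
  then show ?thesis by (metis at_within_open open_interior at_neq_bot)
next
  case False
  have "x \<in> closure (interior E)" using assms cuboid_closure_interior by blast
  with False have "x islimpt interior E" by (simp add: closure_def)
  then show ?thesis by (simp add: trivial_limit_within)
qed

text \<open>\<open>Lim\<close> is informative only where a unique limit exists. A continuous
  representative on the closed element supplies existence; uniqueness holds because every point of a
  cuboid is approached from its interior.\<close>

lemma from_within_eqI:
  fixes g :: "real^3 \<Rightarrow> 'b::t2_space"
  assumes "cuboid \<rho> E" "x \<in> E" "continuous_on E h" "\<And>y. y \<in> interior E \<Longrightarrow> g y = h y"
  shows "from_within E g x = h x"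
  unfolding from_within_def
proof (rule tendsto_Lim)
  show "at x within interior E \<noteq> bot" by (rule cuboid_islimpt[OF assms(1,2)])
  have "(h \<longlongrightarrow> h x) (at x within interior E)"
    using assms(2,3) interior_subset by (meson continuous_on_def tendsto_within_subset)
  then show "(g \<longlongrightarrow> h x) (at x within interior E)"
    by (rule Lim_transform_eventually) (auto simp: eventually_at_filter assms(4))
qed

text \<open>Gram determinant: the product of \<open>elem_DF\<close> with its transpose is diagonal,
  with the squared edge lengths as entries.\<close>

lemma cuboid_det:
  assumes "cuboid \<rho> E"
  shows "elem_J \<rho> = (\<Prod>d\<in>UNIV. norm (edge \<rho> d))"
proof -
  have "transpose (elem_DF \<rho>) ** elem_DF \<rho> = (\<chi> i j. edge \<rho> i \<bullet> edge \<rho> j)"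
    by (simp add: matrix_matrix_mult_def transpose_def elem_DF_column vec_eq_iff inner_vec_def)
  moreover have "det (\<chi> i j. edge \<rho> i \<bullet> edge \<rho> j) = (\<Prod>i\<in>UNIV. edge \<rho> i \<bullet> edge \<rho> i)"
    by (subst det_diagonal) (auto simp: cuboid_edge_orthogonal[OF assms])
  ultimately have "(det (elem_DF \<rho>))\<^sup>2 = (\<Prod>i\<in>UNIV. edge \<rho> i \<bullet> edge \<rho> i)"
    by (metis (no_types) det_mul[of "transpose (elem_DF \<rho>)"] det_transpose[of "elem_DF \<rho>"] power2_eq_square)
  also have "\<dots> = (\<Prod>d\<in>UNIV. norm (edge \<rho> d))\<^sup>2"
    by (simp add: prod_power_distrib power2_norm_eq_inner)
  finally show ?thesis unfolding elem_J_def
    by (metis abs_of_nonneg power2_abs power2_eq_iff_nonneg abs_ge_zero norm_ge_zero prod_nonneg)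
qed

lemma cuboid_measure:
  assumes "cuboid \<rho> E" shows "measure lebesgue E = elem_J \<rho>"
proof -
  note cuboid_linear_image[OF assms]
  then have "measure lebesgue E = measure lebesgue ((*v) (elem_DF \<rho>) ` ref_cube)"
    by (metis measure_translation)
  also have "\<dots> = \<bar>det (elem_DF \<rho>)\<bar> * measure lebesgue ref_cube"
    using measure_linear_image[of "(*v) (elem_DF \<rho>)" ref_cube] by (simp add: ref_cube_def)
  also have "measure lebesgue ref_cube = 1"
    by (simp add: ref_cube_def content_cbox_cart interval_ne_empty_cart)
  finally show ?thesis by (simp add: elem_J_def)
qed

lemma cuboid_J_pos:
  assumes "cuboid \<rho> E" shows "elem_J \<rho> > 0"
  using cuboid_edge_nonzero[OF assms] by (simp add: cuboid_det[OF assms] prod_pos)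

section \<open>Facets and extreme points of a cuboid\<close>

definition box_face :: "(nat \<Rightarrow> real^3) \<Rightarrow> (real^3) set \<Rightarrow> 3 \<Rightarrow> real \<Rightarrow> (real^3) set" where
  "box_face \<rho> E j s = {x \<in> E. lcoord \<rho> x $ j = s}"

text \<open>A local coordinate is an affine functional with values between 0 and 1 on
  \<open>E\<close>, so its extreme level sets lie on supporting hyperplanes.\<close>

lemma box_face_face_of:
  assumes "cuboid \<rho> E" "s \<in> {0, 1}" shows "box_face \<rho> E j s face_of E"
proof -
  define a where "a = edge \<rho> j /\<^sub>R (edge \<rho> j \<bullet> edge \<rho> j)"
  define b where "b = a \<bullet> \<rho> 1"
  have lc: "lcoord \<rho> x $ j = a \<bullet> x - b" for x
    by (simp add: lcoord_def a_def b_def inner_diff_right diff_divide_distrib divide_inverse mult.commute algebra_simps)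
  have bounds: "b \<le> a \<bullet> x" "a \<bullet> x \<le> b + 1" if "x \<in> E" for x
    using that[unfolded cuboid_iff[OF assms(1)], rule_format, of j] by (simp_all add: lc)
  show ?thesis
  proof (cases "s = 0")
    case True
    have "box_face \<rho> E j s = E \<inter> {x. a \<bullet> x = b}" by (auto simp: box_face_def lc True)
    then show ?thesis
      by (simp add: face_of_Int_supporting_hyperplane_ge cuboid_convex[OF assms(1)] bounds)
  next
    case False
    then have "s = 1" using assms by auto
    then have "box_face \<rho> E j s = E \<inter> {x. a \<bullet> x = b + 1}" by (auto simp: box_face_def lc)
    then show ?thesis
      by (simp add: face_of_Int_supporting_hyperplane_le cuboid_convex[OF assms(1)] bounds)
  qed
qed

lemma cuboid_aff_dim:
  assumes "cuboid \<rho> E" shows "aff_dim E = 3"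
  using aff_dim_nonempty_interior[OF cuboid_interior_nonempty[OF assms]] by simp

lemma box_face_facet_of:
  assumes "cuboid \<rho> E" "s \<in> {0, 1}" shows "box_face \<rho> E j s facet_of E"
proof -
  let ?F = "box_face \<rho> E j s"
  have face: "?F face_of E" by (rule box_face_face_of[OF assms])
  \<comment> \<open>\<open>p\<close> lies opposite to \<open>q\<close> across the box. Adding this
    single point to the face already spans \<open>E\<close>, so the face has codimension
    one.\<close>
  define p where "p = elem_map \<rho> (\<chi> d. if d = j then 1 - s else 0)"
  define q where "q = elem_map \<rho> (\<chi> d. if d = j then s else 0)"
  have s: "0 \<le> s" "s \<le> 1" using assms(2) by auto
  have q: "q \<in> ?F" using s by (simp add: q_def box_face_def cuboid_iff[OF assms(1)] lcoord_elem_map[OF assms(1)])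
  have pE: "p \<in> E" using s by (simp add: p_def cuboid_iff[OF assms(1)] lcoord_elem_map[OF assms(1)])
  have "p \<notin> ?F" using assms(2) by (auto simp: p_def box_face_def lcoord_elem_map[OF assms(1)])
  with pE have "?F \<noteq> E" by blast
  then have lt: "aff_dim ?F < aff_dim E"
    by (rule face_of_aff_dim_lt[OF cuboid_convex[OF assms(1)] face])
  have pq: "p - q = (1 - 2 * s) *\<^sub>R edge \<rho> j"
    by (simp add: p_def q_def elem_map_sum flip: sum_subtractf scaleR_diff_left)
       (subst sum.cong[of UNIV UNIV _ "\<lambda>d. if d = j then (1 - 2 * s) *\<^sub>R edge \<rho> j else 0"], simp_all)
  have "E \<subseteq> affine hull (insert p ?F)"
  proof
    fix x assume x: "x \<in> E"
    define t where "t = lcoord \<rho> x $ j - s"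
    define x' where "x' = x + (-t) *\<^sub>R edge \<rho> j"
    have x': "x' \<in> ?F" using x s
      by (auto simp: x'_def box_face_def cuboid_iff[OF assms(1)] lcoord_add[OF assms(1)] t_def)
    have "x = x' + (t / (1 - 2 * s)) *\<^sub>R (p - q)"
      using assms(2) by (auto simp: x'_def pq)
    also have "\<dots> \<in> affine hull (insert p ?F)"
      by (rule mem_affine_3_minus) (use x' q in \<open>auto simp: hull_inc\<close>)
    finally show "x \<in> affine hull (insert p ?F)" .
  qed
  then have "aff_dim E \<le> aff_dim (insert p ?F)"
    by (metis aff_dim_affine_hull aff_dim_subset)
  also have "\<dots> \<le> aff_dim ?F + 1" by (simp add: aff_dim_insert)
  finally show ?thesis using lt face q by (auto simp: facet_of_def)
qed

text \<open>A relative interior point of a facet lies on the boundary of the box, hence on some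
  \<open>box_face\<close>. A face that meets the facet in such a point contains it, and equal
  dimension forces equality.\<close>

lemma facet_of_cuboid_iff:
  assumes "cuboid \<rho> E"
  shows "f facet_of E \<longleftrightarrow> (\<exists>j. \<exists>s\<in>{0, 1}. f = box_face \<rho> E j s)"
proof
  assume f: "f facet_of E"
  then have face: "f face_of E" and ne: "f \<noteq> {}" and dim: "aff_dim f = 2"
    using cuboid_aff_dim[OF assms] by (auto simp: facet_of_def)
  have fE: "f \<subseteq> E" using face by (rule face_of_imp_subset)
  have "f \<noteq> E" using dim cuboid_aff_dim[OF assms] by auto
  then have disj: "f \<inter> interior E = {}"
    using face_of_disjoint_interior[OF face] by simp
  obtain z where z: "z \<in> rel_interior f"
    using rel_interior_eq_empty[OF face_of_imp_convex[OF face]] ne by blast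
  then have zf: "z \<in> f" using rel_interior_subset by blast
  with fE have zE: "z \<in> E" by blast
  from zf disj have "z \<notin> interior E" by blast
  then obtain j where "\<not> (0 < lcoord \<rho> z $ j \<and> lcoord \<rho> z $ j < 1)"
    using cuboid_interior_iff[OF assms] by blast
  then obtain s where s: "s \<in> {0, 1}" "lcoord \<rho> z $ j = s"
    using zE cuboid_iff[OF assms] by (metis insert_iff less_eq_real_def)
  let ?F = "box_face \<rho> E j s"
  have F: "?F facet_of E" by (rule box_face_facet_of[OF assms s(1)])
  have zF: "z \<in> ?F" using zE s by (simp add: box_face_def)
  have sub: "f \<subseteq> ?F"
    using subset_of_face_of[of ?F E f] F fE z zF by (auto simp: facet_of_def)
  have fF: "f face_of ?F" using face_of_subset[OF face sub] F by (simp add: facet_of_imp_subset)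
  have "f = ?F"
  proof (rule ccontr)
    assume "f \<noteq> ?F"
    moreover have "convex ?F" using F by (auto simp: facet_of_def face_of_imp_convex)
    ultimately have "aff_dim f < aff_dim ?F" using face_of_aff_dim_lt[OF _ fF] by blast
    then show False using F dim cuboid_aff_dim[OF assms] by (simp add: facet_of_def)
  qed
  then show "\<exists>j. \<exists>s\<in>{0, 1}. f = box_face \<rho> E j s" using s by blast
qed (use box_face_facet_of[OF assms] in blast)

lemma extreme_point_of_cuboid_iff:
  assumes "cuboid \<rho> E"
  shows "x extreme_point_of E \<longleftrightarrow> (\<forall>d. lcoord \<rho> x $ d \<in> {0, 1})"
proof
  assume x: "x extreme_point_of E"
  then have xE: "x \<in> E" by (simp add: extreme_point_of_def)
  show "\<forall>d. lcoord \<rho> x $ d \<in> {0, 1}"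
  proof (rule allI, rule ccontr)
    fix d assume "lcoord \<rho> x $ d \<notin> {0, 1}"
    then have c: "0 < lcoord \<rho> x $ d" "lcoord \<rho> x $ d < 1"
      using xE cuboid_iff[OF assms] by (auto simp: less_le)
    \<comment> \<open>The largest displacement along the edge that stays in the box in both
      directions, which makes \<open>x\<close> a proper midpoint.\<close>
    define t where "t = min (lcoord \<rho> x $ d) (1 - lcoord \<rho> x $ d)"
    have t: "t > 0" "t \<le> lcoord \<rho> x $ d" "t \<le> 1 - lcoord \<rho> x $ d" using c by (auto simp: t_def)
    have a: "x + t *\<^sub>R edge \<rho> d \<in> E" "x + (-t) *\<^sub>R edge \<rho> d \<in> E"
      using xE t by (auto simp: cuboid_iff[OF assms] lcoord_add[OF assms] simp del: scaleR_minus_left)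
    have "x + t *\<^sub>R edge \<rho> d \<noteq> x + (-t) *\<^sub>R edge \<rho> d"
    proof
      assume "x + t *\<^sub>R edge \<rho> d = x + (-t) *\<^sub>R edge \<rho> d"
      then have "lcoord \<rho> (x + t *\<^sub>R edge \<rho> d) $ d = lcoord \<rho> (x + (-t) *\<^sub>R edge \<rho> d) $ d"
        by (rule arg_cong)
      then show False unfolding lcoord_add[OF assms] using t by simp
    qed
    moreover have "x = (1 - 1/2) *\<^sub>R (x + t *\<^sub>R edge \<rho> d) + (1/2) *\<^sub>R (x + (-t) *\<^sub>R edge \<rho> d)"
      by (simp add: algebra_simps flip: scaleR_add_left)
    ultimately have "x \<in> open_segment (x + t *\<^sub>R edge \<rho> d) (x + (-t) *\<^sub>R edge \<rho> d)"
      unfolding in_segment by (intro conjI exI[of _ "1/2"]) simp_all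
    then show False using x a by (auto simp: extreme_point_of_def)
  qed
next
  assume *: "\<forall>d. lcoord \<rho> x $ d \<in> {0, 1}"
  \<comment> \<open>A corner is cut out by the three facets through it, and an intersection of faces
    is a face.\<close>
  have "(\<Inter>d\<in>UNIV. box_face \<rho> E d (lcoord \<rho> x $ d)) = {x}"
  proof -
    have "x \<in> E" unfolding cuboid_iff[OF assms] using * by (metis insertE order.refl singletonD zero_le_one)
    moreover have "y = x" if "\<And>d. lcoord \<rho> y $ d = lcoord \<rho> x $ d" for y
      using that elem_map_lcoord[OF assms] by (metis vec_eq_iff)
    ultimately show ?thesis by (auto simp: box_face_def)
  qed
  moreover have "(\<Inter>d\<in>UNIV. box_face \<rho> E d (lcoord \<rho> x $ d)) face_of E"
    by (rule face_of_Inter) (use * box_face_face_of[OF assms] in auto)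
  ultimately show "x extreme_point_of E" by (simp add: face_of_singleton)
qed

section \<open>Symmetric positive definite and block-diagonal matrices\<close>

lemma sym_pos_def_invertible:
  fixes M :: "real^'n^'n"
  assumes "sym_pos_def M" shows "invertible M"
proof -
  have "x = 0" if "M *v x = 0" for x
  proof (rule ccontr)
    assume "x \<noteq> 0"
    then have "x \<bullet> (M *v x) > 0" using assms by (simp add: sym_pos_def_def)
    then show False by (simp add: that)
  qed
  then show ?thesis
    by (simp add: invertible_left_inverse matrix_left_invertible_ker)
qed

lemma matrix_inv_mult:
  fixes M :: "real^'n^'n"
  assumes "invertible M"
  shows "matrix_inv M ** M = mat 1" "M ** matrix_inv M = mat 1"
proof -
  have "M ** matrix_inv M = mat 1 \<and> matrix_inv M ** M = mat 1"
    using assms unfolding invertible_def matrix_inv_def by (rule someI_ex)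
  then show "matrix_inv M ** M = mat 1" "M ** matrix_inv M = mat 1" by auto
qed

lemma sym_pos_def_matrix_inv:
  fixes M :: "real^'n^'n"
  assumes "sym_pos_def M" shows "sym_pos_def (matrix_inv M)"
proof -
  let ?N = "matrix_inv M"
  have sym: "transpose M = M" and pos: "\<And>x. x \<noteq> 0 \<Longrightarrow> x \<bullet> (M *v x) > 0"
    using assms by (auto simp: sym_pos_def_def)
  note inv = matrix_inv_mult[OF sym_pos_def_invertible[OF assms]]
  have "transpose ?N ** M = transpose (M ** ?N)" by (simp add: matrix_transpose_mul sym)
  then have "transpose ?N ** M = mat 1" by (simp add: inv transpose_mat)
  then have "transpose ?N ** (M ** ?N) = ?N" by (simp add: matrix_mul_assoc)
  then have "transpose ?N = ?N" by (simp add: inv)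
  moreover have "x \<bullet> (?N *v x) > 0" if "x \<noteq> 0" for x
  proof -
    have x: "x = M *v (?N *v x)" by (simp add: matrix_vector_mul_assoc inv)
    then have "?N *v x \<noteq> 0" using that by (metis matrix_vector_mult_0_right)
    from pos[OF this] show ?thesis by (metis x inner_commute)
  qed
  ultimately show ?thesis by (simp add: sym_pos_def_def)
qed

lemma block_matrix_nth [simp]:
  "block_matrix P Q R S $ Inl a $ Inl a' = P $ a $ a'"
  "block_matrix P Q R S $ Inl a $ Inr b' = Q $ a $ b'"
  "block_matrix P Q R S $ Inr b $ Inl a' = R $ b $ a'"
  "block_matrix P Q R S $ Inr b $ Inr b' = S $ b $ b'"
  by (simp_all add: block_matrix_def)

lemma sum_over_sum_type:
  fixes f :: "'a::finite + 'b::finite \<Rightarrow> real"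
  shows "sum f UNIV = (\<Sum>a\<in>UNIV. f (Inl a)) + (\<Sum>b\<in>UNIV. f (Inr b))"
  by (simp add: sum.Plus flip: UNIV_Plus_UNIV)

lemma block_matrix_quadratic_form:
  fixes P :: "real^'a^'a" and S :: "real^'b^'b"
  defines "x1 \<equiv> \<lambda>x :: real^('a + 'b). \<chi> a. x $ Inl a" and "x2 \<equiv> \<lambda>x :: real^('a + 'b). \<chi> b. x $ Inr b"
  shows "x \<bullet> (block_matrix P Q R S *v x) =
    x1 x \<bullet> (P *v x1 x + Q *v x2 x) + x2 x \<bullet> (R *v x1 x + S *v x2 x)"
  by (simp add: inner_vec_def matrix_vector_mult_def sum_over_sum_type x1_def x2_def)

lemma congruence_inner:
  fixes N :: "real^'d^'d" and B :: "real^'d^'a" and C :: "real^'d^'b"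
  shows "x \<bullet> ((B ** N ** transpose C) *v y) = (transpose B *v x) \<bullet> (N *v (transpose C *v y))"
  by (simp add: dot_lmul_matrix flip: matrix_vector_mul_assoc)

lemma transpose_congruence:
  fixes N :: "real^'d^'d" and B :: "real^'d^'a" and C :: "real^'d^'b"
  assumes "transpose N = N"
  shows "transpose (B ** N ** transpose C) = C ** N ** transpose B"
  by (simp add: matrix_transpose_mul matrix_mul_assoc assms)

lemma congruence_nth_swap:
  fixes N :: "real^'d^'d" and B :: "real^'d^'a" and C :: "real^'d^'b"
  assumes "transpose N = N"
  shows "(B ** N ** transpose C) $ i $ j = (C ** N ** transpose B) $ j $ i"
proof -
  have "(B ** N ** transpose C) $ i $ j = transpose (C ** N ** transpose B) $ i $ j"
    by (simp only: transpose_congruence[OF assms])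
  then show ?thesis by (simp add: transpose_def)
qed

text \<open>The quadratic form of the block matrix at a pair of vectors is that of \<open>N\<close>
  at the sum of their images under the two transposes, and injectivity keeps this sum away from
  zero.\<close>

lemma sym_pos_def_block_congruence:
  fixes N :: "real^'d^'d" and B :: "real^'d^'a" and C :: "real^'d^'b"
  assumes N: "sym_pos_def N"
    and inj: "\<And>x y. transpose B *v x + transpose C *v y = 0 \<Longrightarrow> x = 0 \<and> y = 0"
  shows "sym_pos_def (block_matrix (B ** N ** transpose B) (B ** N ** transpose C)
    (C ** N ** transpose B) (C ** N ** transpose C))" (is "sym_pos_def ?M")
proof -
  have sym: "transpose N = N" using N by (simp add: sym_pos_def_def)
  have "?M $ i $ j = ?M $ j $ i" for i j
    by (cases i; cases j) (simp_all only: block_matrix_nth, (rule congruence_nth_swap[OF sym])+)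
  then have "transpose ?M = ?M" by (simp add: transpose_def vec_eq_iff)
  moreover have "x \<bullet> (?M *v x) > 0" if "x \<noteq> 0" for x
  proof -
    define x1 where "x1 = (\<chi> a. x $ Inl a)"
    define x2 where "x2 = (\<chi> b. x $ Inr b)"
    define z where "z = transpose B *v x1 + transpose C *v x2"
    have "x1 \<noteq> 0 \<or> x2 \<noteq> 0"
    proof (rule ccontr)
      assume "\<not> (x1 \<noteq> 0 \<or> x2 \<noteq> 0)"
      then have "x $ i = 0" for i by (cases i) (auto simp: x1_def x2_def vec_eq_iff)
      with that show False by (simp add: vec_eq_iff)
    qed
    then have "z \<noteq> 0" using inj unfolding z_def by blast
    then have "z \<bullet> (N *v z) > 0" using N by (simp add: sym_pos_def_def)
    also have "z \<bullet> (N *v z) = x \<bullet> (?M *v x)"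
      unfolding block_matrix_quadratic_form
      by (fold x1_def x2_def)
         (simp add: inner_add_right inner_add_left congruence_inner z_def matrix_vector_right_distrib)
    finally show ?thesis .
  qed
  ultimately show ?thesis by (simp add: sym_pos_def_def)
qed

lemma sym_pos_def_congruence:
  fixes N :: "real^'d^'d" and C :: "real^'d^'b"
  assumes N: "sym_pos_def N" and inj: "\<And>y. transpose C *v y = 0 \<Longrightarrow> y = 0"
  shows "sym_pos_def (C ** N ** transpose C)"
proof -
  have "transpose (C ** N ** transpose C) = C ** N ** transpose C"
    by (rule transpose_congruence) (use N in \<open>simp add: sym_pos_def_def\<close>)
  then show ?thesis
    using assms unfolding sym_pos_def_def congruence_inner by blast
qed

text \<open>The form of the Schur complement at \<open>x\<close> is the full block form at
  \<open>(x, y)\<close> for the \<open>y\<close> that solves the second block row.\<close>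

lemma sym_pos_def_Schur_complement:
  fixes N :: "real^'d^'d" and B :: "real^'d^'a" and C :: "real^'d^'b"
  assumes N: "sym_pos_def N"
    and inj: "\<And>x y. transpose B *v x + transpose C *v y = 0 \<Longrightarrow> x = 0 \<and> y = 0"
  shows "sym_pos_def (B ** N ** transpose B -
    B ** N ** transpose C ** matrix_inv (C ** N ** transpose C) ** (C ** N ** transpose B))"
    (is "sym_pos_def (?P - ?Q ** ?K ** ?R)")
proof -
  let ?S = "C ** N ** transpose C"
  have sym: "transpose N = N" using N by (simp add: sym_pos_def_def)
  have S: "sym_pos_def ?S"
    by (rule sym_pos_def_congruence[OF N]) (use inj[of 0] in \<open>simp del: transpose_matrix_vector\<close>)
  then have K: "transpose ?K = ?K"
    using sym_pos_def_matrix_inv by (auto simp: sym_pos_def_def)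
  note inv = matrix_inv_mult[OF sym_pos_def_invertible[OF S]]
  have trm: "transpose (X - Y) = transpose X - transpose Y" for X Y :: "real^'a^'a"
    by (simp add: transpose_def vec_eq_iff)
  have "transpose (?Q ** ?K ** ?R) = transpose ?R ** (transpose ?K ** transpose ?Q)"
    by (simp only: matrix_transpose_mul)
  also have "\<dots> = ?Q ** ?K ** ?R"
    by (simp only: transpose_congruence[OF sym] K matrix_mul_assoc)
  finally have "transpose (?P - ?Q ** ?K ** ?R) = ?P - ?Q ** ?K ** ?R"
    by (simp only: trm transpose_congruence[OF sym])
  moreover have "x \<bullet> ((?P - ?Q ** ?K ** ?R) *v x) > 0" if "x \<noteq> 0" for x
  proof -
    \<comment> \<open>The eliminated unknown as a function of \<open>x\<close>; it cancels the
      second block row.\<close>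
    define y where "y = - (?K *v (?R *v x))"
    define z where "z = transpose B *v x + transpose C *v y"
    have Sy: "?S *v y = - (?R *v x)"
      by (simp add: y_def linear_neg[OF matrix_vector_mul_linear]) (simp only: matrix_vector_mul_assoc matrix_mul_assoc inv matrix_mul_lid)
    have "z \<noteq> 0" using inj[of x y] that unfolding z_def by blast
    then have "0 < z \<bullet> (N *v z)" using N by (simp add: sym_pos_def_def)
    also have "\<dots> = x \<bullet> (?P *v x) + x \<bullet> (?Q *v y) + y \<bullet> (?R *v x + ?S *v y)"
      unfolding congruence_inner inner_add_right
      by (simp add: z_def inner_add_left inner_add_right matrix_vector_right_distrib)
    also have "\<dots> = x \<bullet> (?P *v x) + x \<bullet> (?Q *v y)" by (simp add: Sy)
    also have "?Q *v y = - ((?Q ** ?K ** ?R) *v x)"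
      by (simp add: y_def linear_neg[OF matrix_vector_mul_linear] matrix_vector_mul_assoc matrix_mul_assoc)
    finally show ?thesis by (simp add: matrix_vector_mult_diff_rdistrib inner_diff_right)
  qed
  ultimately show ?thesis by (simp add: sym_pos_def_def)
qed

text \<open>Column \<open>j\<close> of the inverse solves a linear system whose right-hand side
  lives in the block of \<open>j\<close>. Restricting the solution to that block still solves the
  system, so by uniqueness nothing was cut off.\<close>

lemma block_diagonal_matrix_inv:
  fixes M :: "real^'n^'n"
  assumes "block_diagonal blk M" "invertible M"
  shows "block_diagonal blk (matrix_inv M)"
  unfolding block_diagonal_def
proof (intro allI impI)
  fix i j assume ij: "blk i \<noteq> blk j"
  let ?N = "matrix_inv M"
  note inv = matrix_inv_mult[OF assms(2)]
  define x where "x = ?N *v axis j 1"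
  define y where "y = (\<chi> k. if blk k = blk j then x $ k else 0)"
  have Mx: "M *v x = axis j 1" by (simp add: x_def matrix_vector_mul_assoc inv)
  have "M *v y = axis j 1"
  proof (subst vec_eq_iff, rule allI)
    fix k
    have M0: "M $ k $ l = 0" if "blk k \<noteq> blk l" for l
      using assms(1) that by (simp add: block_diagonal_def)
    show "(M *v y) $ k = axis j 1 $ k"
    proof (cases "blk k = blk j")
      case True
      have "(M *v y) $ k = (M *v x) $ k"
        unfolding matrix_vector_mult_def y_def vec_lambda_beta
        by (rule sum.cong) (use True M0 in \<open>auto\<close>)
      then show ?thesis by (simp add: Mx)
    next
      case False
      have "(M *v y) $ k = 0"
        unfolding matrix_vector_mult_def y_def vec_lambda_beta
        by (rule sum.neutral) (use False M0 in \<open>auto\<close>)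
      then show ?thesis using False by (auto simp: axis_def)
    qed
  qed
  then have "?N *v (M *v y) = x" by (simp add: x_def)
  then have "y = x" by (simp add: matrix_vector_mul_assoc inv)
  moreover have "y $ i = 0" using ij by (simp add: y_def)
  ultimately have "x $ i = 0" by simp
  then show "?N $ i $ j = 0"
    by (simp add: x_def matrix_vector_mult_basis column_def)
qed

text \<open>A nonzero summand links a row label to a column label of \<open>C\<close>, that one
  through a block of \<open>N\<close> to another, and back; all four labels agree.\<close>

lemma block_diagonal_congruence:
  fixes N :: "real^'d^'d" and C :: "real^'d^'b"
  assumes "block_diagonal blk N" and C: "\<And>k j. C $ k $ j \<noteq> 0 \<Longrightarrow> blk' k = blk j"
  shows "block_diagonal blk' (C ** N ** transpose C)"
  unfolding block_diagonal_def
proof (intro allI impI)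
  fix k l assume kl: "blk' k \<noteq> blk' l"
  have "C $ k $ i * N $ i $ j * C $ l $ j = 0" for i j
    using assms(1) C[of k i] C[of l j] kl unfolding block_diagonal_def by force
  then show "(C ** N ** transpose C) $ k $ l = 0"
    by (simp only: matrix_matrix_mult_def transpose_def sum_distrib_right vec_lambda_beta sum.neutral_const)
qed

section \<open>Enhanced Raviart-Thomas fields\<close>

text \<open>Turns a sum over square-free monomials in three variables into its eight terms.\<close>

lemma sum_3_set:
  fixes f :: "3 set \<Rightarrow> real"
  shows "sum f UNIV = f {} + f {1} + f {2} + f {3} + f {1,2} + f {1,3} + f {2,3} + f {1,2,3}"
proof -
  let ?L = "[{}, {1}, {2}, {3}, {1,2}, {1,3}, {2,3}, {1,2,3}] :: 3 set list"
  have "S \<in> set ?L" for S :: "3 set"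
  proof -
    have "S = (if 1 \<in> S then {1} else {}) \<union> (if 2 \<in> S then {2} else {}) \<union> (if 3 \<in> S then {3} else {})"
      by (simp add: set_eq_iff forall_3)
    then show ?thesis
      by (cases "1 \<in> S"; cases "2 \<in> S"; cases "3 \<in> S") (simp_all add: insert_commute)
  qed
  then have "UNIV = set ?L" by (intro equalityI subsetI UNIV_I)
  then have "sum f UNIV = sum f (set ?L)" by (rule arg_cong)
  also have "\<dots> = sum_list (map f ?L)"
    by (rule sum.distinct_set_conv_list) (simp add: set_eq_iff forall_3)
  finally show ?thesis by (simp add: add_ac)
qed

text \<open>The polynomials of degree at most one in each variable without constant term. The
  monomial that \<open>B_hat\<close> omits from a component is covered by a zero
  coefficient.\<close>

definition multilin :: "(3 set \<Rightarrow> real) \<Rightarrow> real^3 \<Rightarrow> real" where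
  "multilin c x = c {1} * x$1 + c {2} * x$2 + c {3} * x$3 + c {1,2} * x$1 * x$2 +
     c {1,3} * x$1 * x$3 + c {2,3} * x$2 * x$3 + c {1,2,3} * x$1 * x$2 * x$3"

lemma B_hat_multilin:
  assumes "b \<in> B_hat" shows "\<exists>c. \<forall>x d. b x $ d = multilin (c d) x"
proof -
  obtain c :: "3 \<Rightarrow> 3 set \<Rightarrow> real"
    where b: "b = (\<lambda>x. \<chi> d. \<Sum>D\<in>UNIV - {{}, {d}}. c d D * (\<Prod>j\<in>D. x$j))"
    using assms unfolding B_hat_def by auto
  define c' where "c' d D = (if D \<in> {{}, {d}} then 0 else c d D)" for d D
  have "b x $ d = multilin (c' d) x" for x d
  proof -
    have "b x $ d = (\<Sum>D\<in>UNIV. c' d D * (\<Prod>j\<in>D. x$j))"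
      unfolding b vec_lambda_beta by (rule sum.mono_neutral_cong_left) (auto simp: c'_def)
    also have "\<dots> = c' d {} + multilin (c' d) x"
      unfolding sum_3_set multilin_def by (simp add: algebra_simps)
    finally show ?thesis by (simp add: c'_def)
  qed
  then show ?thesis by blast
qed

definition multilin_deriv :: "(3 set \<Rightarrow> real) \<Rightarrow> real^3 \<Rightarrow> real^3 \<Rightarrow> real" where
  "multilin_deriv c x h =
     (c {1} + c {1,2} * x$2 + c {1,3} * x$3 + c {1,2,3} * x$2 * x$3) * h$1 +
     (c {2} + c {1,2} * x$1 + c {2,3} * x$3 + c {1,2,3} * x$1 * x$3) * h$2 +
     (c {3} + c {1,3} * x$1 + c {2,3} * x$2 + c {1,2,3} * x$1 * x$2) * h$3"

lemma has_derivative_nth [derivative_intros]: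
  "((\<lambda>x. x $ i) has_derivative (\<lambda>h. h $ i)) (at (x :: real^3))"
  by (rule bounded_linear_imp_has_derivative) (rule bounded_linear_vec_nth)

lemma multilin_has_derivative [derivative_intros]:
  "(multilin c has_derivative multilin_deriv c x) (at x)"
  unfolding multilin_def[abs_def]
  by (rule derivative_eq_intros has_derivative_nth refl)+
     (simp add: multilin_deriv_def fun_eq_iff algebra_simps)

lemma vector3_has_derivative:
  fixes f :: "real^3 \<Rightarrow> real^3"
  assumes "\<And>i. ((\<lambda>x. f x $ i) has_derivative f' i) (at x)"
  shows "(f has_derivative (\<lambda>h. \<chi> i. f' i h)) (at x)"
  by (subst has_derivative_componentwise_within)
     (auto simp: Basis_vec_def inner_axis assms)

lemma frechet_derivative_nth:
  fixes f :: "real^3 \<Rightarrow> real^3"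
  assumes "\<And>i. ((\<lambda>x. f x $ i) has_derivative f' i) (at x)"
  shows "frechet_derivative f (at x) h $ i = f' i h"
  using frechet_derivative_at[OF vector3_has_derivative[OF assms]] by (metis vec_lambda_beta)

text \<open>The identity \<open>curl (x \<times> b) = x div b - 2 b - (x \<cdot> \<nabla>) b\<close>.\<close>

lemma curl_cross_multilin:
  fixes b :: "real^3 \<Rightarrow> real^3"
  assumes b: "\<And>x d. b x $ d = multilin (c d) x"
  shows "curl3 (\<lambda>y. cross3 y (b y)) x $ i =
    x $ i * (\<Sum>d\<in>UNIV. multilin_deriv (c d) x (axis d 1)) - 2 * multilin (c i) x - multilin_deriv (c i) x x"
proof -
  define g' where "g' i h = (if i = 1 then h$2 * b x $ 3 + x$2 * multilin_deriv (c 3) x h - h$3 * b x $ 2 - x$3 * multilin_deriv (c 2) x h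
     else if i = 2 then h$3 * b x $ 1 + x$3 * multilin_deriv (c 1) x h - h$1 * b x $ 3 - x$1 * multilin_deriv (c 3) x h
     else h$1 * b x $ 2 + x$1 * multilin_deriv (c 2) x h - h$2 * b x $ 1 - x$2 * multilin_deriv (c 1) x h)"
    for i :: 3 and h :: "real^3"
  have "((\<lambda>y. cross3 y (b y) $ i) has_derivative g' i) (at x)" for i
  proof -
    have "((\<lambda>y. cross3 y (b y) $ 1) has_derivative g' 1) (at x)"
      "((\<lambda>y. cross3 y (b y) $ 2) has_derivative g' 2) (at x)"
      "((\<lambda>y. cross3 y (b y) $ 3) has_derivative g' 3) (at x)"
      unfolding cross_components b g'_def
      by (rule derivative_eq_intros multilin_has_derivative has_derivative_nth refl | simp add: fun_eq_iff)+
    then show ?thesis using exhaust_3[of i] by auto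
  qed
  note fd = frechet_derivative_nth[OF this]
  show ?thesis
    using exhaust_3[of i]
    by (elim disjE)
       (simp_all add: curl3_def Let_def fd g'_def axis_def b sum_3 multilin_def multilin_deriv_def algebra_simps)
qed

text \<open>The second expression for \<open>s\<close> is the sum of the mean vertex values of the outward normal
  components: on each face the normal component of an enhanced Raviart-Thomas field is bilinear.\<close>

lemma ERT0_divergence:
  assumes "q \<in> ERT0_hat"
  shows "\<exists>D s. (\<forall>x. (q has_derivative D x) (at x)) \<and> (\<forall>h. continuous_on UNIV (\<lambda>x. D x h)) \<and>
    (\<forall>x. (\<Sum>j\<in>UNIV. D x (axis j 1) $ j) = s) \<and>
    s = (\<Sum>i=1..8. \<Sum>j\<in>UNIV. (2 * ref_vertex i $ j - 1) * q (ref_vertex i) $ j) / 4"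
proof -
  obtain q0 b where q: "q = (\<lambda>x. q0 x + curl3 (\<lambda>y. cross3 y (b y)) x)"
    and "q0 \<in> RT0_hat" and "b \<in> B_hat"
    using assms unfolding ERT0_hat_def by auto
  then obtain \<alpha> \<beta> :: "real^3" and c where q0: "q0 = (\<lambda>x. \<chi> d. \<alpha>$d + \<beta>$d * x$d)"
    and b: "\<And>x d. b x $ d = multilin (c d) x"
    unfolding RT0_hat_def using B_hat_multilin by blast
  have qn: "q x $ i = \<alpha>$i + \<beta>$i * x$i + (x $ i * (\<Sum>d\<in>UNIV. multilin_deriv (c d) x (axis d 1)) - 2 * multilin (c i) x - multilin_deriv (c i) x x)" for x i
    by (simp add: q q0 curl_cross_multilin[OF b])
  \<comment> \<open>Euler's identity: a monomial of degree m is an eigenvector of the derivative in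
    direction x with eigenvalue m, which together with the term 2 b gives the factors 3, 4 and
    5.\<close>
  have qn1: "q x $ i = \<alpha>$i + \<beta>$i * x$i + x $ i * (
      c 1 {1} + c 1 {1,2} * x$2 + c 1 {1,3} * x$3 + c 1 {1,2,3} * x$2 * x$3 +
      c 2 {2} + c 2 {1,2} * x$1 + c 2 {2,3} * x$3 + c 2 {1,2,3} * x$1 * x$3 +
      c 3 {3} + c 3 {1,3} * x$1 + c 3 {2,3} * x$2 + c 3 {1,2,3} * x$1 * x$2)
      - (3 * c i {1} * x$1 + 3 * c i {2} * x$2 + 3 * c i {3} * x$3 + 4 * c i {1,2} * x$1 * x$2 +
     4 * c i {1,3} * x$1 * x$3 + 4 * c i {2,3} * x$2 * x$3 + 5 * c i {1,2,3} * x$1 * x$2 * x$3)" for x i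
    unfolding qn by (simp add: sum_3 multilin_def multilin_deriv_def axis_def algebra_simps)
  define q' where "q' x i h = \<beta>$i * h$i + h $ i * (
      c 1 {1} + c 1 {1,2} * x$2 + c 1 {1,3} * x$3 + c 1 {1,2,3} * x$2 * x$3 +
      c 2 {2} + c 2 {1,2} * x$1 + c 2 {2,3} * x$3 + c 2 {1,2,3} * x$1 * x$3 +
      c 3 {3} + c 3 {1,3} * x$1 + c 3 {2,3} * x$2 + c 3 {1,2,3} * x$1 * x$2) +
      x $ i * (c 1 {1,2} * h$2 + c 1 {1,3} * h$3 + c 1 {1,2,3} * (h$2 * x$3 + x$2 * h$3) +
      c 2 {1,2} * h$1 + c 2 {2,3} * h$3 + c 2 {1,2,3} * (h$1 * x$3 + x$1 * h$3) +
      c 3 {1,3} * h$1 + c 3 {2,3} * h$2 + c 3 {1,2,3} * (h$1 * x$2 + x$1 * h$2))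
      - (3 * c i {1} * h$1 + 3 * c i {2} * h$2 + 3 * c i {3} * h$3 + 4 * c i {1,2} * (h$1 * x$2 + x$1 * h$2) +
     4 * c i {1,3} * (h$1 * x$3 + x$1 * h$3) + 4 * c i {2,3} * (h$2 * x$3 + x$2 * h$3) +
     5 * c i {1,2,3} * (h$1 * x$2 * x$3 + x$1 * h$2 * x$3 + x$1 * x$2 * h$3))" for x :: "real^3" and i and h :: "real^3"
  have "((\<lambda>x. q x $ i) has_derivative q' x i) (at x)" for x i
    unfolding qn1
    by (rule derivative_eq_intros has_derivative_nth refl)+
       (simp add: q'_def fun_eq_iff algebra_simps)
  then have 1: "(q has_derivative (\<lambda>h. \<chi> i. q' x i h)) (at x)" for x
    by (rule vector3_has_derivative)
  have 2: "continuous_on UNIV (\<lambda>x. \<chi> i. q' x i h)" for h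
    unfolding q'_def by (intro continuous_intros)
  \<comment> \<open>The curls are divergence free, so only the Raviart-Thomas part is left.\<close>
  have 3: "(\<Sum>j\<in>UNIV. (\<chi> i. q' x i (axis j 1)) $ j) = \<beta>$1 + \<beta>$2 + \<beta>$3" for x
    by (simp add: sum_3 q'_def axis_def algebra_simps)
  have 4: "(\<beta>$1 + \<beta>$2 + \<beta>$3) = (\<Sum>i=1..8. \<Sum>j\<in>UNIV. (2 * ref_vertex i $ j - 1) * q (ref_vertex i) $ j) / 4"
  proof -
    have set: "{1..8::nat} = {1,2,3,4,5,6,7,8}" by auto
    have nth: "ref_vertex (Suc 0) = vector [0,0,0]" "ref_vertex 2 = vector [1,0,0]" "ref_vertex 3 = vector [1,1,0]"
      "ref_vertex 4 = vector [0,1,0]" "ref_vertex 5 = vector [0,0,1]" "ref_vertex 6 = vector [1,0,1]"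
      "ref_vertex 7 = vector [1,1,1]" "ref_vertex 8 = vector [0,1,1]"
      by (simp_all add: ref_vertex_def)
    show ?thesis unfolding set qn1 by (simp add: nth sum_3 algebra_simps)
  qed
  show ?thesis by (intro exI conjI allI) (rule 1 2 3 4)+
qed

section \<open>Cutoffs and integration by parts\<close>

text \<open>Serves \<open>sqpos\<close>, whose two branches meet at 0: one remainder bound avoids
  one-sided derivatives.\<close>

lemma has_field_derivative_quadraticI:
  fixes f :: "real \<Rightarrow> real"
  assumes "\<And>y. \<bar>f y - f x - d * (y - x)\<bar> \<le> (y - x)\<^sup>2"
  shows "(f has_real_derivative d) (at x)"
  unfolding has_field_derivative_iff
proof (rule Lim_transform_eventually)
  show "((\<lambda>y. (f y - f x - d * (y - x)) / (y - x) + d) \<longlongrightarrow> d) (at x)"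
  proof -
    have "((\<lambda>y. (f y - f x - d * (y - x)) / (y - x)) \<longlongrightarrow> 0) (at x)"
    proof (rule Lim_null_comparison)
      show "\<forall>\<^sub>F y in at x. norm ((f y - f x - d * (y - x)) / (y - x)) \<le> \<bar>y - x\<bar>"
      proof (rule eventually_at_filter[THEN iffD2], rule always_eventually, intro allI impI)
        fix y assume "y \<noteq> x"
        then have "0 < \<bar>y - x\<bar>" by simp
        moreover have "\<bar>f y - f x - d * (y - x)\<bar> \<le> \<bar>y - x\<bar> * \<bar>y - x\<bar>"
          using assms[of y] by (simp only: power2_eq_square abs_mult_self_eq)
        ultimately show "norm ((f y - f x - d * (y - x)) / (y - x)) \<le> \<bar>y - x\<bar>"
          by (simp only: real_norm_def abs_divide pos_divide_le_eq)
      qed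
      show "((\<lambda>y. \<bar>y - x\<bar>) \<longlongrightarrow> 0) (at x)"
        by (rule tendsto_eq_intros refl | simp)+
    qed
    from tendsto_add[OF this tendsto_const[of d]] show ?thesis by simp
  qed
  show "\<forall>\<^sub>F y in at x. (f y - f x - d * (y - x)) / (y - x) + d = (f y - f x) / (y - x)"
    unfolding eventually_at_filter
    by (rule always_eventually) (auto simp: field_simps)
qed

definition sqpos :: "real \<Rightarrow> real" where "sqpos s = (max 0 s)\<^sup>2"

lemma sqpos_has_derivative: "(sqpos has_real_derivative 2 * max 0 x) (at x)"
proof (rule has_field_derivative_quadraticI)
  fix y :: real
  have "\<bar>- x\<^sup>2 - 2 * x * (y - x)\<bar> \<le> (y - x)\<^sup>2" if "x \<ge> 0" "y \<le> 0"
  proof -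
    have "x * y \<le> 0" using that by (rule mult_nonneg_nonpos)
    moreover have "0 \<le> x * x" "0 \<le> y * y" by simp_all
    moreover have "(y - x) * (y - x) = y * y - 2 * (x * y) + x * x" by (simp add: algebra_simps)
    ultimately have "0 \<le> x * x - 2 * (x * y)" "x * x - 2 * (x * y) \<le> (y - x) * (y - x)"
      by linarith+
    moreover have "- x\<^sup>2 - 2 * x * (y - x) = x * x - 2 * (x * y)"
      by (simp add: power2_eq_square algebra_simps)
    ultimately show ?thesis by (simp add: power2_eq_square)
  qed
  moreover have "y\<^sup>2 \<le> (y - x)\<^sup>2" if "x \<le> 0" "y \<ge> 0"
    using that by (intro power_mono) auto
  moreover have "\<bar>y\<^sup>2 - x\<^sup>2 - 2 * x * (y - x)\<bar> = (y - x)\<^sup>2"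
  proof -
    have "y\<^sup>2 - x\<^sup>2 - 2 * x * (y - x) = (y - x)\<^sup>2" by (simp add: power2_eq_square algebra_simps)
    then show ?thesis by simp
  qed
  ultimately show "\<bar>sqpos y - sqpos x - 2 * max 0 x * (y - x)\<bar> \<le> (y - x)\<^sup>2"
    unfolding sqpos_def max_def by auto
qed

text \<open>A transition from 0, for arguments up to 0, to 1, for arguments from 1 on. The two
  nested squares make both junctions continuously differentiable, which is the regularity that
  \<open>C1_test_field\<close> asks for.\<close>

definition step :: "real \<Rightarrow> real" where "step s = 1 - sqpos (1 - sqpos s)"

lemma step_has_derivative:
  "(step has_real_derivative (4 * max 0 (1 - sqpos s) * max 0 s)) (at s)"
  unfolding step_def[abs_def]
  by (rule derivative_eq_intros DERIV_chain'[OF _ sqpos_has_derivative] sqpos_has_derivative refl)+ simp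

lemma continuous_on_sqpos [continuous_intros]:
  "continuous_on S f \<Longrightarrow> continuous_on S (\<lambda>x. sqpos (f x))"
  unfolding sqpos_def by (intro continuous_intros)

lemma continuous_on_step [continuous_intros]:
  "continuous_on S f \<Longrightarrow> continuous_on S (\<lambda>x. step (f x))"
  unfolding step_def by (intro continuous_intros)

lemma step_nonpos: "s \<le> 0 \<Longrightarrow> step s = 0"
  by (simp add: step_def sqpos_def)

lemma step_ge_1: "s \<ge> 1 \<Longrightarrow> step s = 1"
  using mult_mono[of 1 s 1 s] by (simp add: step_def sqpos_def max_def power2_eq_square)

lemma step_bounds: "0 \<le> step s" "step s \<le> 1"
proof -
  have "sqpos s \<ge> 0" "sqpos (1 - sqpos s) \<ge> 0" by (simp_all add: sqpos_def)
  moreover have "sqpos (1 - sqpos s) \<le> 1\<^sup>2"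
    unfolding sqpos_def[of "1 - sqpos s"] using \<open>sqpos s \<ge> 0\<close> by (intro power_mono) auto
  ultimately show "0 \<le> step s" "step s \<le> 1" by (simp_all add: step_def)
qed

text \<open>The product \<open>t * (1 - t)\<close> is positive exactly between the endpoints. The
  shift by 1 makes the function vanish until the product exceeds 1/k; it equals 1 once the product
  reaches 2/k. Hence it tends pointwise to the indicator of the open interval.\<close>

definition bump :: "nat \<Rightarrow> real \<Rightarrow> real" where
  "bump k t = step (real k * (t * (1 - t)) - 1)"

definition bump' :: "nat \<Rightarrow> real \<Rightarrow> real" where
  "bump' k t = 4 * max 0 (1 - sqpos (real k * (t * (1 - t)) - 1)) * max 0 (real k * (t * (1 - t)) - 1)
     * (real k * (1 - 2 * t))"

lemma bump_has_derivative: "(bump k has_real_derivative bump' k t) (at t)"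
  unfolding bump_def[abs_def] bump'_def
  by (rule derivative_eq_intros DERIV_chain'[OF _ step_has_derivative] refl)+ (simp add: algebra_simps)

lemma bump_eq_0: "real k * (t * (1 - t)) < 1 \<Longrightarrow> bump k t = 0" "real k * (t * (1 - t)) < 1 \<Longrightarrow> bump' k t = 0"
  by (simp_all add: bump_def bump'_def step_nonpos)

lemma bump_tendsto:
  assumes "0 < t" "t < 1" shows "(\<lambda>k. bump k t) \<longlonglongrightarrow> 1"
proof (rule tendsto_eventually)
  have pos: "t * (1 - t) > 0" using assms by simp
  obtain N :: nat where N: "2 / (t * (1 - t)) \<le> real N" using real_arch_simple by blast
  have "bump k t = 1" if "k \<ge> N" for k
  proof -
    have "2 / (t * (1 - t)) \<le> real k" using N that by linarith
    then have "2 \<le> real k * (t * (1 - t))" using pos by (simp add: divide_le_eq)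
    then show ?thesis by (simp add: bump_def step_ge_1)
  qed
  then show "\<forall>\<^sub>F k in sequentially. bump k t = 1" by (auto simp: eventually_sequentially)
qed

definition cutoff :: "nat \<Rightarrow> real^3 \<Rightarrow> real" where
  "cutoff k y = bump k (y$1) * bump k (y$2) * bump k (y$3)"

definition cutoff' :: "nat \<Rightarrow> 3 \<Rightarrow> real^3 \<Rightarrow> real" where
  "cutoff' k j y = (if j = 1 then bump' k (y$1) * bump k (y$2) * bump k (y$3)
     else if j = 2 then bump k (y$1) * bump' k (y$2) * bump k (y$3)
     else bump k (y$1) * bump k (y$2) * bump' k (y$3))"

text \<open>A closed condition, chosen instead of an open one for compactness; the bound from below
  by 1 forces every coordinate strictly between 0 and 1.\<close>

definition cutoff_support :: "nat \<Rightarrow> (real^3) set" where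
  "cutoff_support k = {y. \<forall>j. 1 \<le> real k * (y$j * (1 - y$j))}"

lemma cutoff_has_derivative:
  "(cutoff k has_derivative (\<lambda>h. \<Sum>j\<in>UNIV. cutoff' k j y * h $ j)) (at y)"
proof -
  have b: "((\<lambda>y. bump k (y $ j)) has_derivative (\<lambda>h. bump' k (y $ j) * h $ j)) (at y)" for j
    by (rule has_derivative_compose[OF has_derivative_nth
        bump_has_derivative[THEN has_field_derivative_imp_has_derivative]])
  show ?thesis
    unfolding cutoff_def[abs_def]
    by (rule derivative_eq_intros b refl)+
       (simp add: sum_3 cutoff'_def fun_eq_iff algebra_simps)
qed

lemma continuous_on_bump [continuous_intros]:
  "continuous_on S f \<Longrightarrow> continuous_on S (\<lambda>x. bump k (f x))"
  "continuous_on S f \<Longrightarrow> continuous_on S (\<lambda>x. bump' k (f x))"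
  unfolding bump_def bump'_def by (intro continuous_intros; assumption)+

lemma continuous_on_cutoff [continuous_intros]:
  assumes "continuous_on S f"
  shows "continuous_on S (\<lambda>x. cutoff k (f x))" "continuous_on S (\<lambda>x. cutoff' k j (f x))"
proof -
  show "continuous_on S (\<lambda>x. cutoff k (f x))"
    unfolding cutoff_def by (intro continuous_intros assms)
  show "continuous_on S (\<lambda>x. cutoff' k j (f x))"
    using exhaust_3[of j]
    by (elim disjE; simp add: cutoff'_def) (intro continuous_intros assms)+
qed

lemma cutoff_support_subset: "cutoff_support k \<subseteq> interior ref_cube"
proof
  fix y assume y: "y \<in> cutoff_support k"
  have "0 < y $ j \<and> y $ j < 1" for j
  proof -
    have *: "1 \<le> real k * (y$j * (1 - y$j))" using y by (simp add: cutoff_support_def)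
    have "0 < y$j * (1 - y$j)"
    proof (rule ccontr)
      assume "\<not> ?thesis"
      then have "real k * (y$j * (1 - y$j)) \<le> 0" by (simp add: mult_nonneg_nonpos)
      then show False using * by simp
    qed
    then show ?thesis by (auto simp: zero_less_mult_iff)
  qed
  then show "y \<in> interior ref_cube" by (simp add: mem_interior_ref_cube)
qed

lemma compact_cutoff_support: "compact (cutoff_support k)"
proof -
  have "closed (cutoff_support k)"
    unfolding cutoff_support_def
    by (intro closed_Collect_all closed_Collect_le continuous_intros)
  moreover have "bounded (cutoff_support k)"
    using cutoff_support_subset interior_subset
    by (metis bounded_cbox bounded_subset ref_cube_def)
  ultimately show ?thesis by (simp add: compact_eq_bounded_closed)
qed

lemma cutoff_outside:
  assumes "y \<notin> cutoff_support k" shows "cutoff k y = 0" "cutoff' k j y = 0"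
proof -
  obtain i where i: "real k * (y$i * (1 - y$i)) < 1"
    using assms by (auto simp: cutoff_support_def not_le)
  show "cutoff k y = 0" "cutoff' k j y = 0"
    using exhaust_3[of i] bump_eq_0[OF i] by (auto simp: cutoff_def cutoff'_def)
qed

lemma cutoff_bounds: "0 \<le> cutoff k y" "cutoff k y \<le> 1"
  using step_bounds by (simp_all add: cutoff_def bump_def mult_le_one)

lemma cutoff_tendsto:
  assumes "y \<in> interior ref_cube" shows "(\<lambda>k. cutoff k y) \<longlonglongrightarrow> 1"
proof -
  have "(\<lambda>k. bump k (y$j)) \<longlonglongrightarrow> 1" for j
    using assms by (intro bump_tendsto) (simp_all add: mem_interior_ref_cube)
  then have "(\<lambda>k. bump k (y$1) * bump k (y$2) * bump k (y$3)) \<longlonglongrightarrow> 1 * 1 * 1"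
    by (intro tendsto_mult)
  then show ?thesis by (simp add: cutoff_def)
qed

section \<open>Integrals over the whole space\<close>

lemma integrable_compact_support:
  fixes f :: "'a::euclidean_space \<Rightarrow> real"
  assumes "continuous_on UNIV f" "compact K" "\<And>x. x \<notin> K \<Longrightarrow> f x = 0"
  shows "integrable lborel f"
proof -
  have "integrable lborel (\<lambda>x. indicator K x *\<^sub>R f x)"
    using assms by (intro borel_integrable_compact) (auto intro: continuous_on_subset)
  also have "(\<lambda>x. indicator K x *\<^sub>R f x) = f"
    by (rule ext) (use assms(3) in \<open>auto simp: indicator_def\<close>)
  finally show ?thesis .
qed

lemma lborel_integral_translation:
  fixes f :: "'a::euclidean_space \<Rightarrow> real"
  assumes [measurable]: "f \<in> borel_measurable borel"
  shows "(\<integral>x. f (c + x) \<partial>lborel) = (\<integral>x. f x \<partial>lborel)"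
proof -
  have "(\<integral>x. f x \<partial>distr lborel borel ((+) c)) = (\<integral>x. f (c + x) \<partial>lborel)"
    by (rule integral_distr) measurable
  then show ?thesis by (simp add: lborel_distr_plus)
qed

lemma integrable_lborel_translation:
  fixes f :: "'a::euclidean_space \<Rightarrow> real"
  assumes "integrable lborel f"
  shows "integrable lborel (\<lambda>x. f (c + x))"
proof -
  have "integrable (distr lborel borel ((+) c)) f" using assms by (simp add: lborel_distr_plus)
  then show ?thesis
    by (subst (asm) integrable_distr_eq) (use assms in auto)
qed

text \<open>By translation invariance the difference quotients of \<open>f\<close> in direction \<open>e\<close> have integral
  zero, and they converge dominatedly to the derivative.\<close>

lemma integral_directional_derivative:
  fixes f f' :: "'a::euclidean_space \<Rightarrow> real"
  assumes der: "\<And>x. ((\<lambda>t. f (x + t *\<^sub>R e)) has_real_derivative f' x) (at 0)"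
    and cont: "continuous_on UNIV f" "continuous_on UNIV f'"
    and K: "compact K" "\<And>x. x \<notin> K \<Longrightarrow> f x = 0" "\<And>x. x \<notin> K \<Longrightarrow> f' x = 0"
  shows "(\<integral>x. f' x \<partial>lborel) = 0"
proof -
  define s where "s n x = real (Suc n) * (f (inverse (real (Suc n)) *\<^sub>R e + x) - f x)" for n x
  have int: "integrable lborel f" by (rule integrable_compact_support[OF cont(1) K(1,2)])
  have meas: "f \<in> borel_measurable borel" "f' \<in> borel_measurable borel"
    using cont by (auto intro: borel_measurable_continuous_onI)
  have s0: "(\<integral>x. s n x \<partial>lborel) = 0" for n
    unfolding s_def
    by (simp add: int integrable_lborel_translation lborel_integral_translation meas(1))
  have der': "((\<lambda>t. f (x + t *\<^sub>R e)) has_real_derivative f' (x + t *\<^sub>R e)) (at t)" for x t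
    using DERIV_shift[of "\<lambda>t. f (x + t *\<^sub>R e)" "f' (x + t *\<^sub>R e)" 0 t] der[of "x + t *\<^sub>R e"]
    by (simp add: algebra_simps)
  have "bounded (f' ` K)"
    using cont(2) K(1) by (meson compact_continuous_image compact_imp_bounded continuous_on_subset subset_UNIV)
  then obtain M where M: "\<And>x. x \<in> K \<Longrightarrow> \<bar>f' x\<bar> \<le> M" "M > 0"
    by (metis bounded_pos imageI real_norm_def)
  have M': "\<bar>f' x\<bar> \<le> M" for x using M K(3)[of x] by (cases "x \<in> K") auto
  have "bounded K" using K(1) by (rule compact_imp_bounded)
  then obtain R where "\<forall>x\<in>K. norm x \<le> R" unfolding bounded_iff by blast
  then have R: "\<And>x. x \<in> K \<Longrightarrow> norm x \<le> R" by simp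
  \<comment> \<open>Outside this ball neither \<open>x\<close> nor its translate by a fraction of
    \<open>e\<close> lies in \<open>K\<close>, so a multiple of the indicator of the ball dominates
    all difference quotients.\<close>
  define C where "C = cball (0::'a) (R + norm e)"
  have bound: "\<bar>s n x\<bar> \<le> M * indicator C x" for n x
  proof (cases "x \<in> C")
    case False
    define h where "h = inverse (real (Suc n))"
    have h: "0 < h" "h \<le> 1" by (simp_all add: h_def inverse_le_1_iff)
    have big: "norm x > R + norm e" using False by (simp add: C_def)
    then have "x \<notin> K" using R[of x] norm_ge_zero[of e] by linarith
    moreover have "norm x \<le> norm (h *\<^sub>R e + x) + norm (h *\<^sub>R e)"
      by (metis add.commute add_diff_cancel_left' norm_triangle_ineq4)
    then have "h *\<^sub>R e + x \<notin> K"
      using R[of "h *\<^sub>R e + x"] big h mult_right_mono[of h 1 "norm e"] by auto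
    ultimately show ?thesis using False K(2) by (simp add: s_def h_def)
  next
    case True
    define h where "h = inverse (real (Suc n))"
    have h: "0 < h" by (simp add: h_def)
    \<comment> \<open>By the mean value theorem the difference quotient is a value of
      \<open>f'\<close>, hence bounded by \<open>M\<close>.\<close>
    obtain z where z: "0 < z" "z < h" "f (x + h *\<^sub>R e) - f (x + 0 *\<^sub>R e) = (h - 0) * f' (x + z *\<^sub>R e)"
      using MVT2[OF h der'] by blast
    have "s n x = inverse h * (f (x + h *\<^sub>R e) - f (x + 0 *\<^sub>R e))" by (simp add: s_def h_def add.commute)
    also have "\<dots> = f' (x + z *\<^sub>R e)" unfolding z(3) using h by simp
    finally show ?thesis using True M' by simp
  qed
  have lim: "(\<lambda>n. s n x) \<longlonglongrightarrow> f' x" for x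
  proof -
    have "((\<lambda>h. (f (x + h *\<^sub>R e) - f x) / h) \<longlongrightarrow> f' x) (at 0)"
      using der[of x] by (simp add: has_field_derivative_iff)
    moreover have "filterlim (\<lambda>n. inverse (real (Suc n))) (at 0) sequentially"
      unfolding filterlim_at using LIMSEQ_inverse_real_of_nat by simp
    ultimately have "(\<lambda>n. (f (x + inverse (real (Suc n)) *\<^sub>R e) - f x) / inverse (real (Suc n))) \<longlonglongrightarrow> f' x"
      by (rule filterlim_compose)
    then show ?thesis by (simp add: s_def divide_inverse mult.commute add.commute)
  qed
  have "(\<lambda>n. \<integral>x. s n x \<partial>lborel) \<longlonglongrightarrow> (\<integral>x. f' x \<partial>lborel)"
  proof (rule integral_dominated_convergence)
    show "f' \<in> borel_measurable lborel" using meas(2) by simp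
    show "s n \<in> borel_measurable lborel" for n
      unfolding s_def using meas(1) by measurable
    show "integrable lborel (\<lambda>x. M * indicator C x)"
      unfolding C_def
      using emeasure_lborel_cball_finite[of "0::'a" "R + norm e"]
      by (intro integrable_mult_right integrable_real_indicator) simp_all
    show "AE x in lborel. (\<lambda>n. s n x) \<longlonglongrightarrow> f' x" using lim by simp
    show "AE x in lborel. norm (s n x) \<le> M * indicator C x" for n using bound by simp
  qed
  then show ?thesis unfolding s0 by (simp add: LIMSEQ_const_iff)
qed

text \<open>\<open>t \<le> 1 + t^2\<close> for every real t, and constants are integrable over a set
  of finite measure.\<close>

lemma L2_integrable:
  fixes g :: "real^3 \<Rightarrow> 'b::euclidean_space"
  assumes "L2 \<Omega> g" "\<Omega> \<in> lmeasurable"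
  shows "integrable (lebesgue_on \<Omega>) g"
proof (rule Bochner_Integration.integrable_bound)
  have \<Omega>: "\<Omega> \<in> sets lebesgue" using assms(2) by auto
  have "integrable (lebesgue_on \<Omega>) (\<lambda>x. 1 :: real)"
    using assms(2) by (simp add: integrable_restrict_space[OF] \<Omega> fmeasurable_def)
  then show "integrable (lebesgue_on \<Omega>) (\<lambda>x. 1 + (norm (g x))\<^sup>2)"
    using assms(1) by (simp add: L2_def)
  show "g \<in> borel_measurable (lebesgue_on \<Omega>)" using assms(1) by (simp add: L2_def)
  show "AE x in lebesgue_on \<Omega>. norm (g x) \<le> norm (1 + (norm (g x))\<^sup>2)"
  proof (intro AE_I2)
    fix x
    have "0 \<le> (norm (g x) - 1)\<^sup>2" by simp
    then show "norm (g x) \<le> norm (1 + (norm (g x))\<^sup>2)"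
      by (simp add: power2_diff) (smt (verit) norm_ge_zero zero_le_power2)
  qed
qed

text \<open>Links the restricted complete measure, in which the weak divergence is stated, to
  \<open>lborel\<close>, in which the integration by parts takes place.\<close>

lemma lebesgue_on_integral_supported:
  fixes f :: "real^3 \<Rightarrow> real"
  assumes "f \<in> borel_measurable borel" "\<Omega> \<in> sets lebesgue" "\<And>x. x \<notin> \<Omega> \<Longrightarrow> f x = 0"
  shows "integral\<^sup>L (lebesgue_on \<Omega>) f = (\<integral>x. f x \<partial>lborel)"
proof -
  have "integral\<^sup>L (lebesgue_on \<Omega>) f = (\<integral>x. indicator \<Omega> x *\<^sub>R f x \<partial>lebesgue)"
    using assms(2) by (simp add: integral_restrict_space)
  also have "(\<lambda>x. indicator \<Omega> x *\<^sub>R f x) = f"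
    by (rule ext) (use assms(3) in \<open>auto simp: indicator_def\<close>)
  also have "(\<integral>x. f x \<partial>lebesgue) = (\<integral>x. f x \<partial>lborel)"
    using assms(1) by (simp add: integral_completion)
  finally show ?thesis .
qed

section \<open>Test fields supported in one element\<close>

lemma lcoord_has_derivative:
  "(lcoord \<rho> has_derivative (\<lambda>h. \<chi> d. edge \<rho> d \<bullet> h / (edge \<rho> d \<bullet> edge \<rho> d))) (at x)"
proof (rule vector3_has_derivative)
  fix i
  show "((\<lambda>x. lcoord \<rho> x $ i) has_derivative (\<lambda>h. edge \<rho> i \<bullet> h / (edge \<rho> i \<bullet> edge \<rho> i))) (at x)"
    unfolding lcoord_nth divide_inverse
    by (rule derivative_eq_intros refl)+ simp
qed

lemma lcoord_line:
  assumes "cuboid \<rho> E"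
  shows "lcoord \<rho> (x + t *\<^sub>R edge \<rho> j) = lcoord \<rho> x + t *\<^sub>R axis j 1"
  by (simp add: vec_eq_iff lcoord_add[OF assms] axis_def)

text \<open>Moving along edge \<open>j\<close> changes local coordinate \<open>j\<close> alone, at
  unit speed. Derivatives along edges are therefore partial derivatives on the reference cube, and
  the integrals need no change of variables.\<close>

lemma has_derivative_along_edge:
  assumes "cuboid \<rho> E" "(f has_derivative f') (at (lcoord \<rho> x))"
  shows "((\<lambda>t. f (lcoord \<rho> (x + t *\<^sub>R edge \<rho> j))) has_vector_derivative f' (axis j 1)) (at 0)"
proof -
  have "((\<lambda>t. lcoord \<rho> x + t *\<^sub>R axis j 1) has_derivative (\<lambda>t. t *\<^sub>R axis j 1)) (at 0)"
    by (rule derivative_eq_intros refl)+ simp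
  then have "((\<lambda>t. f (lcoord \<rho> x + t *\<^sub>R axis j 1)) has_derivative (\<lambda>t. f' (t *\<^sub>R axis j 1))) (at 0)"
    by (rule has_derivative_compose) (use assms(2) in simp)
  moreover have "f' (t *\<^sub>R axis j 1) = t *\<^sub>R f' (axis j 1)" for t
    by (rule linear_scale[OF has_derivative_linear[OF assms(2)]])
  ultimately show ?thesis
    by (simp add: has_vector_derivative_def lcoord_line[OF assms(1)])
qed

definition elem_cutoff :: "(nat \<Rightarrow> real^3) \<Rightarrow> nat \<Rightarrow> real^3 \<Rightarrow> real" where
  "elem_cutoff \<rho> k x = cutoff k (lcoord \<rho> x)"

definition elem_cutoff_support :: "(nat \<Rightarrow> real^3) \<Rightarrow> nat \<Rightarrow> (real^3) set" where
  "elem_cutoff_support \<rho> k = elem_map \<rho> ` cutoff_support k"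

lemma compact_elem_cutoff_support: "compact (elem_cutoff_support \<rho> k)"
  unfolding elem_cutoff_support_def
  by (intro compact_continuous_image continuous_on_elem_map compact_cutoff_support)

lemma elem_cutoff_support_subset:
  assumes "cuboid \<rho> E" shows "elem_cutoff_support \<rho> k \<subseteq> interior E"
  using cutoff_support_subset by (auto simp: elem_cutoff_support_def cuboid_interior_image[OF assms])

lemma elem_cutoff_outside:
  assumes "cuboid \<rho> E" "x \<notin> elem_cutoff_support \<rho> k"
  shows "elem_cutoff \<rho> k x = 0" "cutoff' k j (lcoord \<rho> x) = 0"
proof -
  have "lcoord \<rho> x \<notin> cutoff_support k"
    using assms(2) elem_map_lcoord[OF assms(1), of x] by (metis elem_cutoff_support_def imageI)
  then show "elem_cutoff \<rho> k x = 0" "cutoff' k j (lcoord \<rho> x) = 0"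
    by (simp_all add: elem_cutoff_def cutoff_outside)
qed

text \<open>The differential of local coordinate \<open>j\<close>, with values in the line of the
  unit vector \<open>d\<close>.\<close>

definition edge_axis_blinfun :: "(nat \<Rightarrow> real^3) \<Rightarrow> 3 \<Rightarrow> 3 \<Rightarrow> (real^3) \<Rightarrow>\<^sub>L (real^3)" where
  "edge_axis_blinfun \<rho> d j = Blinfun (\<lambda>h. (edge \<rho> j \<bullet> h / (edge \<rho> j \<bullet> edge \<rho> j)) *\<^sub>R axis d 1)"

lemma edge_axis_blinfun_apply:
  "blinfun_apply (edge_axis_blinfun \<rho> d j) = (\<lambda>h. (edge \<rho> j \<bullet> h / (edge \<rho> j \<bullet> edge \<rho> j)) *\<^sub>R axis d 1)"
  unfolding edge_axis_blinfun_def divide_inverse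
  by (rule bounded_linear_Blinfun_apply)
     (intro bounded_linear_scaleR_const bounded_linear_mult_const bounded_linear_inner_right)

text \<open>By the chain rule, the derivative of the test field whose component \<open>d\<close> is
  the cutoff; testing with it isolates row \<open>d\<close> of a stress.\<close>

definition test_deriv :: "(nat \<Rightarrow> real^3) \<Rightarrow> nat \<Rightarrow> 3 \<Rightarrow> real^3 \<Rightarrow> (real^3) \<Rightarrow>\<^sub>L (real^3)" where
  "test_deriv \<rho> k d x = (\<Sum>j\<in>UNIV. cutoff' k j (lcoord \<rho> x) *\<^sub>R edge_axis_blinfun \<rho> d j)"

lemma test_deriv_apply:
  "blinfun_apply (test_deriv \<rho> k d x) h =
     (\<Sum>j\<in>UNIV. cutoff' k j (lcoord \<rho> x) * (edge \<rho> j \<bullet> h / (edge \<rho> j \<bullet> edge \<rho> j))) *\<^sub>R axis d 1"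
  by (simp add: test_deriv_def blinfun.sum_left blinfun.scaleR_left edge_axis_blinfun_apply scaleR_sum_left)

lemma C1_test_field_cutoff:
  assumes "cuboid \<rho> E" "interior E \<subseteq> \<Omega>"
  shows "C1_test_field \<Omega> (\<lambda>x. elem_cutoff \<rho> k x *\<^sub>R axis d 1) (test_deriv \<rho> k d)"
  unfolding C1_test_field_def
proof (intro conjI allI)
  fix x
  have "(elem_cutoff \<rho> k has_derivative
      (\<lambda>h. \<Sum>j\<in>UNIV. cutoff' k j (lcoord \<rho> x) * (\<chi> d. edge \<rho> d \<bullet> h / (edge \<rho> d \<bullet> edge \<rho> d)) $ j)) (at x)"
    unfolding elem_cutoff_def[abs_def]
    by (rule has_derivative_compose[OF lcoord_has_derivative cutoff_has_derivative])
  then have "((\<lambda>x. elem_cutoff \<rho> k x *\<^sub>R axis d 1) has_derivative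
      (\<lambda>h. (\<Sum>j\<in>UNIV. cutoff' k j (lcoord \<rho> x) * (edge \<rho> j \<bullet> h / (edge \<rho> j \<bullet> edge \<rho> j))) *\<^sub>R axis d 1)) (at x)"
    by (intro has_derivative_scaleR_left) simp
  then show "((\<lambda>x. elem_cutoff \<rho> k x *\<^sub>R axis d 1) has_derivative blinfun_apply (test_deriv \<rho> k d x)) (at x)"
    by (simp add: test_deriv_apply[abs_def])
next
  show "continuous_on UNIV (test_deriv \<rho> k d)"
    unfolding test_deriv_def[abs_def] by (intro continuous_intros continuous_on_cutoff continuous_on_lcoord)
  show "\<exists>K. compact K \<and> K \<subseteq> \<Omega> \<and> (\<forall>x. x \<notin> K \<longrightarrow> elem_cutoff \<rho> k x *\<^sub>R axis d 1 = 0)"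
  proof (intro exI[of _ "elem_cutoff_support \<rho> k"] conjI allI impI)
    show "compact (elem_cutoff_support \<rho> k)" by (rule compact_elem_cutoff_support)
    show "elem_cutoff_support \<rho> k \<subseteq> \<Omega>"
      using elem_cutoff_support_subset[OF assms(1)] assms(2) by (rule subset_trans)
    show "elem_cutoff \<rho> k x *\<^sub>R axis d 1 = 0" if "x \<notin> elem_cutoff_support \<rho> k" for x
      using elem_cutoff_outside(1)[OF assms(1) that] by simp
  qed
qed

text \<open>Component \<open>j\<close> of \<open>q\<close> times the cutoff is differentiated along
  edge \<open>j\<close>. Each such derivative integrates to zero, and by the product rule their sum
  is the integrand on the left plus \<open>s\<close> times the cutoff.\<close>

lemma cutoff_integration_by_parts:
  fixes q :: "real^3 \<Rightarrow> real^3"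
  assumes \<rho>: "cuboid \<rho> E" and q: "\<And>y. (q has_derivative D y) (at y)"
    and cont: "\<And>h. continuous_on UNIV (\<lambda>y. D y h)"
    and div: "\<And>y. (\<Sum>j\<in>UNIV. D y (axis j 1) $ j) = s"
  shows "(\<integral>x. (\<Sum>j\<in>UNIV. cutoff' k j (lcoord \<rho> x) * q (lcoord \<rho> x) $ j) \<partial>lborel) =
    - s * (\<integral>x. elem_cutoff \<rho> k x \<partial>lborel)"
proof -
  let ?K = "elem_cutoff_support \<rho> k"
  have qc: "continuous_on UNIV q"
    using q by (meson continuous_on_eq_continuous_at differentiableI differentiable_imp_continuous_within open_UNIV UNIV_I)
  have qlc: "continuous_on UNIV (\<lambda>x. q (lcoord \<rho> x))"
    using continuous_on_compose2[OF qc continuous_on_lcoord] by simp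
  have Dlc: "continuous_on UNIV (\<lambda>x. D (lcoord \<rho> x) h)" for h
    using continuous_on_compose2[OF cont continuous_on_lcoord] by simp
  have cc: "continuous_on UNIV (\<lambda>x. cutoff' k j (lcoord \<rho> x))" for j
    by (intro continuous_on_cutoff continuous_on_lcoord)
  have ec: "continuous_on UNIV (elem_cutoff \<rho> k)"
    unfolding elem_cutoff_def[abs_def] by (intro continuous_on_cutoff continuous_on_lcoord)
  define f' where "f' j x = cutoff' k j (lcoord \<rho> x) * q (lcoord \<rho> x) $ j +
    elem_cutoff \<rho> k x * D (lcoord \<rho> x) (axis j 1) $ j" for j x
  have f'c: "continuous_on UNIV (f' j)" for j
    unfolding f'_def[abs_def] by (intro continuous_intros qlc Dlc cc ec)
  have f'K: "f' j x = 0" if "x \<notin> ?K" for j x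
    using elem_cutoff_outside[OF \<rho> that] by (simp add: f'_def)
  have zero: "(\<integral>x. f' j x \<partial>lborel) = 0" for j
  proof (rule integral_directional_derivative[where e = "edge \<rho> j" and K = ?K
      and f = "\<lambda>x. elem_cutoff \<rho> k x * q (lcoord \<rho> x) $ j"])
    fix x
    have "((\<lambda>t. cutoff k (lcoord \<rho> (x + t *\<^sub>R edge \<rho> j))) has_vector_derivative
        (\<Sum>i\<in>UNIV. cutoff' k i (lcoord \<rho> x) * axis j 1 $ i)) (at 0)"
      by (rule has_derivative_along_edge[OF \<rho> cutoff_has_derivative])
    also have "(\<Sum>i\<in>UNIV. cutoff' k i (lcoord \<rho> x) * axis j 1 $ i) = cutoff' k j (lcoord \<rho> x)"
      by (simp add: axis_def if_distrib cong: if_cong)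
    finally have 1: "((\<lambda>t. elem_cutoff \<rho> k (x + t *\<^sub>R edge \<rho> j)) has_real_derivative cutoff' k j (lcoord \<rho> x)) (at 0)"
      by (simp add: elem_cutoff_def has_real_derivative_iff_has_vector_derivative)
    have "((\<lambda>y. q y $ j) has_derivative (\<lambda>h. D (lcoord \<rho> x) h $ j)) (at (lcoord \<rho> x))"
      by (rule bounded_linear.has_derivative[OF bounded_linear_vec_nth q])
    from has_derivative_along_edge[OF \<rho> this, of j]
    have 2: "((\<lambda>t. q (lcoord \<rho> (x + t *\<^sub>R edge \<rho> j)) $ j) has_real_derivative D (lcoord \<rho> x) (axis j 1) $ j) (at 0)"
      by (simp add: has_real_derivative_iff_has_vector_derivative)
    show "((\<lambda>t. elem_cutoff \<rho> k (x + t *\<^sub>R edge \<rho> j) * q (lcoord \<rho> (x + t *\<^sub>R edge \<rho> j)) $ j)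
        has_real_derivative f' j x) (at 0)"
      using DERIV_mult[OF 1 2] by (simp add: f'_def algebra_simps)
  next
    show "continuous_on UNIV (\<lambda>x. elem_cutoff \<rho> k x * q (lcoord \<rho> x) $ j)"
      by (intro continuous_intros qlc ec)
    show "elem_cutoff \<rho> k x * q (lcoord \<rho> x) $ j = 0" if "x \<notin> ?K" for x
      using elem_cutoff_outside[OF \<rho> that] by simp
  qed (use f'c f'K compact_elem_cutoff_support in auto)
  have int: "integrable lborel (\<lambda>x. \<Sum>j\<in>UNIV. cutoff' k j (lcoord \<rho> x) * q (lcoord \<rho> x) $ j)"
    by (rule integrable_compact_support[OF _ compact_elem_cutoff_support[of \<rho> k]])
       (auto intro!: continuous_intros cc qlc simp: elem_cutoff_outside[OF \<rho>])
  have int_c: "integrable lborel (elem_cutoff \<rho> k)"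
    by (rule integrable_compact_support[OF ec compact_elem_cutoff_support[of \<rho> k]])
       (simp add: elem_cutoff_outside[OF \<rho>])
  have "(\<Sum>j\<in>UNIV. f' j x) = (\<Sum>j\<in>UNIV. cutoff' k j (lcoord \<rho> x) * q (lcoord \<rho> x) $ j) + s * elem_cutoff \<rho> k x" for x
    unfolding f'_def sum.distrib by (simp add: div flip: sum_distrib_left)
  moreover have "(\<integral>x. (\<Sum>j\<in>UNIV. f' j x) \<partial>lborel) = 0"
    by (subst Bochner_Integration.integral_sum)
       (auto simp: zero intro!: integrable_compact_support[OF f'c compact_elem_cutoff_support[of \<rho> k]] f'K)
  ultimately show ?thesis using int int_c by simp
qed

lemma inner_matrix_test_deriv:
  "M \<bullet> matrix (blinfun_apply (test_deriv \<rho> k d x)) =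
    (\<Sum>j\<in>UNIV. cutoff' k j (lcoord \<rho> x) * (edge \<rho> j \<bullet> row d M / (edge \<rho> j \<bullet> edge \<rho> j)))"
proof -
  have "M \<bullet> matrix (blinfun_apply (test_deriv \<rho> k d x)) =
      (\<Sum>i\<in>UNIV. \<Sum>l\<in>UNIV. M $ i $ l * ((\<Sum>j\<in>UNIV. cutoff' k j (lcoord \<rho> x) * (edge \<rho> j $ l / (edge \<rho> j \<bullet> edge \<rho> j))) * axis d 1 $ i))"
    by (simp add: inner_vec_def[of M] inner_vec_def[of "M $ _"] matrix_def test_deriv_apply inner_axis)
  also have "\<dots> = (\<Sum>i\<in>UNIV. if i = d then (\<Sum>l\<in>UNIV. M $ d $ l * (\<Sum>j\<in>UNIV. cutoff' k j (lcoord \<rho> x) * (edge \<rho> j $ l / (edge \<rho> j \<bullet> edge \<rho> j)))) else 0)"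
    by (rule sum.cong) (auto simp: axis_def)
  also have "\<dots> = (\<Sum>l\<in>UNIV. \<Sum>j\<in>UNIV. M $ d $ l * (cutoff' k j (lcoord \<rho> x) * (edge \<rho> j $ l / (edge \<rho> j \<bullet> edge \<rho> j))))"
    by (simp add: sum_distrib_left)
  also have "\<dots> = (\<Sum>j\<in>UNIV. \<Sum>l\<in>UNIV. M $ d $ l * (cutoff' k j (lcoord \<rho> x) * (edge \<rho> j $ l / (edge \<rho> j \<bullet> edge \<rho> j))))"
    by (rule sum.swap)
  also have "\<dots> = (\<Sum>j\<in>UNIV. cutoff' k j (lcoord \<rho> x) * (edge \<rho> j \<bullet> row d M / (edge \<rho> j \<bullet> edge \<rho> j)))"
    by (simp add: inner_vec_def[of _ "M $ d"] row_def sum_divide_distrib sum_distrib_left mult_ac)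
  finally show ?thesis .
qed

text \<open>The weak divergence is tested with cutoffs increasing to the whole element interior. The
  stress side equals the constant reference divergence times the integral of the cutoff over the
  volume; dominated convergence on both sides leaves the reference divergence.\<close>

lemma element_divergence:
  fixes g :: "real^3 \<Rightarrow> real^3"
  assumes \<rho>: "cuboid \<rho> E" and sub: "interior E \<subseteq> \<Omega>" and \<Omega>: "\<Omega> \<in> lmeasurable"
    and g: "L2 \<Omega> g" "weak_div \<Omega> \<tau> g" and q: "q \<in> ERT0_hat"
    and row: "\<And>x. x \<in> interior E \<Longrightarrow> row d (\<tau> x) = (1 / elem_J \<rho>) *\<^sub>R (elem_DF \<rho> *v q (lcoord \<rho> x))"
  shows "(\<integral>x. indicator (interior E) x * g x $ d \<partial>lebesgue_on \<Omega>) =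
    (\<Sum>i=1..8. \<Sum>j\<in>UNIV. (2 * ref_vertex i $ j - 1) * q (ref_vertex i) $ j) / 4"
proof -
  obtain D s where D: "\<And>y. (q has_derivative D y) (at y)" "\<And>h. continuous_on UNIV (\<lambda>y. D y h)"
      "\<And>y. (\<Sum>j\<in>UNIV. D y (axis j 1) $ j) = s"
    and s: "s = (\<Sum>i=1..8. \<Sum>j\<in>UNIV. (2 * ref_vertex i $ j - 1) * q (ref_vertex i) $ j) / 4"
    using ERT0_divergence[OF q] by blast
  have \<Omega>s: "\<Omega> \<in> sets lebesgue" using \<Omega> by auto
  define R where "R k x = (\<Sum>j\<in>UNIV. cutoff' k j (lcoord \<rho> x) * q (lcoord \<rho> x) $ j)" for k x
  have out: "x \<notin> elem_cutoff_support \<rho> k" if "x \<notin> interior E" for k x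
    using elem_cutoff_support_subset[OF \<rho>] that by blast
  have R_out: "R k x = 0" if "x \<notin> interior E" for k x
    unfolding R_def by (simp add: elem_cutoff_outside(2)[OF \<rho> out[OF that]])
  have e_out: "elem_cutoff \<rho> k x = 0" if "x \<notin> interior E" for k x
    by (rule elem_cutoff_outside(1)[OF \<rho> out[OF that]])
  have inner: "\<tau> x \<bullet> matrix (blinfun_apply (test_deriv \<rho> k d x)) = R k x / elem_J \<rho>" for k x
  proof (cases "x \<in> interior E")
    case True
    \<comment> \<open>Dividing by the squared edge length undoes the Piola transform up to the
      volume factor, by orthogonality of the edges.\<close>
    have "edge \<rho> j \<bullet> row d (\<tau> x) / (edge \<rho> j \<bullet> edge \<rho> j) = q (lcoord \<rho> x) $ j / elem_J \<rho>" for j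
      using cuboid_edge_nonzero[OF \<rho>, of j]
      by (simp add: row[OF True] elem_DF_mult cuboid_edge_inner_sum[OF \<rho>])
    then show ?thesis by (simp add: inner_matrix_test_deriv R_def sum_divide_distrib)
  next
    case False
    then have "cutoff' k j (lcoord \<rho> x) = 0" for j
      using elem_cutoff_outside(2)[OF \<rho> out] by blast
    then show ?thesis by (simp add: inner_matrix_test_deriv R_def)
  qed
  have qc: "continuous_on UNIV q"
    using D(1) by (meson continuous_on_eq_continuous_at differentiableI differentiable_imp_continuous_within open_UNIV UNIV_I)
  have qlc: "continuous_on UNIV (\<lambda>x. q (lcoord \<rho> x))"
    using continuous_on_compose2[OF qc continuous_on_lcoord] by simp
  have R_borel: "R k \<in> borel_measurable borel" for k
    unfolding R_def[abs_def]
    by (intro borel_measurable_continuous_onI continuous_intros qlc continuous_on_cutoff continuous_on_lcoord)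
  have e_borel: "elem_cutoff \<rho> k \<in> borel_measurable borel" for k
    unfolding elem_cutoff_def[abs_def]
    by (intro borel_measurable_continuous_onI continuous_on_cutoff continuous_on_lcoord)
  have J: "elem_J \<rho> > 0" by (rule cuboid_J_pos[OF \<rho>])
  have eq: "(\<integral>x. elem_cutoff \<rho> k x * g x $ d \<partial>lebesgue_on \<Omega>) = s / elem_J \<rho> * (\<integral>x. elem_cutoff \<rho> k x \<partial>lborel)" for k
  proof -
    have "L2_inner \<Omega> g (\<lambda>x. elem_cutoff \<rho> k x *\<^sub>R axis d 1) =
        - L2_inner \<Omega> \<tau> (\<lambda>x. matrix (blinfun_apply (test_deriv \<rho> k d x)))"
      using g(2) C1_test_field_cutoff[OF \<rho> sub] unfolding weak_div_def by blast
    then have "(\<integral>x. elem_cutoff \<rho> k x * g x $ d \<partial>lebesgue_on \<Omega>) = - (\<integral>x. R k x / elem_J \<rho> \<partial>lebesgue_on \<Omega>)"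
      by (simp add: L2_inner_def inner inner_axis)
    also have "(\<integral>x. R k x / elem_J \<rho> \<partial>lebesgue_on \<Omega>) = (\<integral>x. R k x \<partial>lborel) / elem_J \<rho>"
      using lebesgue_on_integral_supported[OF R_borel[of k] \<Omega>s] R_out sub by (simp add: subset_iff) blast
    also have "(\<integral>x. R k x \<partial>lborel) = - s * (\<integral>x. elem_cutoff \<rho> k x \<partial>lborel)"
      unfolding R_def by (rule cutoff_integration_by_parts[OF \<rho> D])
    finally show ?thesis by simp
  qed
  have lim: "(\<lambda>k. elem_cutoff \<rho> k x) \<longlonglongrightarrow> indicator (interior E) x" for x
  proof (cases "x \<in> interior E")
    case True
    then have "lcoord \<rho> x \<in> interior ref_cube"
      by (simp add: mem_interior_ref_cube cuboid_interior_iff[OF \<rho>])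
    then show ?thesis using cutoff_tendsto True by (simp add: elem_cutoff_def)
  next
    case False
    then show ?thesis by (simp add: e_out)
  qed
  have e_le: "norm (elem_cutoff \<rho> k x) \<le> indicator (interior E) x" for k x
    using cutoff_bounds e_out[of x k] by (cases "x \<in> interior E") (auto simp: elem_cutoff_def)
  have bE: "bounded E" using cuboid_compact[OF \<rho>] by (rule compact_imp_bounded)
  have fin: "emeasure lborel (interior E) < \<infinity>"
    using emeasure_bounded_finite[OF bounded_subset[OF bE interior_subset]] by simp
  have "(\<lambda>k. \<integral>x. elem_cutoff \<rho> k x \<partial>lborel) \<longlonglongrightarrow> (\<integral>x. indicator (interior E) x \<partial>lborel)"
  proof (rule integral_dominated_convergence)
    show "integrable lborel (indicator (interior E) :: _ \<Rightarrow> real)"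
      using fin by (intro integrable_real_indicator) auto
  qed (use lim e_le e_borel in auto)
  also have "(\<integral>x. indicator (interior E) x \<partial>lborel) = measure lebesgue (interior E)"
    by simp
  \<comment> \<open>The frontier of a convex set is null, so the interior has the full
    volume.\<close>
  also have "\<dots> = elem_J \<rho>"
    using measure_interior[OF bE] negligible_convex_frontier[OF cuboid_convex[OF \<rho>]] cuboid_measure[OF \<rho>] by simp
  finally have "(\<lambda>k. s / elem_J \<rho> * (\<integral>x. elem_cutoff \<rho> k x \<partial>lborel)) \<longlonglongrightarrow> s / elem_J \<rho> * elem_J \<rho>"
    by (rule tendsto_mult_left)
  then have lim1: "(\<lambda>k. \<integral>x. elem_cutoff \<rho> k x * g x $ d \<partial>lebesgue_on \<Omega>) \<longlonglongrightarrow> s"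
    using J by (simp add: eq)
  have gint: "integrable (lebesgue_on \<Omega>) (\<lambda>x. g x $ d)"
    using L2_integrable[OF g(1) \<Omega>] by (rule integrable_bounded_linear[OF bounded_linear_vec_nth])
  have gm: "(\<lambda>x. g x $ d) \<in> borel_measurable (lebesgue_on \<Omega>)"
    using gint by (rule borel_measurable_integrable)
  have "(\<lambda>k. \<integral>x. elem_cutoff \<rho> k x * g x $ d \<partial>lebesgue_on \<Omega>) \<longlonglongrightarrow>
      (\<integral>x. indicator (interior E) x * g x $ d \<partial>lebesgue_on \<Omega>)"
  proof (rule integral_dominated_convergence[where w = "\<lambda>x. norm (g x $ d)"])
    have "interior E \<in> sets lebesgue" by simp
    then have "(indicator (interior E) :: _ \<Rightarrow> real) \<in> borel_measurable (lebesgue_on \<Omega>)"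
      by (intro measurable_restrict_space1 borel_measurable_indicator)
    then show "(\<lambda>x. indicator (interior E) x * g x $ d) \<in> borel_measurable (lebesgue_on \<Omega>)"
      using gm by (rule borel_measurable_times)
    have "elem_cutoff \<rho> k \<in> borel_measurable (lebesgue_on \<Omega>)" for k
      using e_borel by (intro measurable_restrict_space1 measurable_completion) simp
    then show "(\<lambda>x. elem_cutoff \<rho> k x * g x $ d) \<in> borel_measurable (lebesgue_on \<Omega>)" for k
      using gm by (rule borel_measurable_times)
    show "integrable (lebesgue_on \<Omega>) (\<lambda>x. norm (g x $ d))" using gint by (rule integrable_norm)
    show "AE x in lebesgue_on \<Omega>. (\<lambda>k. elem_cutoff \<rho> k x * g x $ d) \<longlonglongrightarrow> indicator (interior E) x * g x $ d"
      using lim by (intro AE_I2 tendsto_mult_right)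
    show "AE x in lebesgue_on \<Omega>. norm (elem_cutoff \<rho> k x * g x $ d) \<le> norm (g x $ d)" for k
    proof (rule AE_I2)
      fix x
      have "norm (elem_cutoff \<rho> k x) \<le> 1" using e_le[of k x] by (rule order_trans) (simp add: indicator_def)
      then show "norm (elem_cutoff \<rho> k x * g x $ d) \<le> norm (g x $ d)"
        by (simp add: abs_mult mult_left_le_one_le)
    qed
  qed
  from LIMSEQ_unique[OF this lim1] s show ?thesis by simp
qed

section \<open>Vertices and shared faces\<close>

definition cube_corner :: "real^3 \<Rightarrow> bool" where
  "cube_corner y \<longleftrightarrow> (\<forall>d. y $ d \<in> {0, 1})"

lemma ref_vertex_simps:
  "ref_vertex (Suc 0) = vector [0,0,0]" "ref_vertex 2 = vector [1,0,0]" "ref_vertex 3 = vector [1,1,0]"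
  "ref_vertex 4 = vector [0,1,0]" "ref_vertex 5 = vector [0,0,1]" "ref_vertex 6 = vector [1,0,1]"
  "ref_vertex 7 = vector [1,1,1]" "ref_vertex 8 = vector [0,1,1]"
  by (simp_all add: ref_vertex_def)

lemma atLeastAtMost_1_8: "{1..8::nat} = {Suc 0,2,3,4,5,6,7,8}" by auto

lemma cube_corner_ref_vertex: "i \<in> {1..8} \<Longrightarrow> cube_corner (ref_vertex i)"
  unfolding atLeastAtMost_1_8 by (auto simp: cube_corner_def forall_3 ref_vertex_simps)

lemma cube_corner_imp_ref_vertex:
  assumes "cube_corner y" shows "\<exists>i\<in>{1..8}. y = ref_vertex i"
proof -
  have "y $ 1 \<in> {0,1}" "y $ 2 \<in> {0,1}" "y $ 3 \<in> {0,1}"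
    using assms by (simp_all add: cube_corner_def)
  then show ?thesis
    unfolding atLeastAtMost_1_8 by (auto simp: vec_eq_iff forall_3 ref_vertex_simps)
qed

lemma inj_on_ref_vertex: "inj_on ref_vertex {1..8}"
  unfolding atLeastAtMost_1_8 by (simp add: vec_eq_iff forall_3 ref_vertex_simps)

lemma cuboid_vertex:
  assumes "cuboid \<rho> E" "i \<in> {1..8}" shows "\<rho> i = elem_map \<rho> (ref_vertex i)"
  using assms by (simp only: cuboid_def)

lemma lcoord_vertex:
  assumes "cuboid \<rho> E" "i \<in> {1..8}" shows "lcoord \<rho> (\<rho> i) = ref_vertex i"
  by (metis assms cuboid_vertex lcoord_elem_map)

lemma cuboid_extreme_point_iff:
  assumes "cuboid \<rho> E" shows "x extreme_point_of E \<longleftrightarrow> cube_corner (lcoord \<rho> x)"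
  using extreme_point_of_cuboid_iff[OF assms] by (simp add: cube_corner_def)

lemma cuboid_extreme_point_vertex:
  assumes "cuboid \<rho> E" "x extreme_point_of E" shows "\<exists>i\<in>{1..8}. x = \<rho> i"
proof -
  obtain i where "i \<in> {1..8}" "lcoord \<rho> x = ref_vertex i"
    using assms cuboid_extreme_point_iff cube_corner_imp_ref_vertex by blast
  then show ?thesis by (metis assms(1) cuboid_vertex elem_map_lcoord)
qed

lemma cuboid_vertex_extreme_point:
  assumes "cuboid \<rho> E" "i \<in> {1..8}" shows "\<rho> i extreme_point_of E"
  by (simp only: cuboid_extreme_point_iff[OF assms(1)] lcoord_vertex[OF assms] cube_corner_ref_vertex[OF assms(2)])

lemma cuboid_vertex_mem:
  assumes "cuboid \<rho> E" "i \<in> {1..8}" shows "\<rho> i \<in> E"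
  using cuboid_vertex_extreme_point[OF assms] by (simp add: extreme_point_of_def)

lemma inj_on_vertex:
  assumes "cuboid \<rho> E" shows "inj_on \<rho> {1..8}"
  by (rule inj_onI) (metis assms lcoord_vertex inj_on_ref_vertex inj_onD)

lemma extreme_point_of_box_face:
  assumes "cuboid \<rho> E" "s \<in> {0, 1}"
  shows "x extreme_point_of box_face \<rho> E j s \<longleftrightarrow> cube_corner (lcoord \<rho> x) \<and> lcoord \<rho> x $ j = s"
  using extreme_point_of_face[OF box_face_face_of[OF assms], of x j] cuboid_extreme_point_iff[OF assms(1), of x]
  by (auto simp: box_face_def extreme_point_of_def)

text \<open>The centre of a face has exactly one local coordinate in {0, 1}, which reveals both the
  direction and the side.\<close>

lemma box_face_inj:
  assumes "cuboid \<rho> E" "s \<in> {0, 1}" "s' \<in> {0, 1}" "box_face \<rho> E j s = box_face \<rho> E j' s'"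
  shows "j = j' \<and> s = s'"
proof -
  define p where "p = elem_map \<rho> (\<chi> d. if d = j then s else 1 / 2)"
  have "p \<in> box_face \<rho> E j s"
    using assms(2) by (auto simp: p_def box_face_def cuboid_iff[OF assms(1)] lcoord_elem_map[OF assms(1)])
  then have "p \<in> box_face \<rho> E j' s'" using assms(4) by simp
  then have "(if j' = j then s else 1 / 2) = s'"
    by (simp add: p_def box_face_def lcoord_elem_map[OF assms(1)])
  then show ?thesis using assms(3) by (auto split: if_splits)
qed

section \<open>Centres, normals and areas of facets\<close>

definition box_center :: "(nat \<Rightarrow> real^3) \<Rightarrow> real^3" where
  "box_center \<rho> = elem_map \<rho> (\<chi> d. 1 / 2)"

text \<open>The vector from the centre of the box to the centre of the facet: an outward normal of
  half an edge length.\<close>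

definition face_offset :: "(nat \<Rightarrow> real^3) \<Rightarrow> 3 \<Rightarrow> real \<Rightarrow> real^3" where
  "face_offset \<rho> j s = (s - 1 / 2) *\<^sub>R edge \<rho> j"

lemma lcoord_face_center:
  assumes "cuboid \<rho> E"
  shows "lcoord \<rho> (box_center \<rho> + t *\<^sub>R face_offset \<rho> j s) $ d = (if d = j then 1 / 2 + t * (s - 1 / 2) else 1 / 2)"
  unfolding face_offset_def scaleR_scaleR lcoord_add[OF assms]
  by (simp add: box_center_def lcoord_elem_map[OF assms])

lemma face_offset_nonzero:
  assumes "cuboid \<rho> E" "s \<in> {0, 1}" shows "face_offset \<rho> j s \<noteq> 0"
  using cuboid_edge_nonzero[OF assms(1)] assms(2) by (auto simp: face_offset_def)

lemma norm_face_offset: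
  assumes "s \<in> {0, 1}" shows "norm (face_offset \<rho> j s) = norm (edge \<rho> j) / 2"
  using assms by (auto simp: face_offset_def)

text \<open>A normal of the facet is orthogonal to the two edges spanning it, hence parallel to the
  third. Its orientation is free, so only the absolute value of the product is determined.\<close>

lemma unit_normal_box_face:
  assumes \<rho>: "cuboid \<rho> E" and s: "s \<in> {0, 1}" and n: "unit_normal (box_face \<rho> E j s) n"
  shows "edge \<rho> j = (n \<bullet> edge \<rho> j) *\<^sub>R n" and "\<bar>n \<bullet> edge \<rho> j\<bar> = norm (edge \<rho> j)"
    and "k \<noteq> j \<Longrightarrow> n \<bullet> edge \<rho> k = 0"
proof -
  have perp: "n \<bullet> edge \<rho> k = 0" if "k \<noteq> j" for k
  proof -
    define p where "p = elem_map \<rho> (\<chi> d. if d = j then s else 0)"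
    have "p \<in> box_face \<rho> E j s" "p + 1 *\<^sub>R edge \<rho> k \<in> box_face \<rho> E j s"
      using s that unfolding p_def box_face_def mem_Collect_eq cuboid_iff[OF \<rho>] lcoord_add[OF \<rho>] lcoord_elem_map[OF \<rho>]
      by auto
    then have "n \<bullet> (p + 1 *\<^sub>R edge \<rho> k - p) = 0" using n unfolding unit_normal_def by blast
    then show ?thesis by simp
  qed
  then show "k \<noteq> j \<Longrightarrow> n \<bullet> edge \<rho> k = 0" .
  let ?e = "edge \<rho> j"
  have "n = (\<Sum>d\<in>UNIV. if d = j then (?e \<bullet> n / (?e \<bullet> ?e)) *\<^sub>R ?e else 0)"
    by (subst cuboid_expansion[OF \<rho>, of n], rule sum.cong) (auto simp: perp inner_commute)
  then have n_eq: "n = (n \<bullet> ?e / (?e \<bullet> ?e)) *\<^sub>R ?e" by (simp add: inner_commute)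
  have "norm n = 1" using n by (simp add: unit_normal_def)
  then have nn: "n \<bullet> n = 1" by (simp add: dot_square_norm)
  have ee: "?e \<bullet> ?e \<noteq> 0" using cuboid_edge_nonzero[OF \<rho>] by simp
  have "n \<bullet> n = (n \<bullet> ?e / (?e \<bullet> ?e)) * (n \<bullet> ?e)"
    by (subst (2) n_eq) simp
  then have sq: "(n \<bullet> ?e)\<^sup>2 = ?e \<bullet> ?e"
    using nn ee by (simp add: field_simps power2_eq_square)
  then show "\<bar>n \<bullet> ?e\<bar> = norm ?e"
    by (metis norm_eq_sqrt_inner real_sqrt_abs)
  have "(n \<bullet> ?e) *\<^sub>R n = ((n \<bullet> ?e) * (n \<bullet> ?e / (?e \<bullet> ?e))) *\<^sub>R ?e"
    by (subst (2) n_eq) simp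
  then show "?e = (n \<bullet> ?e) *\<^sub>R n" using sq ee by (simp add: power2_eq_square)
qed

lemma face_offset_normal:
  assumes "cuboid \<rho> E" "s \<in> {0, 1}" "unit_normal (box_face \<rho> E j s) n"
  shows "face_offset \<rho> j s = (n \<bullet> face_offset \<rho> j s) *\<^sub>R n" "\<bar>n \<bullet> face_offset \<rho> j s\<bar> = norm (face_offset \<rho> j s)"
proof -
  have "(s - 1/2) *\<^sub>R edge \<rho> j = (s - 1/2) *\<^sub>R ((n \<bullet> edge \<rho> j) *\<^sub>R n)"
    using unit_normal_box_face(1)[OF assms] by simp
  then show "face_offset \<rho> j s = (n \<bullet> face_offset \<rho> j s) *\<^sub>R n"
    unfolding face_offset_def inner_scaleR_right scaleR_scaleR .
  show "\<bar>n \<bullet> face_offset \<rho> j s\<bar> = norm (face_offset \<rho> j s)"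
    using unit_normal_box_face(2)[OF assms] by (simp add: face_offset_def abs_mult)
qed

text \<open>Two point reflections compose to the translation by twice the difference of their
  centres, and a compact set is not mapped into itself by a nonzero translation. This makes the
  centre of a facet independent of the element from which it is computed.\<close>

lemma symmetry_center_unique:
  fixes f :: "'a::euclidean_space set"
  assumes "compact f" "f \<noteq> {}" "\<And>x. x \<in> f \<Longrightarrow> 2 *\<^sub>R m - x \<in> f" "\<And>x. x \<in> f \<Longrightarrow> 2 *\<^sub>R m' - x \<in> f"
  shows "m = m'"
proof -
  let ?d = "m' - m"
  obtain x where x: "x \<in> f" "\<And>y. y \<in> f \<Longrightarrow> ?d \<bullet> y \<le> ?d \<bullet> x"
    using continuous_attains_sup[OF assms(1,2), of "\<lambda>x. ?d \<bullet> x"]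
      continuous_on_inner[OF continuous_on_const continuous_on_id, of f ?d] by auto
  have "2 *\<^sub>R m' - (2 *\<^sub>R m - x) \<in> f" by (intro assms x)
  from x(2)[OF this] have "?d \<bullet> (x + 2 *\<^sub>R ?d) \<le> ?d \<bullet> x" by (simp add: algebra_simps)
  then have le: "?d \<bullet> ?d \<le> 0" by (simp add: inner_add_right)
  have "?d = 0"
  proof (rule ccontr)
    assume "?d \<noteq> 0"
    then have "0 < ?d \<bullet> ?d" by (simp only: inner_gt_zero_iff not_False_eq_True)
    with le show False by linarith
  qed
  then show ?thesis by simp
qed

lemma box_face_compact:
  assumes "cuboid \<rho> E" "s \<in> {0, 1}" shows "compact (box_face \<rho> E j s)"
  using face_of_imp_compact[OF cuboid_convex[OF assms(1)] cuboid_compact[OF assms(1)] box_face_face_of[OF assms]] .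

lemma lcoord_reflect:
  assumes "cuboid \<rho> E"
  shows "lcoord \<rho> (2 *\<^sub>R m - x) $ d = 2 * lcoord \<rho> m $ d - lcoord \<rho> x $ d"
proof -
  have "2 *\<^sub>R m - x - \<rho> 1 = 2 *\<^sub>R (m - \<rho> 1) - (x - \<rho> 1)" by (simp add: scaleR_2)
  then show ?thesis unfolding lcoord_nth
    by (simp only: inner_diff_right[of _ "2 *\<^sub>R (m - \<rho> 1)" "x - \<rho> 1"] diff_divide_distrib inner_scaleR_right times_divide_eq_right)
qed

lemma box_face_center_mem:
  assumes "cuboid \<rho> E" "s \<in> {0, 1}"
  shows "box_center \<rho> + face_offset \<rho> j s \<in> box_face \<rho> E j s"
  using assms(2) lcoord_face_center[OF assms(1), of 1 j s]
  by (auto simp: box_face_def cuboid_iff[OF assms(1)])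

lemma box_face_symmetric:
  assumes "cuboid \<rho> E" "s \<in> {0, 1}" "x \<in> box_face \<rho> E j s"
  shows "2 *\<^sub>R (box_center \<rho> + face_offset \<rho> j s) - x \<in> box_face \<rho> E j s"
  using assms(2,3) lcoord_face_center[OF assms(1), of 1 j s]
  by (auto simp: box_face_def cuboid_iff[OF assms(1)] lcoord_reflect[OF assms(1)])

lemma shared_face_center:
  assumes "cuboid \<rho> E" "s \<in> {0, 1}" "cuboid \<rho>' E'" "s' \<in> {0, 1}"
    and "box_face \<rho> E j s = box_face \<rho>' E' j' s'"
  shows "box_center \<rho> + face_offset \<rho> j s = box_center \<rho>' + face_offset \<rho>' j' s'"
proof (rule symmetry_center_unique)
  show "compact (box_face \<rho> E j s)" by (rule box_face_compact[OF assms(1,2)])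
  show "box_face \<rho> E j s \<noteq> {}" using box_face_center_mem[OF assms(1,2)] by blast
qed (use box_face_symmetric assms in \<open>metis\<close>)+

text \<open>The area of a face is the volume of the prism of height one over it.\<close>

definition face_prism :: "(real^3) set \<Rightarrow> real^3 \<Rightarrow> (real^3) set" where
  "face_prism f n = {x + t *\<^sub>R n | x t. x \<in> f \<and> 0 \<le> t \<and> t \<le> 1}"

text \<open>The prism is the image of the unit cube under the edge matrix with edge \<open>j\<close>
  replaced by the normal; its Gram matrix is diagonal again, so its volume is the product of the
  other two edge lengths.\<close>

lemma measure_face_prism:
  assumes \<rho>: "cuboid \<rho> E" and s: "s \<in> {0, 1}" and n: "unit_normal (box_face \<rho> E j s) n"
  shows "measure lebesgue (face_prism (box_face \<rho> E j s) n) * norm (edge \<rho> j) = elem_J \<rho>"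
proof -
  define L :: "real^3^3" where "L = (\<chi> i k. if k = j then n $ i else edge \<rho> k $ i)"
  define c where "c = \<rho> 1 + s *\<^sub>R edge \<rho> j"
  have Lv: "L *v y = y $ j *\<^sub>R n + (\<Sum>k\<in>UNIV - {j}. y $ k *\<^sub>R edge \<rho> k)" for y
  proof -
    have "L *v y = (\<Sum>k\<in>UNIV. if k = j then y $ j *\<^sub>R n else y $ k *\<^sub>R edge \<rho> k)"
      by (auto simp: L_def matrix_vector_mult_def vec_eq_iff intro!: sum.cong)
    then show ?thesis by (simp add: sum.remove[of UNIV j])
  qed
  have em: "elem_map \<rho> y = \<rho> 1 + y $ j *\<^sub>R edge \<rho> j + (\<Sum>k\<in>UNIV - {j}. y $ k *\<^sub>R edge \<rho> k)" for y
    by (simp add: elem_map_sum sum.remove[of UNIV j])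
  have "face_prism (box_face \<rho> E j s) n = (+) c ` ((*v) L ` ref_cube)"
  proof (intro equalityI subsetI)
    fix z assume "z \<in> face_prism (box_face \<rho> E j s) n"
    then obtain x t where z: "z = x + t *\<^sub>R n" "x \<in> box_face \<rho> E j s" "0 \<le> t" "t \<le> 1"
      by (auto simp: face_prism_def)
    define y where "y = (\<chi> d. if d = j then t else lcoord \<rho> x $ d)"
    have y: "y \<in> ref_cube"
      using z by (auto simp: ref_cube_def mem_box_cart y_def box_face_def cuboid_iff[OF \<rho>])
    have "x = elem_map \<rho> (lcoord \<rho> x)" by (simp add: elem_map_lcoord[OF \<rho>])
    also have "\<dots> = c + (\<Sum>k\<in>UNIV - {j}. y $ k *\<^sub>R edge \<rho> k)"
      using z(2) by (simp add: em c_def box_face_def y_def)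
    finally have "z = c + L *v y" by (simp add: z(1) Lv y_def)
    then show "z \<in> (+) c ` ((*v) L ` ref_cube)" using y by blast
  next
    fix z assume "z \<in> (+) c ` ((*v) L ` ref_cube)"
    then obtain y where y: "y \<in> ref_cube" "z = c + L *v y" by blast
    define x where "x = elem_map \<rho> (\<chi> d. if d = j then s else y $ d)"
    have "x \<in> box_face \<rho> E j s"
      using y(1) s by (auto simp: x_def box_face_def cuboid_iff[OF \<rho>] lcoord_elem_map[OF \<rho>] ref_cube_def mem_box_cart)
    moreover have "z = x + y $ j *\<^sub>R n" by (simp add: y(2) Lv x_def em c_def)
    moreover have "0 \<le> y $ j" "y $ j \<le> 1" using y(1) by (simp_all add: ref_cube_def mem_box_cart)
    ultimately show "z \<in> face_prism (box_face \<rho> E j s) n" unfolding face_prism_def by blast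
  qed
  then have "measure lebesgue (face_prism (box_face \<rho> E j s) n) = measure lebesgue ((*v) L ` ref_cube)"
    by (simp add: measure_translation)
  also have "\<dots> = \<bar>det L\<bar> * measure lebesgue ref_cube"
    using measure_linear_image[of "(*v) L" ref_cube] by (simp add: ref_cube_def)
  also have "measure lebesgue ref_cube = 1"
    by (simp add: ref_cube_def content_cbox_cart interval_ne_empty_cart)
  finally have meas: "measure lebesgue (face_prism (box_face \<rho> E j s) n) = \<bar>det L\<bar>" by simp
  have n1: "n \<bullet> n = 1" using n by (simp add: unit_normal_def dot_square_norm)
  have "transpose L ** L = (\<chi> i k. (if i = j then n else edge \<rho> i) \<bullet> (if k = j then n else edge \<rho> k))"
    by (simp add: matrix_matrix_mult_def transpose_def L_def vec_eq_iff inner_vec_def)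
  moreover have "det (\<chi> i k. (if i = j then n else edge \<rho> i) \<bullet> (if k = j then n else edge \<rho> k)) =
      (\<Prod>i\<in>UNIV. (if i = j then n else edge \<rho> i) \<bullet> (if i = j then n else edge \<rho> i))"
    using unit_normal_box_face(3)[OF \<rho> s n]
    by (subst det_diagonal) (auto simp: cuboid_edge_orthogonal[OF \<rho>] inner_commute)
  moreover have "\<dots> = (\<Prod>i\<in>UNIV - {j}. edge \<rho> i \<bullet> edge \<rho> i)"
    by (simp add: prod.remove[of UNIV j] n1)
  ultimately have "det (transpose L ** L) = (\<Prod>i\<in>UNIV - {j}. edge \<rho> i \<bullet> edge \<rho> i)" by simp
  then have "(det L)\<^sup>2 = (\<Prod>i\<in>UNIV - {j}. norm (edge \<rho> i))\<^sup>2"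
    by (simp add: det_mul det_transpose prod_power_distrib power2_norm_eq_inner power2_eq_square[of "det L"])
  then have "\<bar>det L\<bar>\<^sup>2 = (\<Prod>i\<in>UNIV - {j}. norm (edge \<rho> i))\<^sup>2" by simp
  then have "\<bar>det L\<bar> = (\<Prod>i\<in>UNIV - {j}. norm (edge \<rho> i))"
    by (rule power2_eq_imp_eq) (simp_all add: prod_nonneg)
  then show ?thesis by (simp add: meas cuboid_det[OF \<rho>] prod.remove[of UNIV j] mult.commute)
qed

text \<open>If both outward offsets pointed to the same side, a point slightly behind the common
  face centre would be interior to both boxes.\<close>

lemma shared_face_opposite:
  assumes \<rho>: "cuboid \<rho> E" "s \<in> {0, 1}" and \<rho>': "cuboid \<rho>' E'" "s' \<in> {0, 1}"
    and eq: "box_face \<rho> E j s = box_face \<rho>' E' j' s'"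
    and n: "unit_normal (box_face \<rho> E j s) n"
    and disj: "interior E \<inter> interior E' = {}"
  shows "(n \<bullet> face_offset \<rho> j s) * (n \<bullet> face_offset \<rho>' j' s') < 0"
proof (rule ccontr)
  let ?o = "face_offset \<rho> j s" and ?o' = "face_offset \<rho>' j' s'"
  assume "\<not> ?thesis"
  then have pos: "(n \<bullet> ?o) * (n \<bullet> ?o') \<ge> 0" by simp
  have o: "?o = (n \<bullet> ?o) *\<^sub>R n" "?o \<noteq> 0" and o': "?o' = (n \<bullet> ?o') *\<^sub>R n" "?o' \<noteq> 0"
    using face_offset_normal(1)[OF \<rho> n] face_offset_nonzero[OF \<rho>]
      face_offset_normal(1)[OF \<rho>' n[unfolded eq]] face_offset_nonzero[OF \<rho>'] by auto
  have nz: "n \<bullet> ?o \<noteq> 0" "n \<bullet> ?o' \<noteq> 0" using o o' by auto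
  define c where "c = (n \<bullet> ?o') / (n \<bullet> ?o)"
  have "c > 0" using pos nz unfolding c_def by (simp add: zero_less_divide_iff zero_le_mult_iff) linarith
  have oc: "?o' = c *\<^sub>R ?o"
  proof -
    have "c *\<^sub>R ?o = c *\<^sub>R ((n \<bullet> ?o) *\<^sub>R n)" using o(1) by simp
    also have "\<dots> = (n \<bullet> ?o') *\<^sub>R n" using nz by (simp add: c_def)
    finally show ?thesis using o'(1) by simp
  qed
  \<comment> \<open>Going back by \<open>t\<close> along the first offset is going back by
    \<open>t / c\<close> along the second; neither may pass half of its offset.\<close>
  define t where "t = min (1/2) (c / 2)"
  have t: "0 < t" "t \<le> 1/2" "0 < t / c" "t / c \<le> 1/2"
    using \<open>c > 0\<close> by (auto simp: t_def min_def field_simps)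
  have in_box: "box_center \<rho>0 + (1 - t0) *\<^sub>R face_offset \<rho>0 j0 s0 \<in> interior E0"
    if "cuboid \<rho>0 E0" "s0 \<in> {0, 1}" "0 < t0" "t0 \<le> 1/2" for \<rho>0 E0 j0 s0 t0
    unfolding cuboid_interior_iff[OF that(1)] lcoord_face_center[OF that(1)] using that by (auto simp: field_simps)
  have "box_center \<rho> + (1 - t) *\<^sub>R ?o = (box_center \<rho> + ?o) - t *\<^sub>R ?o" by (simp add: algebra_simps)
  also have "\<dots> = (box_center \<rho>' + ?o') - t *\<^sub>R ?o"
    using shared_face_center[OF \<rho> \<rho>' eq] by simp
  also have "\<dots> = box_center \<rho>' + (1 - t / c) *\<^sub>R ?o'"
    unfolding oc using \<open>c > 0\<close> by (simp add: algebra_simps)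
  finally have "box_center \<rho> + (1 - t) *\<^sub>R ?o \<in> interior E'"
    using in_box[OF \<rho>' t(3,4)] by simp
  then show False using in_box[OF \<rho> t(1,2)] disj by blast
qed

section \<open>Cuboid meshes\<close>

text \<open>The offset as a function of the facet as a set; the choice is harmless since a facet
  determines its direction and side.\<close>

definition facet_offset :: "(nat \<Rightarrow> real^3) \<Rightarrow> (real^3) set \<Rightarrow> (real^3) set \<Rightarrow> real^3" where
  "facet_offset \<rho> E f = (SOME v. \<exists>j. \<exists>s\<in>{0, 1}. f = box_face \<rho> E j s \<and> v = face_offset \<rho> j s)"

lemma facet_offset_box_face:
  assumes "cuboid \<rho> E" "s \<in> {0, 1}"
  shows "facet_offset \<rho> E (box_face \<rho> E j s) = face_offset \<rho> j s"
  unfolding facet_offset_def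
proof (rule some_equality)
  show "\<exists>j'. \<exists>s'\<in>{0, 1}. box_face \<rho> E j s = box_face \<rho> E j' s' \<and> face_offset \<rho> j s = face_offset \<rho> j' s'"
    using assms(2) by blast
  fix v assume "\<exists>j'. \<exists>s'\<in>{0, 1}. box_face \<rho> E j s = box_face \<rho> E j' s' \<and> v = face_offset \<rho> j' s'"
  then obtain j' s' where "s' \<in> {0, 1}" "box_face \<rho> E j s = box_face \<rho> E j' s'" "v = face_offset \<rho> j' s'"
    by blast
  then show "v = face_offset \<rho> j s" using box_face_inj[OF assms, of s' j j'] by simp
qed

text \<open>Up to the sign given by the orientation of \<open>n\<close>, this is a quarter of the area of \<open>f\<close>.\<close>

definition facet_weight :: "(nat \<Rightarrow> real^3) \<Rightarrow> (real^3) set \<Rightarrow> (real^3) set \<Rightarrow> real^3 \<Rightarrow> real" where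
  "facet_weight \<rho> E f n = elem_J \<rho> * (n \<bullet> facet_offset \<rho> E f) / (8 * (norm (facet_offset \<rho> E f))\<^sup>2)"

text \<open>The offset is half an edge, so the volume of the box is twice its length times the facet
  area. Written with the area, the weight depends on the element only through a sign.\<close>

lemma facet_weight_prism:
  assumes "cuboid \<rho> E" "f facet_of E" "unit_normal f n"
  shows "facet_weight \<rho> E f n = sgn (n \<bullet> facet_offset \<rho> E f) * measure lebesgue (face_prism f n) / 4"
    and "n \<bullet> facet_offset \<rho> E f \<noteq> 0"
proof -
  obtain j s where f: "s \<in> {0, 1}" "f = box_face \<rho> E j s"
    using assms(1,2) facet_of_cuboid_iff by blast
  define v where "v = facet_offset \<rho> E f"
  have v: "v = face_offset \<rho> j s" by (simp only: v_def f(2) facet_offset_box_face[OF assms(1) f(1)])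
  have nv: "\<bar>n \<bullet> v\<bar> = norm v" using face_offset_normal(2)[OF assms(1) f(1)] assms(3) by (simp add: v f(2))
  have v0: "norm v > 0" using face_offset_nonzero[OF assms(1) f(1)] by (simp add: v)
  show "n \<bullet> facet_offset \<rho> E f \<noteq> 0" using nv v0 unfolding v_def by linarith
  have e2: "norm (edge \<rho> j) = 2 * norm v"
    using norm_face_offset[OF f(1), of \<rho> j] by (simp add: v)
  have J: "elem_J \<rho> = measure lebesgue (face_prism f n) * (2 * norm v)"
    using measure_face_prism[OF assms(1) f(1) assms(3)[unfolded f(2)], folded f(2)] unfolding e2 by (rule sym)
  have "n \<bullet> v = sgn (n \<bullet> v) * norm v" using nv by (metis sgn_mult_abs)
  then have "elem_J \<rho> * (n \<bullet> v) = sgn (n \<bullet> v) * measure lebesgue (face_prism f n) * (2 * (norm v)\<^sup>2)"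
    unfolding J by (metis (no_types, opaque_lifting) mult.assoc mult.left_commute power2_eq_square)
  then show "facet_weight \<rho> E f n = sgn (n \<bullet> facet_offset \<rho> E f) * measure lebesgue (face_prism f n) / 4"
    using v0 by (simp add: facet_weight_def flip: v_def)
qed

locale cuboid_mesh =
  fixes \<Omega> :: "(real^3) set" and T :: "(real^3) set set" and r :: "(real^3) set \<Rightarrow> nat \<Rightarrow> real^3"
  assumes open_domain: "open \<Omega>" and connected_domain: "connected \<Omega>"
    and bounded_domain: "bounded \<Omega>" and domain_nonempty: "\<Omega> \<noteq> {}"
    and mesh: "conforming_mesh \<Omega> T" and cuboids: "\<forall>E\<in>T. cuboid (r E) E"
begin

lemma cuboid: "E \<in> T \<Longrightarrow> cuboid (r E) E" using cuboids by blast

lemma finite_T: "finite T" and closure_domain: "closure \<Omega> = \<Union>T" and domain_interior: "\<Omega> = interior (\<Union>T)"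
  using mesh unfolding conforming_mesh_def by blast+

lemma disjoint_interiors:
  assumes "E \<in> T" "E' \<in> T" "E \<noteq> E'" shows "interior E \<inter> interior E' = {}"
  using mesh assms unfolding conforming_mesh_def by blast

lemma Int_face_of:
  assumes "E \<in> T" "E' \<in> T" shows "(E \<inter> E') face_of E"
proof (cases "E = E'")
  case True
  then show ?thesis using cuboid_convex[OF cuboid[OF assms(1)]] by (simp add: face_of_refl)
next
  case False
  then show ?thesis using mesh assms unfolding conforming_mesh_def by blast
qed

lemma interior_subset_domain: "E \<in> T \<Longrightarrow> interior E \<subseteq> \<Omega>"
  unfolding domain_interior by (rule interior_mono) blast

lemma domain_subset: "\<Omega> \<subseteq> \<Union>T"
  using closure_subset closure_domain by blast

text \<open>An open set disjoint from the interior of \<open>E'\<close> is disjoint from its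
  closure, which is all of \<open>E'\<close>.\<close>

lemma interior_meets_imp_eq:
  assumes "E \<in> T" "E' \<in> T" "y \<in> interior E" "y \<in> E'" shows "E = E'"
proof (rule ccontr)
  assume "E \<noteq> E'"
  then have "interior E \<inter> interior E' = {}" using disjoint_interiors assms by blast
  then have "interior E \<inter> closure (interior E') = {}"
    by (simp add: open_Int_closure_eq_empty)
  then show False using assms cuboid_closure_interior[OF cuboid[OF assms(2)]] by blast
qed

lemma not_subset:
  assumes "E \<in> T" "E' \<in> T" "E \<subseteq> E'" shows "E = E'"
proof -
  obtain y where "y \<in> interior E" using cuboid_interior_nonempty[OF cuboid[OF assms(1)]] by blast
  then show ?thesis using interior_meets_imp_eq[OF assms(1,2)] interior_subset assms(3) by blast
qed

lemma closed_Union_subset: "\<A> \<subseteq> T \<Longrightarrow> closed (\<Union>\<A>)"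
  using finite_subset[OF _ finite_T] cuboid_compact[OF cuboid] compact_imp_closed
  by (intro closed_Union) blast+

lemma Int_facet_of:
  assumes "E \<in> T" "E' \<in> T" "E \<noteq> E'" "aff_dim (E \<inter> E') \<ge> 2"
  shows "(E \<inter> E') facet_of E"
proof -
  have "E \<inter> E' \<noteq> E" using not_subset[OF assms(1,2)] assms(3) by blast
  then have "aff_dim (E \<inter> E') < aff_dim E"
    by (rule face_of_aff_dim_lt[OF cuboid_convex[OF cuboid[OF assms(1)]] Int_face_of[OF assms(1,2)]])
  then show ?thesis
    using Int_face_of[OF assms(1,2)] assms(4) cuboid_aff_dim[OF cuboid[OF assms(1)]]
    by (auto simp: facet_of_def)
qed

text \<open>Joining a point to a set of dimension at most one spans at most a plane, which is null
  in space.\<close>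

lemma lowdim_hull_interior:
  fixes S :: "(real^3) set"
  assumes "aff_dim S \<le> 1" shows "negligible (affine hull (insert y S))"
proof -
  have "aff_dim (insert y S) \<le> 2" using assms aff_dim_insert[of y S] by (auto split: if_splits)
  then have "interior (affine hull (insert y S)) = {}"
    using aff_dim_nonempty_interior[of "affine hull (insert y S)"] by (auto simp: aff_dim_affine_hull)
  then show ?thesis
    by (simp add: negligible_convex_interior affine_imp_convex affine_affine_hull)
qed

text \<open>A path between two elements that share a point of \<open>\<Omega>\<close> can be chosen to miss all
  intersections of elements of dimension at most one; where it changes elements, these share a facet.\<close>

lemma facet_connected:
  assumes p: "\<And>A B f. A \<in> T \<Longrightarrow> B \<in> T \<Longrightarrow> f facet_of A \<Longrightarrow> f facet_of B \<Longrightarrow> p A = p B"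
    and AB: "A \<in> T" "B \<in> T"
  shows "p A = p B"
proof (rule ccontr)
  assume ne: "p A \<noteq> p B"
  define \<A> where "\<A> = {E \<in> T. p E = p A}"
  define \<B> where "\<B> = {E \<in> T. p E \<noteq> p A}"
  have sub: "\<A> \<subseteq> T" "\<B> \<subseteq> T" and un: "\<Union>\<A> \<union> \<Union>\<B> = \<Union>T" by (auto simp: \<A>_def \<B>_def)
  have closed: "closed (\<Union>\<A>)" "closed (\<Union>\<B>)" using sub by (simp_all add: closed_Union_subset)
  have meets: "\<Union>\<E> \<inter> \<Omega> \<noteq> {}" if "E \<in> \<E>" "E \<in> T" for \<E> E
    using interior_subset_domain[OF that(2)] cuboid_interior_nonempty[OF cuboid[OF that(2)]] interior_subset[of E] that(1)
    by blast
  \<comment> \<open>Two closed sets that cover the connected domain and both meet it must have a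
    common point in it.\<close>
  have "\<Union>\<A> \<inter> \<Union>\<B> \<inter> \<Omega> \<noteq> {}"
  proof
    assume "\<Union>\<A> \<inter> \<Union>\<B> \<inter> \<Omega> = {}"
    moreover have "\<Omega> \<subseteq> \<Union>\<A> \<union> \<Union>\<B>" using domain_subset un by simp
    moreover have "\<Union>\<A> \<inter> \<Omega> \<noteq> {}" by (rule meets[of A]) (use AB in \<open>auto simp: \<A>_def\<close>)
    moreover have "\<Union>\<B> \<inter> \<Omega> \<noteq> {}" by (rule meets[of B]) (use AB ne in \<open>auto simp: \<B>_def\<close>)
    ultimately show False using connected_domain closed unfolding connected_closed by blast
  qed
  then obtain x A' B' where x: "x \<in> \<Omega>" "x \<in> A'" "x \<in> B'" and A': "A' \<in> \<A>" and B': "B' \<in> \<B>" by blast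
  obtain e where e: "e > 0" "ball x e \<subseteq> \<Omega>" using open_domain x(1) open_contains_ball by blast
  have near: "interior E \<inter> ball x e \<noteq> {}" if "E \<in> T" "x \<in> E" for E
  proof -
    have "x \<in> closure (interior E)" using that cuboid_closure_interior[OF cuboid[OF that(1)]] by simp
    then obtain w where "w \<in> interior E" "dist w x < e" using e(1) closure_approachable by blast
    then show ?thesis by (auto simp: dist_commute)
  qed
  have AT: "A' \<in> T" "B' \<in> T" using A' B' sub by auto
  obtain y where y: "y \<in> interior A'" "y \<in> ball x e" using near[OF AT(1) x(2)] by blast
  \<comment> \<open>All end points whose segment from \<open>y\<close> could run through a small
    intersection; finitely many null sets.\<close>
  define Bad where "Bad = (\<Union>(C, D)\<in>{(C, D). C \<in> T \<and> D \<in> T \<and> aff_dim (C \<inter> D) \<le> 1}. affine hull (insert y (C \<inter> D)))"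
  have "finite {(C, D). C \<in> T \<and> D \<in> T \<and> aff_dim (C \<inter> D) \<le> 1}"
    by (rule finite_subset[OF _ finite_cartesian_product[OF finite_T finite_T]]) auto
  then have "negligible Bad"
    unfolding Bad_def by (intro negligible_Union finite_imageI) (auto intro: lowdim_hull_interior)
  moreover have "\<not> negligible (interior B' \<inter> ball x e)"
    using near[OF AT(2) x(3)] by (intro open_not_negligible) auto
  ultimately have "\<not> interior B' \<inter> ball x e \<subseteq> Bad" by (metis negligible_subset)
  then obtain z where z: "z \<in> interior B'" "z \<in> ball x e" "z \<notin> Bad" by blast
  have seg: "closed_segment y z \<subseteq> \<Omega>"
    using closed_segment_subset[OF y(2) z(2) convex_ball] e(2) by blast
  have "\<Union>\<A> \<inter> \<Union>\<B> \<inter> closed_segment y z \<noteq> {}"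
  proof
    assume "\<Union>\<A> \<inter> \<Union>\<B> \<inter> closed_segment y z = {}"
    moreover have "closed_segment y z \<subseteq> \<Union>\<A> \<union> \<Union>\<B>" using seg domain_subset un by blast
    moreover have "\<Union>\<A> \<inter> closed_segment y z \<noteq> {}"
      using y(1) interior_subset A' by (metis Int_iff Union_iff emptyE ends_in_segment(1) subsetD)
    moreover have "\<Union>\<B> \<inter> closed_segment y z \<noteq> {}"
      using z(1) interior_subset B' by (metis Int_iff Union_iff emptyE ends_in_segment(2) subsetD)
    ultimately show False using connected_segment[of y z] closed unfolding connected_closed by blast
  qed
  then obtain q C D where q: "q \<in> closed_segment y z" "q \<in> C" "q \<in> D" and CD: "C \<in> \<A>" "D \<in> \<B>" by blast
  have CDT: "C \<in> T" "D \<in> T" "C \<noteq> D" using CD by (auto simp: \<A>_def \<B>_def)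
  have "\<not> aff_dim (C \<inter> D) \<le> 1"
  proof
    assume low: "aff_dim (C \<inter> D) \<le> 1"
    have "q \<noteq> y"
    proof
      assume "q = y"
      then have "A' = C" "A' = D" using interior_meets_imp_eq[OF AT(1) _ y(1)] q(2,3) CDT by auto
      then show False using CDT by simp
    qed
    obtain t where t: "q = (1 - t) *\<^sub>R y + t *\<^sub>R z" using q(1) by (auto simp: in_segment)
    with \<open>q \<noteq> y\<close> have "t \<noteq> 0" by auto
    have "q - y = t *\<^sub>R (z - y)" by (simp add: t algebra_simps)
    \<comment> \<open>\<open>z\<close> lies on the line through \<open>y\<close> and
      \<open>q\<close>, hence in the affine hull that it was chosen to avoid.\<close>
    then have "z = y + (1 / t) *\<^sub>R (q - y)" using \<open>t \<noteq> 0\<close> by simp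
    also have "\<dots> \<in> affine hull (insert y (C \<inter> D))"
      by (rule mem_affine_3_minus) (use q in \<open>auto intro: hull_inc\<close>)
    finally have "z \<in> Bad" using low CDT by (auto simp: Bad_def)
    then show False using z(3) by simp
  qed
  then have "aff_dim (C \<inter> D) \<ge> 2" by simp
  then have "(C \<inter> D) facet_of C" "(C \<inter> D) facet_of D"
    using Int_facet_of CDT by (metis, metis Int_commute)
  then have "p C = p D" using p CDT by blast
  then show False using CD by (simp add: \<A>_def \<B>_def)
qed

text \<open>Centre and area belong to the facet, whereas the outward direction flips; therefore the
  two weights cancel and the offsets end at the same point.\<close>

lemma shared_facet:
  assumes AB: "A \<in> T" "B \<in> T" "A \<noteq> B" and f: "f facet_of A" "f facet_of B" and n: "unit_normal f n"
  shows "box_center (r A) + facet_offset (r A) A f = box_center (r B) + facet_offset (r B) B f"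
    and "(n \<bullet> facet_offset (r A) A f) * (n \<bullet> facet_offset (r B) B f) < 0"
    and "facet_weight (r B) B f n = - facet_weight (r A) A f n"
proof -
  note cA = cuboid[OF AB(1)] and cB = cuboid[OF AB(2)]
  obtain j s where j: "s \<in> {0, 1}" "f = box_face (r A) A j s" using facet_of_cuboid_iff[OF cA] f(1) by blast
  obtain j' s' where j': "s' \<in> {0, 1}" "f = box_face (r B) B j' s'" using facet_of_cuboid_iff[OF cB] f(2) by blast
  have oA: "facet_offset (r A) A f = face_offset (r A) j s"
    using facet_offset_box_face[OF cA j(1)] j(2) by simp
  have oB: "facet_offset (r B) B f = face_offset (r B) j' s'"
    using facet_offset_box_face[OF cB j'(1)] j'(2) by simp
  have eq: "box_face (r A) A j s = box_face (r B) B j' s'" using j j' by simp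
  show "box_center (r A) + facet_offset (r A) A f = box_center (r B) + facet_offset (r B) B f"
    unfolding oA oB by (rule shared_face_center[OF cA j(1) cB j'(1) eq])
  show neg: "(n \<bullet> facet_offset (r A) A f) * (n \<bullet> facet_offset (r B) B f) < 0"
    unfolding oA oB
    by (rule shared_face_opposite[OF cA j(1) cB j'(1) eq n[unfolded j(2)] disjoint_interiors[OF AB]])
  then have "sgn (n \<bullet> facet_offset (r B) B f) = - sgn (n \<bullet> facet_offset (r A) A f)"
    by (auto simp: mult_less_0_iff)
  then show "facet_weight (r B) B f n = - facet_weight (r A) A f n"
    by (simp add: facet_weight_prism(1)[OF cA f(1) n] facet_weight_prism(1)[OF cB f(2) n])
qed

text \<open>Among three nonzero reals two have the same sign, so three elements cannot lie pairwise
  on opposite sides of one facet.\<close>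

lemma at_most_two_elements:
  assumes "A \<in> T" "B \<in> T" "C \<in> T" "f facet_of A" "f facet_of B" "f facet_of C" "unit_normal f n"
  shows "A = B \<or> B = C \<or> A = C"
proof (rule ccontr)
  assume "\<not> ?thesis"
  then have "A \<noteq> B" "B \<noteq> C" "A \<noteq> C" by auto
  then show False
    using shared_facet(2)[of A B f n] shared_facet(2)[of B C f n] shared_facet(2)[of A C f n] assms
    by (auto simp: mult_less_0_iff)
qed

lemma facet_elements_cases:
  assumes "f \<in> mesh_faces T" "unit_normal f n"
  obtains (one) A where "A \<in> T" "f facet_of A" "{E \<in> T. f facet_of E} = {A}"
  | (two) A B where "A \<in> T" "B \<in> T" "A \<noteq> B" "f facet_of A" "f facet_of B" "{E \<in> T. f facet_of E} = {A, B}"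
proof -
  obtain A where A: "A \<in> T" "f facet_of A" using assms(1) by (auto simp: mesh_faces_def)
  show thesis
  proof (cases "\<exists>B\<in>T. f facet_of B \<and> B \<noteq> A")
    case True
    then obtain B where B: "B \<in> T" "f facet_of B" "A \<noteq> B" by blast
    have "{E \<in> T. f facet_of E} = {A, B}"
      using at_most_two_elements[OF A(1) B(1) _ A(2) B(2) _ assms(2)] A B by auto
    then show thesis by (rule two[OF A(1) B(1,3) A(2) B(2)])
  next
    case False
    then have "E = A" if "E \<in> T" "f facet_of E" for E using that by metis
    then have "{E \<in> T. f facet_of E} = {A}" using A by blast
    then show thesis by (rule one[OF A])
  qed
qed

end

section \<open>Degrees of freedom at an interior vertex\<close>

text \<open>The determinant of a linear involution squares to one.\<close>

lemma measure_involution_image: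
  fixes f :: "real^3 \<Rightarrow> real^3"
  assumes "linear f" "\<And>x. f (f x) = x" "S \<in> lmeasurable"
  shows "measure lebesgue (f ` S) = measure lebesgue S"
proof -
  have "matrix f ** matrix f = matrix (f \<circ> f)"
    by (simp add: matrix_compose[OF assms(1) assms(1)])
  also have "f \<circ> f = id" using assms(2) by auto
  finally have "det (matrix f) * det (matrix f) = 1"
    by (metis det_I det_mul matrix_id_mat_1)
  then have "\<bar>det (matrix f)\<bar> = 1" by (metis abs_1 abs_mult_self_eq real_sqrt_abs2 real_sqrt_one)
  then show ?thesis by (simp add: measure_linear_image[OF assms(1,3)])
qed

text \<open>The reflection in the hyperplane orthogonal to \<open>b\<close> exchanges the two halves
  of \<open>S\<close>, which overlap in a null set.\<close>

lemma measure_half_space: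
  fixes S :: "(real^3) set"
  assumes b: "b \<noteq> 0" and S: "S \<in> lmeasurable"
    and sym: "\<And>y. y \<in> S \<Longrightarrow> y - (2 * (b \<bullet> y) / (b \<bullet> b)) *\<^sub>R b \<in> S"
  shows "measure lebesgue (S \<inter> {y. 0 \<le> b \<bullet> y}) = measure lebesgue S / 2"
proof -
  define f where "f y = y - (2 * (b \<bullet> y) / (b \<bullet> b)) *\<^sub>R b" for y
  have bf: "b \<bullet> f y = - (b \<bullet> y)" for y using b by (simp add: f_def inner_diff_right)
  have ff: "f (f y) = y" for y
  proof -
    have "f (f y) = f y - (2 * (b \<bullet> f y) / (b \<bullet> b)) *\<^sub>R b" by (simp only: f_def[of "f y"])
    then show ?thesis unfolding bf by (simp add: f_def)
  qed
  have lin: "linear f"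
    by (rule linearI) (simp_all add: f_def inner_add_right algebra_simps add_divide_distrib flip: scaleR_add_left)
  let ?P = "S \<inter> {y. 0 \<le> b \<bullet> y}" and ?M = "S \<inter> {y. b \<bullet> y \<le> 0}"
  have hs: "{y. 0 \<le> b \<bullet> y} \<in> sets lebesgue" "{y. b \<bullet> y \<le> 0} \<in> sets lebesgue"
    using closed_halfspace_ge[of 0 b] closed_halfspace_le[of b 0] by auto
  have meas: "?P \<in> lmeasurable" "?M \<in> lmeasurable"
    using hs S by (auto intro: fmeasurable_Int_fmeasurable)
  have "?M = f ` ?P"
  proof (intro equalityI subsetI)
    fix y assume "y \<in> ?M"
    then have "f y \<in> ?P" "y = f (f y)" using sym[of y] by (auto simp: bf ff simp flip: f_def)
    then show "y \<in> f ` ?P" by blast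
  next
    fix y assume "y \<in> f ` ?P"
    then show "y \<in> ?M" using sym by (auto simp: bf simp flip: f_def)
  qed
  then have MP: "measure lebesgue ?M = measure lebesgue ?P"
    using measure_involution_image[OF lin ff meas(1)] by simp
  have "negligible {y. b \<bullet> y = 0}" using b by (intro negligible_hyperplane) auto
  then have "negligible (?P \<inter> ?M)" by (rule negligible_subset) auto
  then have "measure lebesgue (?P \<union> ?M) = measure lebesgue ?P + measure lebesgue ?M"
    using measure_Un3[OF meas] negligible_imp_measure0 by simp
  moreover have "?P \<union> ?M = S" by auto
  ultimately show ?thesis using MP by simp
qed

text \<open>The ball is halved three times. Orthogonality makes each reflection preserve the
  half-spaces already imposed.\<close>

lemma measure_octant:
  fixes b :: "3 \<Rightarrow> real^3"
  assumes "\<And>j. b j \<noteq> 0" "\<And>j k. j \<noteq> k \<Longrightarrow> b j \<bullet> b k = 0"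
  shows "measure lebesgue {y \<in> ball 0 \<epsilon>. \<forall>j. 0 \<le> b j \<bullet> y} = measure lebesgue (ball (0::real^3) \<epsilon>) / 8"
proof -
  define f where "f j y = y - (2 * (b j \<bullet> y) / (b j \<bullet> b j)) *\<^sub>R b j" for j y
  have nf: "norm (f j y) = norm y" for j y
  proof -
    have "f j y \<bullet> f j y = y \<bullet> y"
      using assms(1)[of j] by (simp add: f_def inner_diff_left inner_diff_right inner_commute[of y "b j"] field_simps)
    then show ?thesis by (simp add: norm_eq_sqrt_inner)
  qed
  have bf: "b k \<bullet> f j y = b k \<bullet> y" if "k \<noteq> j" for j k y
    using assms(2)[OF that] by (simp add: f_def inner_diff_right)
  have hs: "{y. 0 \<le> b j \<bullet> y} \<in> sets lebesgue" for j
    using closed_halfspace_ge[of 0 "b j"] by auto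
  let ?S0 = "ball (0::real^3) \<epsilon>"
  let ?S1 = "?S0 \<inter> {y. 0 \<le> b 1 \<bullet> y}"
  let ?S2 = "?S1 \<inter> {y. 0 \<le> b 2 \<bullet> y}"
  have S0: "?S0 \<in> lmeasurable" by simp
  have S1: "?S1 \<in> lmeasurable" using S0 hs by (rule fmeasurable_Int_fmeasurable)
  have S2: "?S2 \<in> lmeasurable" using S1 hs by (rule fmeasurable_Int_fmeasurable)
  have "measure lebesgue ?S1 = measure lebesgue ?S0 / 2"
    by (rule measure_half_space[OF assms(1) S0]) (simp add: nf flip: f_def)
  moreover have "measure lebesgue ?S2 = measure lebesgue ?S1 / 2"
    by (rule measure_half_space[OF assms(1) S1]) (simp add: nf bf flip: f_def)
  moreover have "measure lebesgue (?S2 \<inter> {y. 0 \<le> b 3 \<bullet> y}) = measure lebesgue ?S2 / 2"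
    by (rule measure_half_space[OF assms(1) S2]) (simp add: nf bf flip: f_def)
  moreover have "{y \<in> ball 0 \<epsilon>. \<forall>j. 0 \<le> b j \<bullet> y} = ?S2 \<inter> {y. 0 \<le> b 3 \<bullet> y}"
    by (auto simp: forall_3)
  ultimately show ?thesis by simp
qed

text \<open>Within a distance not exceeding any edge length only the three facets through the corner
  constrain the box, so it coincides there with an octant.\<close>

lemma corner_measure:
  assumes \<rho>: "cuboid \<rho> E" and x: "cube_corner (lcoord \<rho> x)" and \<epsilon>: "\<And>j. \<epsilon> \<le> norm (edge \<rho> j)"
  shows "measure lebesgue (E \<inter> ball x \<epsilon>) = measure lebesgue (ball x \<epsilon>) / 8"
proof -
  \<comment> \<open>The factor is 1 or -1 at a corner and directs the edge from \<open>x\<close>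
    into the box.\<close>
  define b where "b j = (1 - 2 * lcoord \<rho> x $ j) *\<^sub>R edge \<rho> j" for j
  have c: "lcoord \<rho> x $ j = 0 \<or> lcoord \<rho> x $ j = 1" for j using x by (auto simp: cube_corner_def)
  have mem: "x + z \<in> E \<longleftrightarrow> (\<forall>j. 0 \<le> b j \<bullet> z)" if z: "z \<in> ball 0 \<epsilon>" for z
  proof -
    have "(0 \<le> lcoord \<rho> (x + z) $ j \<and> lcoord \<rho> (x + z) $ j \<le> 1) \<longleftrightarrow> 0 \<le> b j \<bullet> z" for j
    proof -
      let ?e = "edge \<rho> j" and ?t = "edge \<rho> j \<bullet> z / (edge \<rho> j \<bullet> edge \<rho> j)"
      have ee: "?e \<bullet> ?e > 0" using cuboid_edge_nonzero[OF \<rho>] by simp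
      have "x + z - \<rho> 1 = (x - \<rho> 1) + z" by simp
      then have l: "lcoord \<rho> (x + z) $ j = lcoord \<rho> x $ j + ?t"
        unfolding lcoord_nth by (simp only: inner_add_right add_divide_distrib)
      have "\<bar>?e \<bullet> z\<bar> \<le> norm ?e * norm z" by (rule Cauchy_Schwarz_ineq2)
      also have "\<dots> \<le> norm ?e * norm ?e" using z \<epsilon>[of j] by (intro mult_left_mono) auto
      finally have "\<bar>?e \<bullet> z\<bar> \<le> ?e \<bullet> ?e" by (simp add: dot_square_norm power2_eq_square)
      then have t: "\<bar>?t\<bar> \<le> 1" using ee by (simp add: abs_divide)
      have s: "0 \<le> ?t \<longleftrightarrow> 0 \<le> ?e \<bullet> z" "?t \<le> 0 \<longleftrightarrow> ?e \<bullet> z \<le> 0"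
        by (simp_all only: pos_le_divide_eq[OF ee] pos_divide_le_eq[OF ee] mult_zero_left)
      show ?thesis
        using c[of j]
      proof
        assume l0: "lcoord \<rho> x $ j = 0"
        then show ?thesis using t s(1) unfolding l b_def by auto
      next
        assume l1: "lcoord \<rho> x $ j = 1"
        then show ?thesis using t s(2) unfolding l b_def by auto
      qed
    qed
    then show ?thesis by (simp add: cuboid_iff[OF \<rho>])
  qed
  have "E \<inter> ball x \<epsilon> = (+) x ` {z \<in> ball 0 \<epsilon>. \<forall>j. 0 \<le> b j \<bullet> z}"
  proof (intro equalityI subsetI)
    fix y assume y: "y \<in> E \<inter> ball x \<epsilon>"
    then have "y - x \<in> ball 0 \<epsilon>" by (simp add: dist_norm norm_minus_commute)
    then have "y - x \<in> {z \<in> ball 0 \<epsilon>. \<forall>j. 0 \<le> b j \<bullet> z}" using mem[of "y - x"] y by simp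
    then have "x + (y - x) \<in> (+) x ` {z \<in> ball 0 \<epsilon>. \<forall>j. 0 \<le> b j \<bullet> z}" by (rule imageI)
    then show "y \<in> (+) x ` {z \<in> ball 0 \<epsilon>. \<forall>j. 0 \<le> b j \<bullet> z}" by simp
  next
    fix y assume "y \<in> (+) x ` {z \<in> ball 0 \<epsilon>. \<forall>j. 0 \<le> b j \<bullet> z}"
    then show "y \<in> E \<inter> ball x \<epsilon>" using mem by (auto simp: dist_norm)
  qed
  then have "measure lebesgue (E \<inter> ball x \<epsilon>) = measure lebesgue {z \<in> ball 0 \<epsilon>. \<forall>j. 0 \<le> b j \<bullet> z}"
    by (simp add: measure_translation)
  also have "\<dots> = measure lebesgue (ball (0::real^3) \<epsilon>) / 8"
  proof (rule measure_octant)
    show "b j \<noteq> 0" for j using c[of j] cuboid_edge_nonzero[OF \<rho>, of j] by (auto simp: b_def)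
    show "b j \<bullet> b k = 0" if "j \<noteq> k" for j k using cuboid_edge_orthogonal[OF \<rho> that] by (simp add: b_def)
  qed
  also have "measure lebesgue (ball (0::real^3) \<epsilon>) = measure lebesgue (ball x \<epsilon>)"
    using measure_translation[of x "ball 0 \<epsilon>"] by (simp add: ball_translation[symmetric] del: measure_translation)
  finally show ?thesis .
qed

section \<open>Counting elements, facets and degrees of freedom at a vertex\<close>

context cuboid_mesh
begin

text \<open>Conformity excludes hanging vertices: the singleton is a face of the common face, hence
  a face of the other element.\<close>

lemma vertex_of_all_elements:
  assumes "E \<in> T" "x extreme_point_of E" "E' \<in> T" "x \<in> E'"
  shows "x extreme_point_of E'"
proof -
  have "x \<in> E" using assms(2) by (simp add: extreme_point_of_def)
  then have "{x} face_of (E \<inter> E')"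
    using face_of_subset[of "{x}" E "E \<inter> E'"] assms(2,4) by (simp add: face_of_singleton)
  then have "{x} face_of E'"
    using Int_face_of[OF assms(3,1)] by (metis Int_commute face_of_trans)
  then show ?thesis by (simp add: face_of_singleton)
qed

lemma negligible_Int:
  assumes "E \<in> T" "E' \<in> T" "E \<noteq> E'" shows "negligible (E \<inter> E')"
proof -
  have "convex (E \<inter> E')"
    by (rule convex_Int[OF cuboid_convex[OF cuboid[OF assms(1)]] cuboid_convex[OF cuboid[OF assms(2)]]])
  moreover have "interior (E \<inter> E') = {}" using disjoint_interiors[OF assms] by simp
  ultimately show ?thesis by (simp add: negligible_convex_interior)
qed

text \<open>Each element at the vertex takes one eighth of a small ball, the overlaps are null, and
  together they fill the ball.\<close>

lemma card_elements_at_interior_vertex: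
  assumes x: "x \<in> \<Omega>" and E0: "E0 \<in> T" "x extreme_point_of E0"
  shows "card {E \<in> T. x \<in> E} = 8"
proof -
  let ?N = "{E \<in> T. x \<in> E}"
  have fin: "finite ?N" using finite_T by simp
  obtain e1 where e1: "e1 > 0" "ball x e1 \<subseteq> \<Omega>" using open_domain x open_contains_ball by blast
  have "closed (\<Union>(T - ?N))" by (rule closed_Union_subset) auto
  then have "open (- \<Union>(T - ?N))" by (simp add: open_Compl)
  moreover have "x \<in> - \<Union>(T - ?N)" by auto
  ultimately obtain e2 where e2: "e2 > 0" "ball x e2 \<subseteq> - \<Union>(T - ?N)" using open_contains_ball by blast
  \<comment> \<open>The radius keeps the ball in the domain, away from elements that miss
    \<open>x\<close>, and below the edge lengths of the others.\<close>
  define L where "L = insert e1 (insert e2 ((\<lambda>(E, j). norm (edge (r E) j)) ` (?N \<times> (UNIV :: 3 set))))"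
  define e where "e = Min L"
  have finL: "finite L" using fin by (auto simp: L_def)
  have le: "e \<le> l" if "l \<in> L" for l using finL that by (simp add: e_def)
  have "l > 0" if "l \<in> L" for l
    using that e1(1) e2(1) cuboid_edge_nonzero[OF cuboid] by (auto simp: L_def)
  then have e0: "e > 0" using finL by (simp add: e_def L_def)
  have m: "measure lebesgue (E \<inter> ball x e) = measure lebesgue (ball x e) / 8" if "E \<in> ?N" for E
  proof (rule corner_measure)
    show "cuboid (r E) E" using cuboid that by simp
    show "cube_corner (lcoord (r E) x)"
      using vertex_of_all_elements[OF E0] that cuboid_extreme_point_iff[OF cuboid] by simp
    show "e \<le> norm (edge (r E) j)" for j by (rule le) (use that in \<open>force simp: L_def\<close>)
  qed
  have cover: "(\<Union>E\<in>?N. E \<inter> ball x e) = ball x e"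
  proof -
    have "ball x e \<subseteq> ball x e1" "ball x e \<subseteq> ball x e2"
      using le[of e1] le[of e2] by (auto simp: L_def)
    then have "ball x e \<subseteq> \<Union>T" "ball x e \<inter> \<Union>(T - ?N) = {}"
      using e1(2) e2(2) domain_subset by blast+
    then show ?thesis by blast
  qed
  have "measure lebesgue (ball x e) = (\<Sum>E\<in>?N. measure lebesgue (E \<inter> ball x e))"
  proof (subst cover[symmetric], rule measure_negligible_finite_Union_image[OF fin])
    show "E \<inter> ball x e \<in> lmeasurable" if "E \<in> ?N" for E
      using that cuboid_compact[OF cuboid] by (simp add: lmeasurable_compact fmeasurable_Int_fmeasurable)
    show "pairwise (\<lambda>E E'. negligible (E \<inter> ball x e \<inter> (E' \<inter> ball x e))) ?N"
      using negligible_Int unfolding pairwise_def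
      by (auto intro: negligible_subset)
  qed
  also have "\<dots> = (\<Sum>E\<in>?N. measure lebesgue (ball x e) / 8)" by (rule sum.cong) (use m in auto)
  finally have "measure lebesgue (ball x e) = real (card ?N) * (measure lebesgue (ball x e) / 8)" by simp
  moreover have "measure lebesgue (ball x e) > 0"
    using e0 content_ball_pos[of e x] by simp
  ultimately have "real (card ?N) = 8" by simp
  then show ?thesis by simp
qed

text \<open>Points just outside \<open>E\<close> beyond a relative interior point of
  \<open>f\<close> lie in other elements; as these are finitely many closed sets, one of them
  contains that point. Its intersection with \<open>E\<close> is then a face containing
  \<open>f\<close>, of the same dimension.\<close>

lemma interior_facet_shared:
  assumes E: "E \<in> T" "f facet_of E" and x: "x \<in> f" "x \<in> \<Omega>"
  shows "\<exists>E'\<in>T. E' \<noteq> E \<and> f facet_of E'"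
proof -
  note c = cuboid[OF E(1)]
  obtain j s where f: "s \<in> {0, 1}" "f = box_face (r E) E j s" using facet_of_cuboid_iff[OF c] E(2) by blast
  have face: "f face_of E" and dim: "aff_dim f = 2"
    using E(2) cuboid_aff_dim[OF c] by (auto simp: facet_of_def)
  have conv: "convex f" using face by (rule face_of_imp_convex)
  obtain e where e: "e > 0" "ball x e \<subseteq> \<Omega>" using open_domain x(2) open_contains_ball by blast
  have "x \<in> closure (rel_interior f)"
    using convex_closure_rel_interior[OF conv] x(1) closure_subset by blast
  then obtain p where p: "p \<in> rel_interior f" "dist p x < e" using e(1) closure_approachable by blast
  then have pf: "p \<in> f" using rel_interior_subset by blast
  have "p \<in> \<Omega>" using p(2) e(2) by (auto simp: dist_commute)
  then obtain e' where e': "e' > 0" "ball p e' \<subseteq> \<Omega>" using open_domain open_contains_ball by blast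
  let ?C = "\<Union>(T - {E})" and ?v = "face_offset (r E) j s"
  have v0: "norm ?v > 0" using face_offset_nonzero[OF c f(1)] by simp
  have "p \<in> closure ?C"
    unfolding closure_approachable
  proof (intro allI impI)
    fix d :: real assume "d > 0"
    \<comment> \<open>The outward step is shorter than the tolerance \<open>d\<close> and than the
      radius \<open>e'\<close> of a ball inside the domain.\<close>
    define t where "t = min d e' / (2 * norm ?v)"
    have t: "t > 0" "t * norm ?v < d" "t * norm ?v < e'"
      using \<open>d > 0\<close> e'(1) v0 by (auto simp: t_def)
    let ?q = "p + t *\<^sub>R ?v"
    have "dist ?q p = t * norm ?v" using t(1) by (simp add: dist_norm)
    then have q: "dist ?q p < d" "?q \<in> \<Omega>" using t e'(2) by (auto simp: dist_commute)
    have "?q = p + (t * (s - 1/2)) *\<^sub>R edge (r E) j" by (simp add: face_offset_def)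
    then have "lcoord (r E) ?q $ j = s + t * (s - 1/2)"
      using pf by (simp only: lcoord_add[OF c]) (simp add: f(2) box_face_def)
    then have "?q \<notin> E" using f(1) t(1) unfolding cuboid_iff[OF c] by (auto intro!: exI[of _ j])
    then have "?q \<in> ?C" using q(2) domain_subset by blast
    then show "\<exists>y\<in>?C. dist y p < d" using q(1) by blast
  qed
  moreover have "closed ?C" by (rule closed_Union_subset) auto
  ultimately have "p \<in> ?C" by simp
  then obtain E' where E': "E' \<in> T" "E' \<noteq> E" "p \<in> E'" by blast
  have "f \<subseteq> E \<inter> E'"
    by (rule subset_of_face_of[OF Int_face_of[OF E(1) E'(1)]])
       (use face_of_imp_subset[OF face] p(1) pf E'(3) in auto)
  then have "aff_dim (E \<inter> E') \<ge> 2" using dim aff_dim_subset by metis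
  then have fac: "(E \<inter> E') facet_of E" "(E \<inter> E') facet_of E'"
    using Int_facet_of[OF E(1) E'(1)] Int_facet_of[OF E'(1) E(1)] E'(2) by (auto simp: Int_commute)
  have "f = E \<inter> E'"
  proof (rule ccontr)
    assume ne: "f \<noteq> E \<inter> E'"
    have "f face_of (E \<inter> E')" by (rule face_of_subset[OF face \<open>f \<subseteq> E \<inter> E'\<close>]) auto
    then have "aff_dim f < aff_dim (E \<inter> E')"
      using face_of_aff_dim_lt[OF _ _ ne] fac(1) by (auto simp: facet_of_def face_of_imp_convex)
    then show False using fac(1) dim cuboid_aff_dim[OF c] by (simp add: facet_of_def)
  qed
  then show ?thesis using fac(2) E' by blast
qed

lemma card_facets_at_vertex:
  assumes "E \<in> T" "x extreme_point_of E"
  shows "card {f. f facet_of E \<and> x \<in> f} = 3"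
proof -
  note c = cuboid[OF assms(1)]
  have cc: "lcoord (r E) x $ j \<in> {0, 1}" for j
    using assms(2) unfolding cuboid_extreme_point_iff[OF c] cube_corner_def by blast
  have xE: "x \<in> E" using assms(2) by (simp add: extreme_point_of_def)
  have "{f. f facet_of E \<and> x \<in> f} = (\<lambda>j. box_face (r E) E j (lcoord (r E) x $ j)) ` UNIV"
  proof (intro equalityI subsetI)
    fix f assume "f \<in> {f. f facet_of E \<and> x \<in> f}"
    then obtain j s where f: "f = box_face (r E) E j s" "x \<in> f" using facet_of_cuboid_iff[OF c] by blast
    then have "s = lcoord (r E) x $ j" by (simp add: box_face_def)
    then show "f \<in> (\<lambda>j. box_face (r E) E j (lcoord (r E) x $ j)) ` UNIV" using f(1) by blast
  next
    fix f assume "f \<in> (\<lambda>j. box_face (r E) E j (lcoord (r E) x $ j)) ` UNIV"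
    then obtain j where "f = box_face (r E) E j (lcoord (r E) x $ j)" by blast
    then show "f \<in> {f. f facet_of E \<and> x \<in> f}"
      using box_face_facet_of[OF c cc] xE by (simp add: box_face_def)
  qed
  moreover have "inj (\<lambda>j. box_face (r E) E j (lcoord (r E) x $ j))"
    by (rule injI) (use box_face_inj[OF c cc cc] in blast)
  ultimately show ?thesis by (simp add: card_image)
qed

lemma finite_mesh_faces: "finite (mesh_faces T)"
proof -
  have "mesh_faces T = (\<Union>E\<in>T. (\<lambda>(j, s). box_face (r E) E j s) ` (UNIV \<times> {0, 1}))"
    using facet_of_cuboid_iff[OF cuboid] by (auto simp: mesh_faces_def)
  then show ?thesis using finite_T by simp
qed

text \<open>Double counting of incident pairs of elements and facets at \<open>x\<close>: eight
  elements with three facets each, every facet in two elements.\<close>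

lemma card_mesh_faces_at_interior_vertex:
  assumes x: "x \<in> \<Omega>" and E0: "E0 \<in> T" "x extreme_point_of E0"
    and n: "\<And>f. f \<in> mesh_faces T \<Longrightarrow> unit_normal f (n f)"
  shows "card {f \<in> mesh_faces T. x \<in> f} = 12"
proof -
  let ?N = "{E \<in> T. x \<in> E}" and ?F = "{f \<in> mesh_faces T. x \<in> f}"
  have fin: "finite ?N" "finite ?F" using finite_T finite_mesh_faces by simp_all
  have "(\<Sum>E\<in>?N. \<Sum>f\<in>{f \<in> ?F. f facet_of E}. 1) = (\<Sum>f\<in>?F. \<Sum>E\<in>{E \<in> ?N. f facet_of E}. 1::nat)"
    by (rule sum.swap_restrict[OF fin])
  moreover have "card {f \<in> ?F. f facet_of E} = 3" if "E \<in> ?N" for E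
  proof -
    have "{f \<in> ?F. f facet_of E} = {f. f facet_of E \<and> x \<in> f}" using that by (auto simp: mesh_faces_def)
    then show ?thesis using card_facets_at_vertex vertex_of_all_elements[OF E0] that by simp
  qed
  moreover have "card {E \<in> ?N. f facet_of E} = 2" if f: "f \<in> ?F" for f
  proof -
    have eq: "{E \<in> ?N. f facet_of E} = {E \<in> T. f facet_of E}"
      using f facet_of_imp_subset by blast
    have "f \<in> mesh_faces T" "unit_normal f (n f)" using f n by auto
    then show ?thesis
    proof (cases rule: facet_elements_cases)
      case (one A)
      then show ?thesis using interior_facet_shared[of A f x] f x by blast
    next
      case (two A B)
      then show ?thesis unfolding eq by simp
    qed
  qed
  ultimately have "card ?N * 3 = card ?F * 2" by simp
  then show ?thesis using card_elements_at_interior_vertex[OF x E0] by simp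
qed

lemma card_dofs_at_interior_vertex:
  fixes dof :: "'d::finite \<Rightarrow> (real^3) set \<times> (real^3) \<times> 3"
  assumes x: "x \<in> \<Omega>" "x \<in> mesh_vertices T r"
    and n: "\<And>f. f \<in> mesh_faces T \<Longrightarrow> unit_normal f (n f)"
    and \<Gamma>: "\<Gamma> \<subseteq> frontier \<Omega>" and dof: "bij_betw dof UNIV (dof_set \<Gamma> T)"
  shows "card {i. dof_vertex (dof i) = x} = 36"
proof -
  obtain E0 k where E0: "E0 \<in> T" "k \<in> {1..8}" "x = r E0 k" using x(2) by (auto simp: mesh_vertices_def)
  then have ext: "x extreme_point_of E0" using cuboid_vertex_extreme_point[OF cuboid] by simp
  \<comment> \<open>The domain is open, so no facet through an interior vertex lies in
    \<open>\<Gamma>\<close>; all twelve facets count, with three components each.\<close>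
  have x\<Gamma>: "x \<notin> \<Gamma>" using x(1) \<Gamma> open_domain by (auto simp: frontier_def interior_open)
  let ?F = "{f \<in> mesh_faces T. x \<in> f}"
  have "dof ` {i. dof_vertex (dof i) = x} = {d \<in> dof_set \<Gamma> T. dof_vertex d = x}"
    unfolding bij_betw_imp_surj_on[OF dof, symmetric] by auto
  also have "\<dots> = ?F \<times> {x} \<times> UNIV"
  proof -
    have ext_f: "x extreme_point_of f" if f: "f \<in> mesh_faces T" "x \<in> f" for f
    proof -
      obtain E where E: "E \<in> T" "f facet_of E" using f(1) by (auto simp: mesh_faces_def)
      then have "x extreme_point_of E"
        using vertex_of_all_elements[OF E0(1) ext] f(2) facet_of_imp_subset by blast
      then show ?thesis using extreme_point_of_face[of f E x] E(2) f(2) by (simp add: facet_of_def)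
    qed
    have mem_f: "x \<in> f" if "x extreme_point_of f" for f using that by (simp add: extreme_point_of_def)
    have "(d \<in> dof_set \<Gamma> T \<and> dof_vertex d = x) = (d \<in> ?F \<times> {x} \<times> UNIV)" for d
    proof (cases d)
      case (fields f y c)
      show ?thesis unfolding fields using ext_f[of f] mem_f[of f] x\<Gamma> by (auto simp: dof_set_def dof_vertex_def)
    qed
    then show ?thesis by blast
  qed
  finally have "card {i. dof_vertex (dof i) = x} = card (?F \<times> {x} \<times> (UNIV :: 3 set))"
    using card_image[OF inj_on_subset[OF bij_betw_imp_inj_on[OF dof] subset_UNIV], of "{i. dof_vertex (dof i) = x}"]
    by simp
  also have "\<dots> = 36"
    using card_mesh_faces_at_interior_vertex[OF x(1) E0(1) ext n] by (simp add: card_cartesian_product)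
  finally show ?thesis .
qed

end

section \<open>The discrete kernel\<close>

lemma skew_inner:
  fixes Z :: "real^3^3"
  assumes "transpose Z = - Z" shows "(Z *v x) \<bullet> y = - (x \<bullet> (Z *v y))"
proof -
  have "(Z *v x) \<bullet> y = x \<bullet> (transpose Z *v y)"
    by (metis dot_lmul_matrix inner_commute transpose_matrix_vector)
  also have "transpose Z *v y = - (Z *v y)" 
    by (simp add: assms matrix_vector_mult_def vec_eq_iff sum_negf)
  finally show ?thesis by simp
qed

text \<open>The image of the third edge is orthogonal to that edge by skewness, and to the two edges
  in the kernel by moving \<open>Z\<close> across the inner product.\<close>

lemma skew_eq_0:
  fixes Z :: "real^3^3"
  assumes \<rho>: "cuboid \<rho> E" and Z: "transpose Z = - Z" and "j \<noteq> k"
    and "Z *v edge \<rho> j = 0" "Z *v edge \<rho> k = 0"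
  shows "Z = 0"
proof -
  have Zd: "Z *v edge \<rho> d = 0" for d
  proof (rule cuboid_eq_0_iff[OF \<rho>])
    fix i
    have self: "(Z *v edge \<rho> d) \<bullet> edge \<rho> d = 0"
      using skew_inner[OF Z, of "edge \<rho> d" "edge \<rho> d"] by (simp add: inner_commute)
    have jk: "(Z *v edge \<rho> d) \<bullet> edge \<rho> j = 0" "(Z *v edge \<rho> d) \<bullet> edge \<rho> k = 0"
      using skew_inner[OF Z, of "edge \<rho> d"] assms(4,5) by simp_all
    show "edge \<rho> i \<bullet> (Z *v edge \<rho> d) = 0"
    proof (cases "d = j \<or> d = k")
      case True
      then show ?thesis using assms(4,5) by auto
    next
      case False
      then have "i = d \<or> i = j \<or> i = k"
        using \<open>j \<noteq> k\<close> exhaust_3[of i] exhaust_3[of j] exhaust_3[of k] exhaust_3[of d] by fastforce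
      then show ?thesis using self jk by (auto simp: inner_commute)
    qed
  qed
  have "Z *v x = 0" for x
    by (subst cuboid_expansion[OF \<rho>, of x])
       (simp add: linear_sum[OF matrix_vector_mul_linear] linear_cmul[OF matrix_vector_mul_linear] Zd)
  then show ?thesis by (simp add: matrix_eq)
qed

text \<open>The vector on the right is the axial vector of \<open>Z\<close>.\<close>

lemma skew_eq_cross:
  fixes Z :: "real^3^3"
  assumes "transpose Z = - Z"
  shows "Z *v x = cross3 (vector [Z $ 3 $ 2, Z $ 1 $ 3, Z $ 2 $ 1]) x"
proof -
  have Zt: "Z $ i $ j = - Z $ j $ i" for i j
    using arg_cong[OF assms, of "\<lambda>M. M $ j $ i"] by (simp add: transpose_def)
  have "Z $ 1 $ 1 = 0" "Z $ 2 $ 2 = 0" "Z $ 3 $ 3 = 0"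
    using Zt[of 1 1] Zt[of 2 2] Zt[of 3 3] by auto
  then show ?thesis
    using Zt[of 1 2] Zt[of 2 3] Zt[of 3 1]
    by (simp add: cross3_simps matrix_vector_mult_def forall_3)
qed

text \<open>Twice the offset is a full edge, so the point reached lies on the opposite
  facet.\<close>

lemma opposite_face_point:
  assumes "cuboid \<rho> E" "s \<in> {0, 1}" "x \<in> box_face \<rho> E j s"
  shows "x - 2 *\<^sub>R face_offset \<rho> j s \<in> E"
proof -
  have "x - 2 *\<^sub>R face_offset \<rho> j s = x + (1 - 2 * s) *\<^sub>R edge \<rho> j"
    by (simp add: face_offset_def algebra_simps)
  moreover have "x + (1 - 2 * s) *\<^sub>R edge \<rho> j \<in> E"
    using assms(2,3) unfolding box_face_def mem_Collect_eq cuboid_iff[OF assms(1)] lcoord_add[OF assms(1)] by auto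
  ultimately show ?thesis by (simp only:)
qed

text \<open>A displacement of at most half an edge keeps the tangential coordinates between 0 and 1;
  the sign condition controls the normal one.\<close>

lemma near_face_center:
  assumes \<rho>: "cuboid \<rho> E" and s: "s \<in> {0, 1}" and z: "face_offset \<rho> j s \<bullet> z \<le> 0" "\<And>k. norm z \<le> norm (edge \<rho> k) / 2"
  shows "box_center \<rho> + face_offset \<rho> j s + z \<in> E"
  unfolding cuboid_iff[OF \<rho>]
proof
  fix k
  let ?m = "box_center \<rho> + face_offset \<rho> j s" and ?e = "edge \<rho> k"
  define t where "t = ?e \<bullet> z / (?e \<bullet> ?e)"
  have ee: "?e \<bullet> ?e > 0" using cuboid_edge_nonzero[OF \<rho>] by simp
  have "?m + z - \<rho> 1 = (?m - \<rho> 1) + z" by simp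
  then have l: "lcoord \<rho> (?m + z) $ k = lcoord \<rho> ?m $ k + t"
    unfolding lcoord_nth t_def by (simp only: inner_add_right add_divide_distrib)
  have m: "lcoord \<rho> ?m $ k = (if k = j then s else 1 / 2)"
    using lcoord_face_center[OF \<rho>, of 1 j s k] by simp
  have "\<bar>?e \<bullet> z\<bar> \<le> norm ?e * norm z" by (rule Cauchy_Schwarz_ineq2)
  also have "\<dots> \<le> norm ?e * (norm ?e / 2)" using z(2)[of k] by (intro mult_left_mono) auto
  finally have "\<bar>?e \<bullet> z\<bar> \<le> 1 / 2 * (?e \<bullet> ?e)" by (simp add: dot_square_norm power2_eq_square)
  moreover have "\<bar>t\<bar> = \<bar>?e \<bullet> z\<bar> / (?e \<bullet> ?e)" using ee by (simp add: t_def abs_divide)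
  ultimately have "\<bar>t\<bar> \<le> 1 / 2" by (simp only: pos_divide_le_eq[OF ee])
  then have t: "- (1 / 2) \<le> t" "t \<le> 1 / 2" by linarith+
  have s_t: "k = j \<Longrightarrow> s = 0 \<Longrightarrow> 0 \<le> t" "k = j \<Longrightarrow> s = 1 \<Longrightarrow> t \<le> 0"
    using z(1) ee unfolding t_def by (auto simp: face_offset_def intro: divide_nonneg_pos divide_nonpos_pos)
  show "0 \<le> lcoord \<rho> (?m + z) $ k \<and> lcoord \<rho> (?m + z) $ k \<le> 1"
    unfolding l m using t s s_t by (cases "k = j") auto
qed

lemma face_corners_exist:
  fixes j0 :: 3
  shows "\<exists>j k. j \<noteq> k \<and> j \<noteq> j0 \<and> k \<noteq> j0 \<and> (\<forall>d. d = j \<or> d = k \<or> d = j0)"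
proof -
  have "\<forall>d :: 3. d = 1 \<or> d = 2 \<or> d = 3" using exhaust_3 by blast
  moreover have "(1::3) \<noteq> 2" "(1::3) \<noteq> 3" "(2::3) \<noteq> 3" by simp_all
  moreover have "j0 = 1 \<or> j0 = 2 \<or> j0 = 3" by (rule exhaust_3)
  ultimately show ?thesis by metis
qed

section \<open>Interface equations and infinitesimal rigid motions\<close>

context cuboid_mesh
begin

lemma facet_offset_normal:
  assumes "E \<in> T" "f facet_of E" "unit_normal f n"
  shows "facet_offset (r E) E f = (n \<bullet> facet_offset (r E) E f) *\<^sub>R n"
proof -
  obtain j s where f: "s \<in> {0, 1}" "f = box_face (r E) E j s"
    using facet_of_cuboid_iff[OF cuboid[OF assms(1)]] assms(2) by blast
  show ?thesis
    using face_offset_normal(1)[OF cuboid[OF assms(1)] f(1)] assms(3)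
    by (simp only: f(2) facet_offset_box_face[OF cuboid[OF assms(1)] f(1)])
qed

lemma facet_weight_nonzero:
  assumes "E \<in> T" "f facet_of E" "unit_normal f n"
  shows "facet_weight (r E) E f n \<noteq> 0"
  using facet_weight_prism(2)[OF cuboid[OF assms(1)] assms(2,3)] cuboid_J_pos[OF cuboid[OF assms(1)]]
  by (auto simp: facet_weight_def)

text \<open>The half balls at the facet centre on the two sides lie in \<open>A\<close> and
  \<open>B\<close>, so the centre is interior to the union of the mesh. Hence an interface never
  lies on the boundary.\<close>

lemma shared_facet_interior:
  assumes AB: "A \<in> T" "B \<in> T" "A \<noteq> B" and f: "f facet_of A" "f facet_of B" and n: "unit_normal f n"
  shows "\<not> f \<subseteq> frontier \<Omega>"
proof
  assume sub: "f \<subseteq> frontier \<Omega>"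
  note cA = cuboid[OF AB(1)] and cB = cuboid[OF AB(2)]
  obtain j s where j: "s \<in> {0, 1}" "f = box_face (r A) A j s" using facet_of_cuboid_iff[OF cA] f(1) by blast
  obtain j' s' where j': "s' \<in> {0, 1}" "f = box_face (r B) B j' s'" using facet_of_cuboid_iff[OF cB] f(2) by blast
  let ?o = "face_offset (r A) j s" and ?o' = "face_offset (r B) j' s'"
  define m where "m = box_center (r A) + ?o"
  have eq: "box_face (r A) A j s = box_face (r B) B j' s'" using j j' by simp
  have m': "m = box_center (r B) + ?o'" unfolding m_def by (rule shared_face_center[OF cA j(1) cB j'(1) eq])
  have neg: "(n \<bullet> ?o) * (n \<bullet> ?o') < 0"
    by (rule shared_face_opposite[OF cA j(1) cB j'(1) eq n[unfolded j(2)] disjoint_interiors[OF AB]])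
  have o: "?o = (n \<bullet> ?o) *\<^sub>R n" "?o' = (n \<bullet> ?o') *\<^sub>R n"
    using face_offset_normal(1)[OF cA j(1)] face_offset_normal(1)[OF cB j'(1)] n j(2) j'(2) by simp_all
  \<comment> \<open>The offsets have opposite normal directions, so each displacement leads back
    into at least one of the elements.\<close>
  have sides: "?o \<bullet> z \<le> 0 \<or> ?o' \<bullet> z \<le> 0" for z
  proof -
    have "?o \<bullet> z = (n \<bullet> ?o) * (n \<bullet> z)" "?o' \<bullet> z = (n \<bullet> ?o') * (n \<bullet> z)"
      using o(1)[THEN arg_cong, of "\<lambda>v. v \<bullet> z"] o(2)[THEN arg_cong, of "\<lambda>v. v \<bullet> z"]
      by (simp_all only: inner_scaleR_left)
    then show ?thesis using neg by (auto simp: mult_less_0_iff mult_le_0_iff)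
  qed
  define L where "L = range (\<lambda>k. norm (edge (r A) k) / 2) \<union> range (\<lambda>k. norm (edge (r B) k) / 2)"
  define e where "e = Min L"
  have finL: "finite L" "L \<noteq> {}" by (simp_all add: L_def)
  have pos: "l > 0" if "l \<in> L" for l
    using that cuboid_edge_nonzero[OF cA] cuboid_edge_nonzero[OF cB] by (auto simp: L_def)
  have e0: "e > 0" using finL pos by (simp add: e_def)
  have le: "e \<le> norm (edge (r A) k) / 2" "e \<le> norm (edge (r B) k) / 2" for k
  proof -
    have "norm (edge (r A) k) / 2 \<in> L" "norm (edge (r B) k) / 2 \<in> L" by (simp_all add: L_def)
    then show "e \<le> norm (edge (r A) k) / 2" "e \<le> norm (edge (r B) k) / 2"
      unfolding e_def using finL(1) by (auto intro: Min_le simp del: le_divide_eq_numeral1)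
  qed
  have "ball m e \<subseteq> \<Union>T"
  proof
    fix y assume "y \<in> ball m e"
    then have ny: "norm (y - m) \<le> e" by (simp add: dist_norm norm_minus_commute)
    have zA: "norm (y - m) \<le> norm (edge (r A) k) / 2" for k using ny le(1)[of k] by linarith
    have zB: "norm (y - m) \<le> norm (edge (r B) k) / 2" for k using ny le(2)[of k] by linarith
    from sides[of "y - m"] show "y \<in> \<Union>T"
    proof
      assume "?o \<bullet> (y - m) \<le> 0"
      from near_face_center[OF cA j(1) this zA] have "y \<in> A" by (simp flip: m_def)
      then show ?thesis using AB by blast
    next
      assume "?o' \<bullet> (y - m) \<le> 0"
      from near_face_center[OF cB j'(1) this zB] have "y \<in> B" by (simp flip: m')
      then show ?thesis using AB by blast
    qed
  qed
  then have "m \<in> \<Omega>" unfolding domain_interior using e0 by (meson centre_in_ball interior_maximal open_ball subsetD)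
  moreover have "m \<in> f" using box_face_center_mem[OF cA j(1)] by (simp add: m_def j(2))
  ultimately show False using sub open_domain by (auto simp: frontier_def interior_open)
qed

text \<open>\<open>H\<close> says that \<open>(u, W)\<close> is annihilated by every stress basis field. It forces the rotation \<open>W\<close>
  to be constant and \<open>u\<close> to be an infinitesimal rigid motion that vanishes at the centres of all facets
  lying on one element only and not on \<open>\<Gamma>\<close>.\<close>

lemma discrete_kernel_trivial:
  fixes u :: "(real^3) set \<Rightarrow> real^3" and W :: "real^3 \<Rightarrow> real^3^3"
  assumes n: "\<And>f. f \<in> mesh_faces T \<Longrightarrow> unit_normal f (n f)"
    and \<Gamma>: "\<Gamma> \<subseteq> frontier \<Omega>"
    and A1: "\<And>E. E \<in> T \<Longrightarrow> card {f. f facet_of E \<and> f \<subseteq> \<Gamma>} \<le> 1"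
    and skew: "\<And>x. x \<in> mesh_vertices T r \<Longrightarrow> transpose (W x) = - W x"
    and H: "\<And>f x. f \<in> mesh_faces T \<Longrightarrow> \<not> f \<subseteq> \<Gamma> \<Longrightarrow> x extreme_point_of f \<Longrightarrow>
      (\<Sum>E\<in>{E \<in> T. f facet_of E}. facet_weight (r E) E f (n f) *\<^sub>R (u E + W x *v facet_offset (r E) E f)) = 0"
  shows "(\<forall>E\<in>T. u E = 0) \<and> (\<forall>x\<in>mesh_vertices T r. W x = 0)"
proof -
  have face: "f \<in> mesh_faces T" if "E \<in> T" "f facet_of E" for E f
    using that by (auto simp: mesh_faces_def)
  have eq_one: "u A + W x *v facet_offset (r A) A f = 0"
    if "A \<in> T" "f facet_of A" "\<not> f \<subseteq> \<Gamma>" "{E \<in> T. f facet_of E} = {A}" "x extreme_point_of f" for A f x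
    using H[OF face[OF that(1,2)] that(3,5)] facet_weight_nonzero[OF that(1,2) n[OF face[OF that(1,2)]]]
    by (simp add: that(4))
  \<comment> \<open>The two weights are opposite and nonzero, so the weighted sum is a multiple of a
    difference.\<close>
  have eq_two: "u A + W x *v facet_offset (r A) A f = u B + W x *v facet_offset (r B) B f"
    if "A \<in> T" "B \<in> T" "A \<noteq> B" "f facet_of A" "f facet_of B" "\<not> f \<subseteq> \<Gamma>" "{E \<in> T. f facet_of E} = {A, B}"
      "x extreme_point_of f" for A B f x
  proof -
    have un: "unit_normal f (n f)" by (rule n[OF face[OF that(1,4)]])
    have "facet_weight (r A) A f (n f) *\<^sub>R (u A + W x *v facet_offset (r A) A f) =
      facet_weight (r A) A f (n f) *\<^sub>R (u B + W x *v facet_offset (r B) B f)"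
      using H[OF face[OF that(1,4)] that(6,8)] that(3) shared_facet(3)[OF that(1-5) un] by (simp add: that(7))
    then show ?thesis using facet_weight_nonzero[OF that(1,4) un] by simp
  qed
  \<comment> \<open>The displacements do not depend on the vertex. Comparing two vertices leaves the
    rotations applied to a nonzero multiple of the normal.\<close>
  have same_normal: "W x *v n f = W x' *v n f"
    if f: "f \<in> mesh_faces T" "\<not> f \<subseteq> \<Gamma>" and x: "x extreme_point_of f" "x' extreme_point_of f" for f x x'
    using f(1) n[OF f(1)]
  proof (cases rule: facet_elements_cases)
    case (one A)
    let ?v = "facet_offset (r A) A f"
    define \<alpha> where "\<alpha> = n f \<bullet> ?v"
    have "u A + W x *v ?v = u A + W x' *v ?v"
      using eq_one[OF one(1,2) f(2) one(3) x(1)] eq_one[OF one(1,2) f(2) one(3) x(2)] by simp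
    then have "W x *v ?v = W x' *v ?v" by (rule add_left_imp_eq)
    moreover have "?v = \<alpha> *\<^sub>R n f"
      unfolding \<alpha>_def by (rule facet_offset_normal[OF one(1,2) n[OF f(1)]])
    ultimately have "\<alpha> *\<^sub>R (W x *v n f) = \<alpha> *\<^sub>R (W x' *v n f)"
      by (simp only: linear_cmul[OF matrix_vector_mul_linear])
    moreover have "\<alpha> \<noteq> 0"
      unfolding \<alpha>_def by (rule facet_weight_prism(2)[OF cuboid[OF one(1)] one(2) n[OF f(1)]])
    ultimately show ?thesis by simp
  next
    case (two A B)
    let ?v = "facet_offset (r A) A f - facet_offset (r B) B f"
    have "W y *v ?v = u B - u A" if "y extreme_point_of f" for y
      using eq_two[OF two(1-5) f(2) two(6) that]
      by (simp add: matrix_vector_mult_diff_distrib diff_eq_eq eq_diff_eq) (simp add: algebra_simps)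
    then have "W x *v ?v = W x' *v ?v" using x by simp
    moreover define c where "c = n f \<bullet> facet_offset (r A) A f - n f \<bullet> facet_offset (r B) B f"
    have "?v = c *\<^sub>R n f"
      unfolding c_def scaleR_left_diff_distrib
      by (rule arg_cong2[where f = "(-)"])
         (rule facet_offset_normal[OF two(1,4) n[OF f(1)]] facet_offset_normal[OF two(2,5) n[OF f(1)]])+
    ultimately have "c *\<^sub>R (W x *v n f) = c *\<^sub>R (W x' *v n f)"
      by (simp only: linear_cmul[OF matrix_vector_mul_linear])
    moreover have "c \<noteq> 0"
      using shared_facet(2)[OF two(1-5) n[OF f(1)]] by (auto simp: c_def mult_less_0_iff)
    ultimately show ?thesis by simp
  qed
  have vert: "elem_map (r E) y \<in> mesh_vertices T r" if "E \<in> T" "cube_corner y" for E y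
    using cube_corner_imp_ref_vertex[OF that(2)] cuboid_vertex[OF cuboid[OF that(1)]] that(1)
    unfolding mesh_vertices_def by force
  have const: "W (elem_map (r E) y) = W (elem_map (r E) y')"
    if E: "E \<in> T" and y: "cube_corner y" "cube_corner y'" for E y y'
  proof -
    note c = cuboid[OF E]
    let ?V = "\<lambda>y. W (elem_map (r E) y)"
    have fin: "finite {f. f facet_of E \<and> f \<subseteq> \<Gamma>}"
      by (rule finite_subset[OF _ finite_mesh_faces]) (use E in \<open>auto simp: mesh_faces_def\<close>)
    have uniq: "f = g" if "f facet_of E" "f \<subseteq> \<Gamma>" "g facet_of E" "g \<subseteq> \<Gamma>" for f g
    proof -
      have "card {f. f facet_of E \<and> f \<subseteq> \<Gamma>} \<le> Suc 0" using A1[OF E] by simp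
      then show ?thesis using card_le_Suc0_iff_eq[OF fin] that by blast
    qed
    \<comment> \<open>The pair encodes the only facet that may be excluded. If none is, the
      condition is vacuous and the pair arbitrary.\<close>
    obtain j0 s0 where bad: "\<And>j s. s \<in> {0, 1} \<Longrightarrow> box_face (r E) E j s \<subseteq> \<Gamma> \<Longrightarrow> j = j0 \<and> s = s0"
    proof (cases "\<exists>j0 s0. s0 \<in> {0, 1} \<and> box_face (r E) E j0 s0 \<subseteq> \<Gamma>")
      case True
      then obtain j0 s0 where 0: "s0 \<in> {0, 1}" "box_face (r E) E j0 s0 \<subseteq> \<Gamma>" by blast
      have "j = j0 \<and> s = s0" if "s \<in> {0, 1}" "box_face (r E) E j s \<subseteq> \<Gamma>" for j s
        using uniq[OF box_face_facet_of[OF c that(1)] that(2) box_face_facet_of[OF c 0(1)] 0(2)]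
          box_face_inj[OF c that(1) 0(1)] by blast
      then show ?thesis by (rule that)
    next
      case False
      then show ?thesis using that by blast
    qed
    have same: "?V y *v edge (r E) j = ?V y' *v edge (r E) j"
      if "cube_corner y" "cube_corner y'" "y $ j = y' $ j" "\<not> (j = j0 \<and> y $ j = s0)" for y y' j
    proof -
      have s: "y $ j \<in> {0, 1}" using that(1) unfolding cube_corner_def by blast
      let ?f = "box_face (r E) E j (y $ j)"
      have f: "?f facet_of E" by (rule box_face_facet_of[OF c s])
      have "elem_map (r E) y extreme_point_of ?f" "elem_map (r E) y' extreme_point_of ?f"
        unfolding extreme_point_of_box_face[OF c s] lcoord_elem_map[OF c] using that by simp_all
      then have "?V y *v n ?f = ?V y' *v n ?f"
        using same_normal[OF face[OF E f]] bad[OF s] that(4) by blast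
      moreover have "edge (r E) j = (n ?f \<bullet> edge (r E) j) *\<^sub>R n ?f"
        by (rule unit_normal_box_face(1)[OF c s n[OF face[OF E f]]])
      moreover define \<gamma> where "\<gamma> = n ?f \<bullet> edge (r E) j"
      ultimately have "?V y *v n ?f = ?V y' *v n ?f" "edge (r E) j = \<gamma> *\<^sub>R n ?f" by simp_all
      then show ?thesis by (simp only: linear_cmul[OF matrix_vector_mul_linear])
    qed
    \<comment> \<open>Two corners on two common admissible facets: the difference of their rotations
      is skew and kills two edges.\<close>
    have pair: "?V y = ?V y'"
      if "cube_corner y" "cube_corner y'" "j \<noteq> k" "y $ j = y' $ j" "y $ k = y' $ k"
        "\<not> (j = j0 \<and> y $ j = s0)" "\<not> (k = j0 \<and> y $ k = s0)" for y y' j k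
    proof -
      have "transpose (?V y - ?V y') = transpose (?V y) - transpose (?V y')"
        by (simp add: transpose_def vec_eq_iff)
      also have "\<dots> = - (?V y - ?V y')" using skew vert[OF E] that(1,2) by simp
      finally have "?V y - ?V y' = 0"
        by (rule skew_eq_0[OF c _ that(3)])
           (simp_all add: matrix_vector_mult_diff_rdistrib same[OF that(1,2,4,6)] same[OF that(1,2,5,7)])
      then show ?thesis by simp
    qed
    obtain j k where jk: "j \<noteq> k" "j \<noteq> j0" "k \<noteq> j0" "\<And>d. d = j \<or> d = k \<or> d = j0"
      using face_corners_exist[of j0] by blast
    \<comment> \<open>The side opposite to the excluded facet; even for an arbitrary
      \<open>s0\<close> it is an actual side different from \<open>s0\<close>.\<close>
    define s1 :: real where "s1 = (if s0 = 0 then 1 else 0)"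
    have s1: "s1 \<noteq> s0" "s1 \<in> {0, 1}" by (auto simp: s1_def)
    define up where "up y = (\<chi> d. if d = j0 then s1 else y $ d)" for y :: "real^3"
    have up: "cube_corner (up y)" "up y $ j0 = s1" if "cube_corner y" for y
      using that s1 by (auto simp: cube_corner_def up_def)
    \<comment> \<open>An edge in direction \<open>j0\<close> lies on facets normal to
      \<open>j\<close> and to \<open>k\<close>, neither of which is excluded.\<close>
    have V_up: "?V y = ?V (up y)" if "cube_corner y" for y
      by (rule pair[OF that up(1)[OF that] jk(1)]) (use jk in \<open>auto simp: up_def\<close>)
    \<comment> \<open>On this side the facet normal to \<open>j0\<close> is admissible and serves as
      one of the two facets of each edge. Two steps, each changing one coordinate, connect any two
      of its corners.\<close>
    have level: "?V z = ?V z'" if z: "cube_corner z" "cube_corner z'" "z $ j0 = s1" "z' $ j0 = s1" for z z'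
    proof -
      define w where "w = (\<chi> d. if d = j then z' $ d else z $ d)"
      have w: "cube_corner w" using z by (simp add: cube_corner_def w_def)
      have "?V z = ?V w"
        by (rule pair[OF z(1) w, of j0 k]) (use jk s1 z in \<open>auto simp: w_def\<close>)
      also have "\<dots> = ?V z'"
        by (rule pair[OF w z(2), of j0 j]) (use jk s1 z in \<open>auto simp: w_def\<close>)
      finally show ?thesis .
    qed
    show ?thesis
      using V_up[OF y(1)] V_up[OF y(2)] level[OF up(1)[OF y(1)] up(1)[OF y(2)] up(2)[OF y(1)] up(2)[OF y(2)]] by simp
  qed
  have W_elem: "W x = W (r E 1)" if "E \<in> T" "x extreme_point_of E" for E x
  proof -
    note c = cuboid[OF that(1)]
    have "W (elem_map (r E) (lcoord (r E) x)) = W (elem_map (r E) (ref_vertex 1))"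
      by (rule const[OF that(1)]) (use that(2) cuboid_extreme_point_iff[OF c] cube_corner_ref_vertex[of 1] in simp_all)
    then show ?thesis using cuboid_vertex[OF c, of 1] by (simp add: elem_map_lcoord[OF c])
  qed
  have ext_facet: "x extreme_point_of E" if "x extreme_point_of f" "f facet_of E" for x f E
    using extreme_point_of_face[of f E x] that by (simp add: facet_of_def)
  \<comment> \<open>Rotation and translation part of the rigid motion that takes the value
    \<open>u E\<close> at the centre of \<open>E\<close>.\<close>
  define p where "p E = (W (r E 1), u E - W (r E 1) *v box_center (r E))" for E
  have p_eq: "p A = p B" if AB: "A \<in> T" "B \<in> T" and f: "f facet_of A" "f facet_of B" for A B f
  proof (cases "A = B")
    case False
    have un: "unit_normal f (n f)" by (rule n[OF face[OF AB(1) f(1)]])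
    have nG: "\<not> f \<subseteq> \<Gamma>" using shared_facet_interior[OF AB False f un] \<Gamma> by blast
    have eq2: "{E \<in> T. f facet_of E} = {A, B}"
      using at_most_two_elements[OF AB _ f _ un] False AB f by blast
    obtain j s where js: "s \<in> {0, 1}" "f = box_face (r A) A j s"
      using facet_of_cuboid_iff[OF cuboid[OF AB(1)]] f(1) by blast
    have "elem_map (r A) (\<chi> d. if d = j then s else 0) extreme_point_of f"
      using js(1) unfolding js(2) extreme_point_of_box_face[OF cuboid[OF AB(1)] js(1)]
      by (simp add: lcoord_elem_map[OF cuboid[OF AB(1)]] cube_corner_def)
    then obtain x where x: "x extreme_point_of f" by blast
    have WA: "W x = W (r A 1)" by (rule W_elem[OF AB(1) ext_facet[OF x f(1)]])
    have WB: "W x = W (r B 1)" by (rule W_elem[OF AB(2) ext_facet[OF x f(2)]])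
    have "u A + W x *v facet_offset (r A) A f = u B + W x *v facet_offset (r B) B f"
      by (rule eq_two[OF AB False f nG eq2 x])
    \<comment> \<open>Both offsets end at the common facet centre; this turns the interface equation
      into equality of the translation parts.\<close>
    moreover have "facet_offset (r B) B f = box_center (r A) + facet_offset (r A) A f - box_center (r B)"
      using shared_facet(1)[OF AB False f un] by simp
    ultimately have "u A - W x *v box_center (r A) = u B - W x *v box_center (r B)"
      by (simp add: matrix_vector_mult_diff_distrib matrix_vector_right_distrib algebra_simps)
    then show ?thesis using WA WB by (simp add: p_def)
  qed simp
  have T_ne: "T \<noteq> {}" using domain_nonempty domain_subset by blast
  then obtain E1 where E1: "E1 \<in> T" by blast
  define W0 where "W0 = W (r E1 1)"
  define P where "P = u E1 - W0 *v box_center (r E1)"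
  have glob: "W (r E 1) = W0" "u E = P + W0 *v box_center (r E)" if "E \<in> T" for E
  proof -
    have "p E = p E1" by (rule facet_connected[OF p_eq that E1]) 
    then show "W (r E 1) = W0" "u E = P + W0 *v box_center (r E)"
      by (auto simp: p_def W0_def P_def algebra_simps)
  qed
  have W_vert: "W x = W0" if "x extreme_point_of E" "E \<in> T" for x E
    using W_elem[OF that(2,1)] glob(1)[OF that(2)] by simp
  have W0_skew: "transpose W0 = - W0"
    unfolding W0_def mesh_vertices_def by (intro skew[unfolded mesh_vertices_def] UN_I[OF E1] imageI) simp
  define \<omega> :: "real^3" where "\<omega> = vector [W0 $ 3 $ 2, W0 $ 1 $ 3, W0 $ 2 $ 1]"
  have W0_cross: "W0 *v x = cross3 \<omega> x" for x unfolding \<omega>_def by (rule skew_eq_cross[OF W0_skew])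
  \<comment> \<open>The domain need not be convex. At an extreme point of the hull every facet of
    \<open>E\<close> through it will turn out to lie on one element only.\<close>
  define K where "K = convex hull (\<Union>T)"
  have compK: "compact K"
    unfolding K_def using finite_T cuboid_compact[OF cuboid] by (intro compact_convex_hull compact_Union) auto
  have KT: "E \<subseteq> K" if "E \<in> T" for E using that hull_subset[of "\<Union>T" convex] by (auto simp: K_def)
  have Kne: "K \<noteq> {}" using KT[OF E1] cuboid_interior_nonempty[OF cuboid[OF E1]] interior_subset by blast
  obtain x0 where x0: "x0 \<in> K" "\<And>y. y \<in> K \<Longrightarrow> \<omega> \<bullet> y \<le> \<omega> \<bullet> x0"
    using continuous_attains_sup[OF compK Kne, of "\<lambda>x. \<omega> \<bullet> x"]
      continuous_on_inner[OF continuous_on_const continuous_on_id, of K \<omega>] by auto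
  \<comment> \<open>An extreme point of the maximizing face is extreme in the hull, hence a point of
    some element and a vertex of it.\<close>
  have faceK: "(K \<inter> {x. \<omega> \<bullet> x = \<omega> \<bullet> x0}) face_of K"
    using x0(2) by (intro face_of_Int_supporting_hyperplane_le) (auto simp: K_def convex_convex_hull)
  then obtain x where "x extreme_point_of (K \<inter> {x. \<omega> \<bullet> x = \<omega> \<bullet> x0})"
    using extreme_point_exists_convex[OF face_of_imp_compact[OF _ compK faceK] face_of_imp_convex[OF faceK]] x0(1)
    by (auto simp: K_def convex_convex_hull)
  then have xK: "x extreme_point_of K" and x_max: "\<And>y. y \<in> K \<Longrightarrow> \<omega> \<bullet> y \<le> \<omega> \<bullet> x"
    using extreme_point_of_face[OF faceK, of x] x0(2) by auto
  have "x \<in> \<Union>T" using xK unfolding K_def by (rule extreme_point_of_convex_hull)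
  then obtain E where E: "E \<in> T" "x \<in> E" by blast
  have xE: "x extreme_point_of E" using xK E KT unfolding extreme_point_of_def by blast
  note c = cuboid[OF E(1)]
  have cc: "lcoord (r E) x $ j \<in> {0, 1}" for j
    using xE unfolding cuboid_extreme_point_iff[OF c] cube_corner_def by blast
  define F where "F j = box_face (r E) E j (lcoord (r E) x $ j)" for j
  define b where "b j = face_offset (r E) j (lcoord (r E) x $ j)" for j
  have F: "F j facet_of E" "x \<in> F j" "x extreme_point_of F j" for j
  proof -
    show "F j facet_of E" unfolding F_def by (rule box_face_facet_of[OF c cc])
    show "x \<in> F j" using E(2) by (simp add: F_def box_face_def)
    show "x extreme_point_of F j"
      unfolding F_def extreme_point_of_box_face[OF c cc] using xE cuboid_extreme_point_iff[OF c] by simp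
  qed
  have off: "facet_offset (r E) E (F j) = b j" for j by (simp add: F_def b_def facet_offset_box_face[OF c cc])
  \<comment> \<open>A neighbour across the facet would provide points of the hull on both sides of
    \<open>x\<close> along the normal, against extremality.\<close>
  have single: "{B \<in> T. F j facet_of B} = {E}" for j
  proof (rule ccontr)
    assume "{B \<in> T. F j facet_of B} \<noteq> {E}"
    then obtain B where B: "B \<in> T" "F j facet_of B" "E \<noteq> B" using E(1) F(1) by blast
    have un: "unit_normal (F j) (n (F j))" by (rule n[OF face[OF E(1) F(1)]])
    note cB = cuboid[OF B(1)]
    obtain j' s' where js: "s' \<in> {0, 1}" "F j = box_face (r B) B j' s'"
      using facet_of_cuboid_iff[OF cB] B(2) by blast
    let ?m = "n (F j)" and ?oB = "face_offset (r B) j' s'"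
    have oB: "facet_offset (r B) B (F j) = ?oB" unfolding js(2) by (rule facet_offset_box_face[OF cB js(1)])
    have neg: "(?m \<bullet> b j) * (?m \<bullet> ?oB) < 0"
      using shared_facet(2)[OF E(1) B(1) B(3) F(1) B(2) un] by (simp add: off oB)
    have nb: "b j = (?m \<bullet> b j) *\<^sub>R ?m" using facet_offset_normal[OF E(1) F(1) un] by (simp only: off)
    have nB: "?oB = (?m \<bullet> ?oB) *\<^sub>R ?m" using facet_offset_normal[OF B(1,2) un] by (simp only: oB)
    define y where "y = x - 2 *\<^sub>R b j"
    define z where "z = x - 2 *\<^sub>R ?oB"
    have "y \<in> E" unfolding y_def b_def
      by (rule opposite_face_point[OF c cc]) (use F(2) in \<open>simp add: F_def\<close>)
    moreover have "z \<in> B" unfolding z_def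
      by (rule opposite_face_point[OF cB js(1)]) (rule F(2)[of j, unfolded js(2)])
    ultimately have yz: "y \<in> K" "z \<in> K" using KT E(1) B(1) by auto
    define \<alpha> where "\<alpha> = ?m \<bullet> b j"
    define \<beta> where "\<beta> = ?m \<bullet> ?oB"
    have ab: "\<alpha> * \<beta> < 0" using neg by (simp add: \<alpha>_def \<beta>_def)
    have y: "y = x - (2 * \<alpha>) *\<^sub>R ?m"
      using nb[folded \<alpha>_def] by (simp add: y_def)
    have z: "z = x - (2 * \<beta>) *\<^sub>R ?m"
      using nB[folded \<beta>_def] by (simp add: z_def)
    have d: "\<alpha> - \<beta> \<noteq> 0" using ab by (auto simp: mult_less_0_iff)
    \<comment> \<open>The weight for which the normal components of \<open>y - x\<close> and
      \<open>z - x\<close> cancel; it is proper because they have opposite signs.\<close>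
    define t where "t = \<alpha> / (\<alpha> - \<beta>)"
    have t: "0 < t" "t < 1" using ab unfolding t_def by (auto simp: mult_less_0_iff zero_less_divide_iff divide_less_eq)
    have "(1 - t) * (2 * \<alpha>) + t * (2 * \<beta>) = 0" using d by (simp add: t_def field_simps)
    moreover have "(1 - t) *\<^sub>R y + t *\<^sub>R z = x - ((1 - t) * (2 * \<alpha>) + t * (2 * \<beta>)) *\<^sub>R ?m"
      unfolding y z by (simp add: algebra_simps)
    ultimately have "x = (1 - t) *\<^sub>R y + t *\<^sub>R z" by simp
    moreover have "y \<noteq> z"
    proof
      assume "y = z"
      then have "(2 * \<alpha>) *\<^sub>R ?m = (2 * \<beta>) *\<^sub>R ?m" by (simp add: y z)
      moreover have "?m \<noteq> 0" using un by (auto simp: unit_normal_def)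
      ultimately show False using d by simp
    qed
    ultimately have "x \<in> open_segment y z" using t unfolding in_segment by blast
    then show False using xK yz unfolding extreme_point_of_def by blast
  qed
  obtain j k where jk: "j \<noteq> k" "\<not> F j \<subseteq> \<Gamma>" "\<not> F k \<subseteq> \<Gamma>"
  proof -
    have fin: "finite {f. f facet_of E \<and> f \<subseteq> \<Gamma>}"
      by (rule finite_subset[OF _ finite_mesh_faces]) (use E(1) in \<open>auto simp: mesh_faces_def\<close>)
    have "card {f. f facet_of E \<and> f \<subseteq> \<Gamma>} \<le> Suc 0" using A1[OF E(1)] by simp
    then have "F i = F l" if "F i \<subseteq> \<Gamma>" "F l \<subseteq> \<Gamma>" for i l
      using card_le_Suc0_iff_eq[OF fin] that F(1) by blast
    then have uniq: "i = l" if "F i \<subseteq> \<Gamma>" "F l \<subseteq> \<Gamma>" for i l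
    proof -
      have "F i = F l" by (rule \<open>\<And>i l. F i \<subseteq> \<Gamma> \<Longrightarrow> F l \<subseteq> \<Gamma> \<Longrightarrow> F i = F l\<close>[OF that])
      then show ?thesis unfolding F_def by (rule conjunct1[OF box_face_inj[OF c cc cc]])
    qed
    have ne: "(1::3) \<noteq> 2" "(1::3) \<noteq> 3" "(2::3) \<noteq> 3" by simp_all
    show thesis
    proof (cases "F 1 \<subseteq> \<Gamma>")
      case True
      then have "\<not> F 2 \<subseteq> \<Gamma>" "\<not> F 3 \<subseteq> \<Gamma>" using uniq[of 1 2] uniq[of 1 3] ne by auto
      then show thesis by (rule that[OF ne(3)])
    next
      case F1: False
      show thesis
      proof (cases "F 2 \<subseteq> \<Gamma>")
        case True
        then have "\<not> F 3 \<subseteq> \<Gamma>" using uniq[of 2 3] ne by auto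
        then show thesis by (rule that[OF ne(2) F1])
      next
        case False
        then show thesis by (rule that[OF ne(1) F1])
      qed
    qed
  qed
  \<comment> \<open>On a facet of \<open>E\<close> alone the equation at \<open>x\<close> says that
    the rigid motion vanishes at the facet centre.\<close>
  have Dirichlet: "P + W0 *v (box_center (r E) + b i) = 0" if "\<not> F i \<subseteq> \<Gamma>" for i
    using eq_one[OF E(1) F(1) that single F(3)] glob(2)[OF E(1)] W_vert[OF xE E(1)]
    by (simp add: off matrix_vector_right_distrib add.assoc)
  have b0: "b i \<noteq> 0" for i unfolding b_def by (rule face_offset_nonzero[OF c cc])
  have bb: "b j \<bullet> b k = 0" using cuboid_edge_orthogonal[OF c jk(1)] by (simp add: b_def face_offset_def)
  \<comment> \<open>Crossing \<open>E\<close> to the opposite facet displaces \<open>x\<close> by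
    minus twice \<open>b i\<close>, which cannot increase the maximized functional.\<close>
  have \<omega>b: "\<omega> \<bullet> b i \<ge> 0" for i
  proof -
    have "x - 2 *\<^sub>R b i \<in> E" unfolding b_def
      by (rule opposite_face_point[OF c cc]) (use F(2) in \<open>simp add: F_def\<close>)
    then have "\<omega> \<bullet> (x - 2 *\<^sub>R b i) \<le> \<omega> \<bullet> x" using x_max KT[OF E(1)] by blast
    then show ?thesis by (simp add: inner_diff_right)
  qed
  define d where "d = b j - b k"
  have "W0 *v d = (P + W0 *v (box_center (r E) + b j)) - (P + W0 *v (box_center (r E) + b k))"
    by (simp add: d_def matrix_vector_right_distrib matrix_vector_mult_diff_distrib)
  then have "W0 *v d = 0" unfolding Dirichlet[OF jk(2)] Dirichlet[OF jk(3)] by simp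
  then have "cross3 \<omega> d = 0" by (simp only: W0_cross)
  then have "cross3 d (cross3 \<omega> d) = 0" by simp
  \<comment> \<open>The motion takes equal values at both centres, so \<open>d\<close> is parallel
    to the axis; the double cross product states this without division.\<close>
  then have col: "(d \<bullet> d) *\<^sub>R \<omega> = (d \<bullet> \<omega>) *\<^sub>R d" by (simp add: Lagrange)
  have bb': "b k \<bullet> b j = 0" using bb by (simp add: inner_commute)
  have dj: "d \<bullet> b j = b j \<bullet> b j" "d \<bullet> b k = - (b k \<bullet> b k)"
    by (simp_all add: d_def inner_diff_left bb bb')
  \<comment> \<open>As the two offsets are orthogonal, an axis along their difference has products
    of opposite sign with them, whereas both products are nonnegative.\<close>
  have eqs: "(d \<bullet> d) * (\<omega> \<bullet> b j) = (d \<bullet> \<omega>) * (b j \<bullet> b j)"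
    "(d \<bullet> d) * (\<omega> \<bullet> b k) = - ((d \<bullet> \<omega>) * (b k \<bullet> b k))"
    using arg_cong[OF col, of "\<lambda>v. v \<bullet> b j"] arg_cong[OF col, of "\<lambda>v. v \<bullet> b k"]
    unfolding inner_scaleR_left dj by simp_all
  have nonneg: "0 \<le> (d \<bullet> d) * (\<omega> \<bullet> b i)" for i using \<omega>b by simp
  have pos: "b j \<bullet> b j > 0" "b k \<bullet> b k > 0" using b0 by simp_all
  have "0 \<le> d \<bullet> \<omega>" using nonneg[of j] pos(1) unfolding eqs by (simp only: zero_le_mult_iff) linarith
  moreover have "d \<bullet> \<omega> \<le> 0"
  proof (rule ccontr)
    assume "\<not> ?thesis"
    then have "(d \<bullet> \<omega>) * (b k \<bullet> b k) > 0" using pos(2) by simp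
    then show False using nonneg[of k] unfolding eqs by linarith
  qed
  ultimately have "d \<bullet> \<omega> = 0" by simp
  moreover have "d \<noteq> 0" using dj(1) pos(1) by auto
  ultimately have "\<omega> = 0" using col by simp
  then have "W0 *v x = 0" for x by (simp add: W0_cross)
  then have W00: "W0 = 0" by (simp add: matrix_eq)
  then have P0: "P = 0" using Dirichlet[OF jk(2)] by simp
  have "u E = 0" if "E \<in> T" for E using glob(2)[OF that] W00 P0 by simp
  moreover have "W x = 0" if x: "x \<in> mesh_vertices T r" for x
  proof -
    obtain E i where Ei: "E \<in> T" "i \<in> {1..8}" "x = r E i" using x unfolding mesh_vertices_def by blast
    have "W x = W0" unfolding Ei(3) by (rule W_vert[OF cuboid_vertex_extreme_point[OF cuboid[OF Ei(1)] Ei(2)] Ei(1)])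
    then show ?thesis using W00 by simp
  qed
  ultimately show ?thesis by blast
qed

end

section \<open>Vertex form of the mixed method\<close>

text \<open>The normalized edges form an orthonormal basis. The Frobenius product thus decouples
  into the facet directions in which the degrees of freedom live.\<close>

lemma matrix_inner_edges:
  fixes M N :: "real^3^3"
  assumes "cuboid \<rho> E"
  shows "M \<bullet> N = (\<Sum>j\<in>UNIV. (M *v edge \<rho> j) \<bullet> (N *v edge \<rho> j) / (edge \<rho> j \<bullet> edge \<rho> j))"
proof -
  have nth: "(X *v e) $ d = e \<bullet> X $ d" for X :: "real^3^3" and e d
    by (simp add: matrix_vector_mult_def inner_vec_def mult.commute)
  have "M $ d \<bullet> N $ d = (\<Sum>j\<in>UNIV. (edge \<rho> j \<bullet> M $ d) * (edge \<rho> j \<bullet> N $ d) / (edge \<rho> j \<bullet> edge \<rho> j))" for d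
    by (subst cuboid_expansion[OF assms, of "M $ d"]) (simp add: inner_sum_left)
  then have "M \<bullet> N = (\<Sum>d\<in>UNIV. \<Sum>j\<in>UNIV. (M *v edge \<rho> j) $ d * (N *v edge \<rho> j) $ d / (edge \<rho> j \<bullet> edge \<rho> j))"
    by (simp add: inner_vec_def[of M] nth)
  also have "\<dots> = (\<Sum>j\<in>UNIV. \<Sum>d\<in>UNIV. (M *v edge \<rho> j) $ d * (N *v edge \<rho> j) $ d / (edge \<rho> j \<bullet> edge \<rho> j))"
    by (rule sum.swap)
  finally show ?thesis by (simp add: inner_vec_def[of "M *v _"] sum_divide_distrib)
qed

section \<open>Stress, displacement and rotation fields on one element\<close>

context cuboid_mesh
begin

lemma domain_lmeasurable: "\<Omega> \<in> lmeasurable"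
  using open_domain bounded_domain by (simp add: lmeasurable_open)

lemma closed_element_subset: "E \<in> T \<Longrightarrow> E \<subseteq> closure \<Omega>"
  using closure_domain by blast

text \<open>The Piola identity, transposed and pulled back. Reference fields are continuous
  everywhere, so it persists for the values from within on the closed element, in particular at the
  vertices.\<close>

lemma Xh_element:
  assumes \<tau>: "\<tau> \<in> Xh \<Omega> \<Gamma> T r" and E: "E \<in> T"
  obtains \<tau>' where "\<And>d. (\<lambda>y. row d (\<tau>' y)) \<in> ERT0_hat"
    and "\<And>x. x \<in> interior E \<Longrightarrow>
      \<tau> x = (1 / elem_J (r E)) *\<^sub>R (\<tau>' (lcoord (r E) x) ** transpose (elem_DF (r E)))"
    and "\<And>x. x \<in> E \<Longrightarrow>
      from_within E \<tau> x = (1 / elem_J (r E)) *\<^sub>R (\<tau>' (lcoord (r E) x) ** transpose (elem_DF (r E)))"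
proof -
  note c = cuboid[OF E]
  have "\<forall>E\<in>T. \<exists>\<tau>' :: real^3 \<Rightarrow> real^3^3. (\<forall>d. (\<lambda>y. row d (\<tau>' y)) \<in> ERT0_hat) \<and>
        (\<forall>y\<in>interior ref_cube. transpose (\<tau> (elem_map (r E) y)) =
           (1 / elem_J (r E)) *\<^sub>R (elem_DF (r E) ** transpose (\<tau>' y)))"
    using \<tau> unfolding Xh_def mem_Collect_eq by (elim conjE)
  from bspec[OF this E] obtain \<tau>' :: "real^3 \<Rightarrow> real^3^3" where 1: "\<forall>d. (\<lambda>y. row d (\<tau>' y)) \<in> ERT0_hat"
    and 2: "\<forall>y\<in>interior ref_cube. transpose (\<tau> (elem_map (r E) y)) =
           (1 / elem_J (r E)) *\<^sub>R (elem_DF (r E) ** transpose (\<tau>' y))"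
    by (elim exE conjE)
  note rows = spec[OF 1] and piola = bspec[OF 2]
  let ?h = "\<lambda>x. (1 / elem_J (r E)) *\<^sub>R (\<tau>' (lcoord (r E) x) ** transpose (elem_DF (r E)))"
  have int: "\<tau> x = ?h x" if "x \<in> interior E" for x
  proof -
    have "lcoord (r E) x \<in> interior ref_cube"
      using that by (simp add: mem_interior_ref_cube cuboid_interior_iff[OF c])
    from piola[OF this] have "transpose (transpose (\<tau> x)) =
        transpose ((1 / elem_J (r E)) *\<^sub>R (elem_DF (r E) ** transpose (\<tau>' (lcoord (r E) x))))"
      by (simp add: elem_map_lcoord[OF c])
    also have "\<dots> = (1 / elem_J (r E)) *\<^sub>R transpose (elem_DF (r E) ** transpose (\<tau>' (lcoord (r E) x)))"
      by (simp add: transpose_def vec_eq_iff)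
    finally show ?thesis by (simp add: matrix_transpose_mul)
  qed
  have row_cont: "continuous_on UNIV (\<lambda>y. row d (\<tau>' y))" for d
  proof -
    obtain D where "\<And>y. ((\<lambda>y. row d (\<tau>' y)) has_derivative D y) (at y)"
      using ERT0_divergence[OF rows[of d]] by blast
    then show ?thesis
      by (meson continuous_on_eq_continuous_at differentiableI differentiable_imp_continuous_within open_UNIV UNIV_I)
  qed
  have comp: "continuous_on UNIV (\<lambda>x. \<tau>' (lcoord (r E) x) $ d $ k)" for d k
  proof -
    have "continuous_on UNIV (\<lambda>x. row d (\<tau>' (lcoord (r E) x)))"
      by (rule continuous_on_compose2[OF row_cont continuous_on_lcoord]) simp
    then have "continuous_on UNIV (\<lambda>x. row d (\<tau>' (lcoord (r E) x)) $ k)"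
      by (intro continuous_intros)
    then show ?thesis by (simp add: row_def)
  qed
  have "continuous_on E (\<lambda>x. \<chi> d i. (1 / elem_J (r E)) * (\<Sum>k\<in>UNIV. \<tau>' (lcoord (r E) x) $ d $ k * elem_DF (r E) $ i $ k))"
    by (intro continuous_intros continuous_on_subset[OF comp]) auto
  also have "(\<lambda>x. \<chi> d i. (1 / elem_J (r E)) * (\<Sum>k\<in>UNIV. \<tau>' (lcoord (r E) x) $ d $ k * elem_DF (r E) $ i $ k)) = ?h"
    by (simp add: fun_eq_iff vec_eq_iff matrix_matrix_mult_def transpose_def)
  finally have "continuous_on E ?h" .
  then have "from_within E \<tau> x = ?h x" if "x \<in> E" for x
    using from_within_eqI[OF c that] int by blast
  then show thesis using that rows int by blast
qed

text \<open>The transposed Jacobian sends edge \<open>j\<close> to a multiple of the unit vector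
  \<open>j\<close>, so the normal component on a facet is a single reference component.\<close>

lemma piola_edge:
  assumes "cuboid \<rho> E"
  shows "((1 / elem_J \<rho>) *\<^sub>R (M ** transpose (elem_DF \<rho>))) *v edge \<rho> j =
    (edge \<rho> j \<bullet> edge \<rho> j / elem_J \<rho>) *\<^sub>R column j M"
proof -
  have "(transpose (elem_DF \<rho>) *v edge \<rho> j) $ k = edge \<rho> k \<bullet> edge \<rho> j" for k
    by (simp add: matrix_vector_mult_def transpose_def elem_DF_column inner_vec_def del: transpose_matrix_vector)
  then have "transpose (elem_DF \<rho>) *v edge \<rho> j = (edge \<rho> j \<bullet> edge \<rho> j) *\<^sub>R axis j 1"
    using cuboid_edge_orthogonal[OF assms] by (auto simp: vec_eq_iff axis_def simp del: transpose_matrix_vector)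
  then have "(M ** transpose (elem_DF \<rho>)) *v edge \<rho> j = (edge \<rho> j \<bullet> edge \<rho> j) *\<^sub>R column j M"
    by (simp add: matrix_vector_mult_scaleR matrix_vector_mult_basis del: transpose_matrix_vector
        flip: matrix_vector_mul_assoc)
  then show ?thesis by (simp add: scaleR_matrix_vector_assoc[symmetric])
qed

text \<open>Expresses the reference vertex values by physical ones; the factor
  \<open>2 * ref_vertex i $ j - 1\<close> is the sign of the outward direction relative to edge
  \<open>j\<close>.\<close>

lemma Xh_divergence:
  assumes \<tau>: "\<tau> \<in> Xh \<Omega> \<Gamma> T r" and E: "E \<in> T" and g: "L2 \<Omega> g" "weak_div \<Omega> \<tau> g"
  shows "(\<integral>x. indicator (interior E) x * g x $ d \<partial>lebesgue_on \<Omega>) =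
    (\<Sum>i=1..8. \<Sum>j\<in>UNIV. (2 * ref_vertex i $ j - 1) * elem_J (r E) / (4 * (edge (r E) j \<bullet> edge (r E) j)) *
       (from_within E \<tau> (r E i) *v edge (r E) j) $ d)"
proof -
  note c = cuboid[OF E]
  obtain \<tau>' where rows: "\<And>d. (\<lambda>y. row d (\<tau>' y)) \<in> ERT0_hat"
    and int: "\<And>x. x \<in> interior E \<Longrightarrow> \<tau> x = (1 / elem_J (r E)) *\<^sub>R (\<tau>' (lcoord (r E) x) ** transpose (elem_DF (r E)))"
    and fw: "\<And>x. x \<in> E \<Longrightarrow> from_within E \<tau> x = (1 / elem_J (r E)) *\<^sub>R (\<tau>' (lcoord (r E) x) ** transpose (elem_DF (r E)))"
    by (rule Xh_element[OF \<tau> E]) blast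
  have "(\<integral>x. indicator (interior E) x * g x $ d \<partial>lebesgue_on \<Omega>) =
      (\<Sum>i=1..8. \<Sum>j\<in>UNIV. (2 * ref_vertex i $ j - 1) * row d (\<tau>' (ref_vertex i)) $ j) / 4"
  proof (rule element_divergence[OF c interior_subset_domain[OF E] domain_lmeasurable g rows])
    fix x assume "x \<in> interior E"
    then show "row d (\<tau> x) = (1 / elem_J (r E)) *\<^sub>R (elem_DF (r E) *v row d (\<tau>' (lcoord (r E) x)))"
      by (simp add: int row_def vec_eq_iff matrix_vector_mult_def matrix_matrix_mult_def transpose_def mult.commute)
  qed
  also have "\<dots> = (\<Sum>i=1..8. \<Sum>j\<in>UNIV. (2 * ref_vertex i $ j - 1) * elem_J (r E) / (4 * (edge (r E) j \<bullet> edge (r E) j)) *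
       (from_within E \<tau> (r E i) *v edge (r E) j) $ d)"
    unfolding sum_divide_distrib
  proof (intro sum.cong refl)
    fix i j assume i: "i \<in> {1..8::nat}"
    have "(from_within E \<tau> (r E i) *v edge (r E) j) $ d = (edge (r E) j \<bullet> edge (r E) j) / elem_J (r E) * row d (\<tau>' (ref_vertex i)) $ j"
      unfolding fw[OF cuboid_vertex_mem[OF c i]] piola_edge[OF c] lcoord_vertex[OF c i]
      by (simp add: column_def row_def)
    then show "(2 * ref_vertex i $ j - 1) * row d (\<tau>' (ref_vertex i)) $ j / 4 =
        (2 * ref_vertex i $ j - 1) * elem_J (r E) / (4 * (edge (r E) j \<bullet> edge (r E) j)) * (from_within E \<tau> (r E i) *v edge (r E) j) $ d"
      using cuboid_J_pos[OF c] cuboid_edge_nonzero[OF c, of j] by simp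
  qed
  finally show ?thesis .
qed

lemma Vh_interior:
  assumes v: "v \<in> Vh T" and E: "E \<in> T" and x: "x \<in> interior E"
  shows "v x = v (box_center (r E))"
proof -
  have "box_center (r E) \<in> interior E"
    by (simp add: box_center_def cuboid_interior_iff[OF cuboid[OF E]] lcoord_elem_map[OF cuboid[OF E]])
  moreover obtain c where "\<forall>x\<in>interior E. v x = c" using v E unfolding Vh_def by blast
  ultimately show ?thesis using x by simp
qed

lemma Vh_outside:
  assumes "v \<in> Vh T" "x \<notin> (\<Union>E\<in>T. interior E)" shows "v x = 0"
  using assms unfolding Vh_def by blast

text \<open>Fields of \<open>Vh\<close> vanish off the element interiors, so the decomposition with
  indicators holds at every point and not just almost everywhere.\<close>

lemma L2_inner_Vh:
  assumes v: "v \<in> Vh T" and g: "L2 \<Omega> g"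
  shows "L2_inner \<Omega> g v = (\<Sum>E\<in>T. \<Sum>d\<in>UNIV. v (box_center (r E)) $ d *
    (\<integral>x. indicator (interior E) x * g x $ d \<partial>lebesgue_on \<Omega>))"
proof -
  have pt: "g x \<bullet> v x = (\<Sum>E\<in>T. \<Sum>d\<in>UNIV. v (box_center (r E)) $ d * (indicator (interior E) x * g x $ d))" for x
  proof (cases "x \<in> (\<Union>E\<in>T. interior E)")
    case True
    then obtain E0 where E0: "E0 \<in> T" "x \<in> interior E0" by blast
    have "(\<Sum>E\<in>T. \<Sum>d\<in>UNIV. v (box_center (r E)) $ d * (indicator (interior E) x * g x $ d)) =
        (\<Sum>E\<in>T. if E = E0 then g x \<bullet> v x else 0)"
    proof (rule sum.cong[OF refl])
      fix E assume E: "E \<in> T"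
      show "(\<Sum>d\<in>UNIV. v (box_center (r E)) $ d * (indicator (interior E) x * g x $ d)) = (if E = E0 then g x \<bullet> v x else 0)"
      proof (cases "E = E0")
        case True
        then show ?thesis using E0 Vh_interior[OF v E0] by (simp add: inner_vec_def mult.commute)
      next
        case False
        then have "x \<notin> interior E" using disjoint_interiors[OF E E0(1)] E0(2) by blast
        then show ?thesis using False by simp
      qed
    qed
    then show ?thesis using E0(1) finite_T by simp
  next
    case False
    then have "indicator (interior E) x = (0::real)" if "E \<in> T" for E using that by auto
    then show ?thesis using Vh_outside[OF v False] by simp
  qed
  have gint: "integrable (lebesgue_on \<Omega>) (\<lambda>x. g x $ d)" for d
    using L2_integrable[OF g domain_lmeasurable] by (rule integrable_bounded_linear[OF bounded_linear_vec_nth])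
  have int: "integrable (lebesgue_on \<Omega>) (\<lambda>x. indicator (interior E) x * g x $ d)" if "E \<in> T" for E d
  proof -
    have "interior E \<inter> \<Omega> \<in> sets lebesgue" using open_domain by (intro sets.Int) auto
    then have "interior E \<in> sets (lebesgue_on \<Omega>)"
      using interior_subset_domain[OF that] open_domain by (simp add: sets_restrict_space_iff Int_absorb2)
    from integrable_mult_indicator[OF this gint] show ?thesis by simp
  qed
  show ?thesis
    unfolding L2_inner_def pt
    by (simp add: Bochner_Integration.integral_sum Bochner_Integration.integrable_sum int)
qed

lemma the_div_properties:
  assumes "\<tau> \<in> Xh \<Omega> \<Gamma> T r"
  shows "L2 \<Omega> (the_div \<Omega> \<tau>)" "weak_div \<Omega> \<tau> (the_div \<Omega> \<tau>)"
proof -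
  have "\<exists>g. L2 \<Omega> g \<and> weak_div \<Omega> \<tau> g"
    using assms unfolding Xh_def mem_Collect_eq by (elim conjE)
  then have "L2 \<Omega> (the_div \<Omega> \<tau>) \<and> weak_div \<Omega> \<tau> (the_div \<Omega> \<tau>)"
    unfolding the_div_def by (rule someI_ex)
  then show "L2 \<Omega> (the_div \<Omega> \<tau>)" "weak_div \<Omega> \<tau> (the_div \<Omega> \<tau>)" by auto
qed

text \<open>A piecewise constant field sees only the element integrals of the divergence, which
  brings this form into the shape of a vertex quadrature.\<close>

lemma divergence_form:
  assumes \<tau>: "\<tau> \<in> Xh \<Omega> \<Gamma> T r" and v: "v \<in> Vh T"
  shows "L2_inner \<Omega> (the_div \<Omega> \<tau>) v =
    (\<Sum>E\<in>T. \<Sum>i=1..8. \<Sum>j\<in>UNIV. (2 * ref_vertex i $ j - 1) * elem_J (r E) / (4 * (edge (r E) j \<bullet> edge (r E) j)) *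
       ((from_within E \<tau> (r E i) *v edge (r E) j) \<bullet> v (box_center (r E))))"
proof -
  let ?k = "\<lambda>E i j. (2 * ref_vertex i $ j - 1) * elem_J (r E) / (4 * (edge (r E) j \<bullet> edge (r E) j))"
  let ?s = "\<lambda>E i j. from_within E \<tau> (r E i) *v edge (r E) j"
  have "(\<Sum>d\<in>UNIV. v (box_center (r E)) $ d * (\<Sum>i=1..8. \<Sum>j\<in>UNIV. ?k E i j * ?s E i j $ d)) =
      (\<Sum>i=1..8. \<Sum>j\<in>UNIV. ?k E i j * (?s E i j \<bullet> v (box_center (r E))))" for E
  proof -
    have "(\<Sum>d\<in>UNIV. v (box_center (r E)) $ d * (\<Sum>i=1..8. \<Sum>j\<in>UNIV. ?k E i j * ?s E i j $ d)) =
        (\<Sum>d\<in>UNIV. \<Sum>i=1..8. \<Sum>j\<in>UNIV. ?k E i j * (?s E i j $ d * v (box_center (r E)) $ d))"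
      unfolding sum_distrib_left by (intro sum.cong refl) (simp only: mult_ac)
    also have "\<dots> = (\<Sum>i=1..8. \<Sum>d\<in>UNIV. \<Sum>j\<in>UNIV. ?k E i j * (?s E i j $ d * v (box_center (r E)) $ d))"
      by (rule sum.swap)
    also have "\<dots> = (\<Sum>i=1..8. \<Sum>j\<in>UNIV. \<Sum>d\<in>UNIV. ?k E i j * (?s E i j $ d * v (box_center (r E)) $ d))"
      by (intro sum.cong refl sum.swap)
    finally show ?thesis by (simp only: inner_vec_def inner_real_def sum_distrib_left)
  qed
  then show ?thesis
    unfolding L2_inner_Vh[OF v the_div_properties(1)[OF \<tau>]]
    by (simp only: Xh_divergence[OF \<tau> _ the_div_properties[OF \<tau>]] cong: sum.cong)
qed

lemma Wh1_from_within:
  assumes "w \<in> Wh1 \<Omega> T r" "E \<in> T" "x \<in> E"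
  shows "from_within E w x = w x"
proof -
  have "continuous_on (closure \<Omega>) w" using assms(1) unfolding Wh1_def by blast
  then have "continuous_on E w" by (rule continuous_on_subset[OF _ closed_element_subset[OF assms(2)]])
  then show ?thesis by (rule from_within_eqI[OF cuboid[OF assms(2)] assms(3) _ refl])
qed

text \<open>\<open>\<sigma> E x\<close> stands for the value at \<open>x\<close>, taken from within \<open>E\<close>, of the basis field of the degree
  of freedom \<open>(f0, x0, c0)\<close>.\<close>

lemma basis_field_form:
  fixes u :: "(real^3) set \<Rightarrow> real^3" and W :: "real^3 \<Rightarrow> real^3^3"
  assumes n: "\<And>f. f \<in> mesh_faces T \<Longrightarrow> unit_normal f (n f)"
    and x0: "x0 extreme_point_of f0"
    and dual: "\<And>E f x c. E \<in> T \<Longrightarrow> f facet_of E \<Longrightarrow> x extreme_point_of f \<Longrightarrow>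
      (\<sigma> E x *v n f) $ c = (if (f, x, c) = (f0, x0, c0) then 1 else 0)"
  shows "(\<Sum>E\<in>T. \<Sum>i=1..8. \<Sum>j\<in>UNIV. (2 * ref_vertex i $ j - 1) * elem_J (r E) / (4 * (edge (r E) j \<bullet> edge (r E) j)) *
       ((\<sigma> E (r E i) *v edge (r E) j) \<bullet> u E)) +
     (\<Sum>E\<in>T. elem_J (r E) / 8 * (\<Sum>i=1..8. \<sigma> E (r E i) \<bullet> W (r E i))) =
     (\<Sum>E\<in>{E \<in> T. f0 facet_of E}. facet_weight (r E) E f0 (n f0) *\<^sub>R (u E + W x0 *v facet_offset (r E) E f0)) $ c0"
proof -
  let ?k = "\<lambda>E i j. (2 * ref_vertex i $ j - 1) * elem_J (r E) / (4 * (edge (r E) j \<bullet> edge (r E) j))"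
  let ?R = "\<lambda>E. facet_weight (r E) E f0 (n f0) * (u E + W x0 *v facet_offset (r E) E f0) $ c0"
  let ?f = "\<lambda>E i j. box_face (r E) E j (ref_vertex i $ j)"
  have "(\<Sum>i=1..8. \<Sum>j\<in>UNIV. ?k E i j * ((\<sigma> E (r E i) *v edge (r E) j) \<bullet> u E)) +
      elem_J (r E) / 8 * (\<Sum>i=1..8. \<sigma> E (r E i) \<bullet> W (r E i)) =
      (if f0 facet_of E then ?R E else 0)" if E: "E \<in> T" for E
  proof -
    note c = cuboid[OF E]
    let ?e = "edge (r E)"
    \<comment> \<open>The contribution of one vertex of \<open>E\<close> and one facet direction to
      both forms.\<close>
    have summand: "?k E i j * ((\<sigma> E (r E i) *v ?e j) \<bullet> u E) +
        elem_J (r E) / 8 * ((\<sigma> E (r E i) *v ?e j) \<bullet> (W (r E i) *v ?e j) / (?e j \<bullet> ?e j)) =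
        (if ?f E i j = f0 \<and> r E i = x0 then ?R E else 0)" if i: "i \<in> {1..8}" for i j
    proof -
      let ?y = "ref_vertex i $ j"
      have y: "?y \<in> {0, 1}" using cube_corner_ref_vertex[OF i] unfolding cube_corner_def by blast
      have fac: "?f E i j facet_of E" by (rule box_face_facet_of[OF c y])
      then have mf: "?f E i j \<in> mesh_faces T" using E by (auto simp: mesh_faces_def)
      define m where "m = n (?f E i j)"
      have un: "unit_normal (?f E i j) m" unfolding m_def by (rule n[OF mf])
      have ext: "r E i extreme_point_of ?f E i j"
        unfolding extreme_point_of_box_face[OF c y] lcoord_vertex[OF c i]
        using cube_corner_ref_vertex[OF i] by simp
      define s where "s = \<sigma> E (r E i) *v m"
      have s: "s = (if ?f E i j = f0 \<and> r E i = x0 then axis c0 1 else 0)"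
        using dual[OF E fac ext] by (auto simp: s_def m_def vec_eq_iff axis_def)
      define a where "a = m \<bullet> ?e j"
      have ea: "?e j = a *\<^sub>R m" unfolding a_def by (rule unit_normal_box_face(1)[OF c y un])
      have \<sigma>e: "\<sigma> E (r E i) *v ?e j = a *\<^sub>R s"
        by (subst ea) (simp add: matrix_vector_mult_scaleR s_def)
      have ee: "?e j \<bullet> ?e j \<noteq> 0" using cuboid_edge_nonzero[OF c] by simp
      have off: "facet_offset (r E) E (?f E i j) = (?y - 1/2) *\<^sub>R ?e j"
        by (simp add: facet_offset_box_face[OF c y] face_offset_def)
      \<comment> \<open>Both values rely on the local coordinate being 0 or 1.\<close>
      have sq: "(?y - 1/2) * (?y - 1/2) = 1/4" "(2 * ?y - 1) * (?y - 1/2) = 1/2" using y by auto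
      have "(norm (facet_offset (r E) E (?f E i j)))\<^sup>2 = ((?y - 1/2) * (?y - 1/2)) * (?e j \<bullet> ?e j)"
        unfolding off power2_norm_eq_inner by simp
      then have w: "facet_weight (r E) E (?f E i j) m = ?k E i j * a"
        unfolding facet_weight_def sq(1) using ee by (simp add: off a_def field_simps)
      \<comment> \<open>The half edge contained in the offset converts the divergence weight 1/4
        into the quadrature weight 1/8. Displacement and rotation then share one weight.\<close>
      have "?k E i j * ((a *\<^sub>R s) \<bullet> (W (r E i) *v ((?y - 1/2) *\<^sub>R ?e j))) =
          ((2 * ?y - 1) * (?y - 1/2)) * elem_J (r E) / (4 * (?e j \<bullet> ?e j)) * ((a *\<^sub>R s) \<bullet> (W (r E i) *v ?e j))"
        by (simp add: matrix_vector_mult_scaleR)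
      also have "\<dots> = elem_J (r E) / 8 * ((a *\<^sub>R s) \<bullet> (W (r E i) *v ?e j) / (?e j \<bullet> ?e j))"
        unfolding sq(2) by simp
      finally have "?k E i j * ((\<sigma> E (r E i) *v ?e j) \<bullet> u E) +
          elem_J (r E) / 8 * ((\<sigma> E (r E i) *v ?e j) \<bullet> (W (r E i) *v ?e j) / (?e j \<bullet> ?e j)) =
          ?k E i j * ((a *\<^sub>R s) \<bullet> (u E + W (r E i) *v ((?y - 1/2) *\<^sub>R ?e j)))"
        unfolding \<sigma>e inner_add_right distrib_left by simp
      also have "\<dots> = ?k E i j * a * (s \<bullet> (u E + W (r E i) *v ((?y - 1/2) *\<^sub>R ?e j)))"
        by (simp only: inner_scaleR_left mult.assoc)
      also have "\<dots> = facet_weight (r E) E (?f E i j) m * (s \<bullet> (u E + W (r E i) *v facet_offset (r E) E (?f E i j)))"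
        by (simp only: w off)
      also have "\<dots> = (if ?f E i j = f0 \<and> r E i = x0 then ?R E else 0)"
      proof (cases "?f E i j = f0 \<and> r E i = x0")
        case True
        then show ?thesis by (simp add: s m_def inner_axis' )
      next
        case False
        then have "s = 0" unfolding s by (rule if_not_P)
        then show ?thesis unfolding if_not_P[OF False] by simp
      qed
      finally show ?thesis .
    qed
    have "(\<Sum>i=1..8. \<Sum>j\<in>UNIV. ?k E i j * ((\<sigma> E (r E i) *v ?e j) \<bullet> u E)) +
        elem_J (r E) / 8 * (\<Sum>i=1..8. \<sigma> E (r E i) \<bullet> W (r E i)) =
        (\<Sum>i=1..8. \<Sum>j\<in>UNIV. ?k E i j * ((\<sigma> E (r E i) *v ?e j) \<bullet> u E) +
          elem_J (r E) / 8 * ((\<sigma> E (r E i) *v ?e j) \<bullet> (W (r E i) *v ?e j) / (?e j \<bullet> ?e j)))"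
      unfolding matrix_inner_edges[OF c] sum_distrib_left sum.distrib ..
    also have "\<dots> = (\<Sum>i=1..8. \<Sum>j\<in>UNIV. if ?f E i j = f0 \<and> r E i = x0 then ?R E else 0)"
      by (intro sum.cong refl summand)
    also have "\<dots> = (if f0 facet_of E then ?R E else 0)"
    proof (cases "f0 facet_of E")
      case True
      then obtain j0 s0 where js: "s0 \<in> {0, 1}" "f0 = box_face (r E) E j0 s0" using facet_of_cuboid_iff[OF c] by blast
      have "x0 extreme_point_of E" using extreme_point_of_face[of f0 E x0] True x0 by (simp add: facet_of_def)
      then obtain i0 where i0: "i0 \<in> {1..8}" "x0 = r E i0" using cuboid_extreme_point_vertex[OF c] by blast
      have y0: "ref_vertex i0 $ j0 = s0"
        using x0 unfolding js(2) extreme_point_of_box_face[OF c js(1)] i0(2) lcoord_vertex[OF c i0(1)] by simp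
      \<comment> \<open>Facet and vertex determine the direction and the vertex number, so at most
        one summand per element survives.\<close>
      have "(?f E i j = f0 \<and> r E i = x0) = (i = i0 \<and> j = j0)" if i: "i \<in> {1..8}" for i j
      proof
        assume *: "?f E i j = f0 \<and> r E i = x0"
        then have "i = i0" using inj_onD[OF inj_on_vertex[OF c] _ i i0(1)] i0(2) by simp
        moreover have "ref_vertex i $ j \<in> {0, 1}" using cube_corner_ref_vertex[OF i] unfolding cube_corner_def by blast
        then have "j = j0" using box_face_inj[OF c _ js(1)] * js(2) by metis
        ultimately show "i = i0 \<and> j = j0" by simp
      next
        assume "i = i0 \<and> j = j0"
        then show "?f E i j = f0 \<and> r E i = x0" using i0 js y0 by simp
      qed
      then have "(\<Sum>i=1..8. \<Sum>j\<in>UNIV. if ?f E i j = f0 \<and> r E i = x0 then ?R E else 0) =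
          (\<Sum>i=1..8. \<Sum>j\<in>UNIV. if i = i0 \<and> j = j0 then ?R E else 0)"
        by (intro sum.cong refl) simp
      also have "\<dots> = (\<Sum>i=1..8. if i = i0 then ?R E else 0)"
        by (intro sum.cong refl) auto
      also have "\<dots> = ?R E" using i0(1) by simp
      finally show ?thesis using True by simp
    next
      case False
      have "?f E i j \<noteq> f0" if "i \<in> {1..8}" for i j
      proof -
        have "ref_vertex i $ j \<in> {0, 1}" using cube_corner_ref_vertex[OF that] unfolding cube_corner_def by blast
        then show ?thesis using box_face_facet_of[OF c] False by blast
      qed
      then have "(\<Sum>i=1..8. \<Sum>j\<in>UNIV. if ?f E i j = f0 \<and> r E i = x0 then ?R E else 0) = 0"
        by (intro sum.neutral ballI) simp
      then show ?thesis using False by simp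
    qed
    finally show ?thesis .
  qed
  then have "(\<Sum>E\<in>T. \<Sum>i=1..8. \<Sum>j\<in>UNIV. ?k E i j * ((\<sigma> E (r E i) *v edge (r E) j) \<bullet> u E)) +
      (\<Sum>E\<in>T. elem_J (r E) / 8 * (\<Sum>i=1..8. \<sigma> E (r E i) \<bullet> W (r E i))) =
      (\<Sum>E\<in>T. if f0 facet_of E then ?R E else 0)"
    by (simp only: sum.distrib[symmetric] cong: sum.cong)
  also have "\<dots> = (\<Sum>E\<in>{E \<in> T. f0 facet_of E}. ?R E)"
    by (rule sum.inter_filter[OF finite_T, symmetric])
  also have "\<dots> = (\<Sum>E\<in>{E \<in> T. f0 facet_of E}. facet_weight (r E) E f0 (n f0) *\<^sub>R (u E + W x0 *v facet_offset (r E) E f0)) $ c0"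
    by simp
  finally show ?thesis .
qed

end

section \<open>Vertex values, compliance and the stress matrix\<close>

context cuboid_mesh
begin

text \<open>The normals of the three facets of \<open>E\<close> at a vertex are parallel to the
  three edges and hence form a basis.\<close>

lemma vertex_matrix_zero:
  fixes M :: "real^3^3"
  assumes n: "\<And>f. f \<in> mesh_faces T \<Longrightarrow> unit_normal f (n f)"
    and E: "E \<in> T" "k \<in> {1..8}"
    and M: "\<And>f. f facet_of E \<Longrightarrow> r E k extreme_point_of f \<Longrightarrow> M *v n f = 0"
  shows "M = 0"
proof -
  note c = cuboid[OF E(1)]
  have Me: "M *v edge (r E) j = 0" for j
  proof -
    let ?y = "ref_vertex k $ j"
    let ?f = "box_face (r E) E j ?y"
    have y: "?y \<in> {0, 1}" using cube_corner_ref_vertex[OF E(2)] unfolding cube_corner_def by blast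
    have fac: "?f facet_of E" by (rule box_face_facet_of[OF c y])
    then have "?f \<in> mesh_faces T" using E by (auto simp: mesh_faces_def)
    then have un: "unit_normal ?f (n ?f)" by (rule n)
    have "r E k extreme_point_of ?f"
      unfolding extreme_point_of_box_face[OF c y] lcoord_vertex[OF c E(2)]
      using cube_corner_ref_vertex[OF E(2)] by simp
    then have "M *v n ?f = 0" by (rule M[OF fac])
    then show ?thesis
      by (subst unit_normal_box_face(1)[OF c y un]) (simp add: matrix_vector_mult_scaleR)
  qed
  have "M \<bullet> M = 0" unfolding matrix_inner_edges[OF c] by (simp add: Me)
  then show ?thesis by simp
qed

text \<open>Vertices lie outside the open elements, so coercivity and symmetry are carried to them
  by the continuous extension from the interior.\<close>

lemma compliance_within:
  assumes A: "compliance_tensor \<Omega> T A"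
  obtains \<alpha> where "\<alpha> > 0"
    and "\<And>E x \<tau>. E \<in> T \<Longrightarrow> x \<in> E \<Longrightarrow> blinfun_apply (from_within E A x) \<tau> \<bullet> \<tau> \<ge> \<alpha> * (norm \<tau>)\<^sup>2"
    and "\<And>E x \<sigma> \<tau>. E \<in> T \<Longrightarrow> x \<in> E \<Longrightarrow>
      blinfun_apply (from_within E A x) \<sigma> \<bullet> \<tau> = \<sigma> \<bullet> blinfun_apply (from_within E A x) \<tau>"
proof -
  have sym: "blinfun_apply (A x) \<sigma> \<bullet> \<tau> = \<sigma> \<bullet> blinfun_apply (A x) \<tau>" if "x \<in> \<Omega>" for x \<sigma> \<tau>
    using A that unfolding compliance_tensor_def by blast
  obtain \<alpha> where \<alpha>: "\<alpha> > 0" "\<And>x \<tau>. x \<in> \<Omega> \<Longrightarrow> blinfun_apply (A x) \<tau> \<bullet> \<tau> \<ge> \<alpha> * (norm \<tau>)\<^sup>2"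
    using A unfolding compliance_tensor_def by blast
  have both: "blinfun_apply (from_within E A x) \<tau> \<bullet> \<tau> \<ge> \<alpha> * (norm \<tau>)\<^sup>2 \<and>
      blinfun_apply (from_within E A x) \<sigma> \<bullet> \<tau> = \<sigma> \<bullet> blinfun_apply (from_within E A x) \<tau>"
    if E: "E \<in> T" and x: "x \<in> E" for E x \<sigma> \<tau>
  proof -
    obtain A' where A': "continuous_on E A'" "\<And>y. y \<in> interior E \<Longrightarrow> A y = A' y"
      using A E unfolding compliance_tensor_def by blast
    have fw: "from_within E A x = A' x" by (rule from_within_eqI[OF cuboid[OF E] x A'])
    have cl: "closure (interior E) = E" by (rule cuboid_closure_interior[OF cuboid[OF E]])
    have int\<Omega>: "y \<in> \<Omega>" if "y \<in> interior E" for y using interior_subset_domain[OF E] that by blast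
    have "\<alpha> * (norm \<tau>)\<^sup>2 \<le> blinfun_apply (A' x) \<tau> \<bullet> \<tau>"
    proof (rule continuous_ge_on_closure[of "interior E"])
      show "continuous_on (closure (interior E)) (\<lambda>x. blinfun_apply (A' x) \<tau> \<bullet> \<tau>)"
        unfolding cl by (intro continuous_intros A')
      show "x \<in> closure (interior E)" using x cl by simp
      show "\<alpha> * (norm \<tau>)\<^sup>2 \<le> blinfun_apply (A' y) \<tau> \<bullet> \<tau>" if "y \<in> interior E" for y
        using \<alpha>(2)[OF int\<Omega>[OF that]] A'(2)[OF that] by simp
    qed
    moreover have "blinfun_apply (A' x) \<sigma> \<bullet> \<tau> - \<sigma> \<bullet> blinfun_apply (A' x) \<tau> = 0"
    proof (rule continuous_constant_on_closure[of "interior E"])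
      show "continuous_on (closure (interior E)) (\<lambda>x. blinfun_apply (A' x) \<sigma> \<bullet> \<tau> - \<sigma> \<bullet> blinfun_apply (A' x) \<tau>)"
        unfolding cl by (intro continuous_intros A')
      show "x \<in> closure (interior E)" using x cl by simp
      show "blinfun_apply (A' y) \<sigma> \<bullet> \<tau> - \<sigma> \<bullet> blinfun_apply (A' y) \<tau> = 0" if "y \<in> interior E" for y
        using sym[OF int\<Omega>[OF that]] A'(2)[OF that] by simp
    qed
    ultimately show ?thesis by (simp add: fw)
  qed
  show thesis by (rule that[OF \<alpha>(1)]) (use both in blast)+
qed

text \<open>Bilinearity collects the coefficients into one stress value per element vertex, to which
  coercivity applies.\<close>

lemma stress_matrix_inner:
  fixes z :: "real^'d" and \<tau> :: "'d::finite \<Rightarrow> real^3 \<Rightarrow> real^3^3"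
  shows "z \<bullet> ((\<chi> i j. quad_A T r A (\<tau> j) (\<tau> i)) *v z) =
    (\<Sum>E\<in>T. measure lebesgue E / 8 * (\<Sum>k=1..8. blinfun_apply (from_within E A (r E k))
      (\<Sum>j\<in>UNIV. z $ j *\<^sub>R from_within E (\<tau> j) (r E k)) \<bullet> (\<Sum>j\<in>UNIV. z $ j *\<^sub>R from_within E (\<tau> j) (r E k))))"
proof -
  let ?B = "\<lambda>E k. blinfun_apply (from_within E A (r E k))" and ?V = "\<lambda>j E k. from_within E (\<tau> j) (r E k)"
  have "z \<bullet> ((\<chi> i j. quad_A T r A (\<tau> j) (\<tau> i)) *v z) =
      (\<Sum>i\<in>UNIV. \<Sum>j\<in>UNIV. \<Sum>E\<in>T. \<Sum>k=1..8. z $ i * (measure lebesgue E / 8 * (?B E k (?V j E k) \<bullet> ?V i E k) * z $ j))"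
    by (simp add: inner_vec_def[of z] matrix_vector_mult_def quad_A_def sum_distrib_left sum_distrib_right mult.assoc)
  also have "\<dots> = (\<Sum>E\<in>T. \<Sum>k=1..8. \<Sum>i\<in>UNIV. \<Sum>j\<in>UNIV. z $ i * (measure lebesgue E / 8 * (?B E k (?V j E k) \<bullet> ?V i E k) * z $ j))"
  proof -
    have "(\<Sum>i\<in>UNIV. \<Sum>j\<in>UNIV. \<Sum>E\<in>T. \<Sum>k=1..8. g i j E k) = (\<Sum>E\<in>T. \<Sum>k=1..8. \<Sum>i\<in>UNIV. \<Sum>j\<in>UNIV. g i j E k)"
      for g :: "'d \<Rightarrow> 'd \<Rightarrow> (real^3) set \<Rightarrow> nat \<Rightarrow> real"
    proof -
      have "(\<Sum>i\<in>UNIV. \<Sum>j\<in>UNIV. \<Sum>E\<in>T. \<Sum>k=1..8. g i j E k) = (\<Sum>i\<in>UNIV. \<Sum>E\<in>T. \<Sum>j\<in>UNIV. \<Sum>k=1..8. g i j E k)"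
        by (intro sum.cong refl sum.swap)
      also have "\<dots> = (\<Sum>i\<in>UNIV. \<Sum>E\<in>T. \<Sum>k=1..8. \<Sum>j\<in>UNIV. g i j E k)"
        by (intro sum.cong refl sum.swap)
      also have "\<dots> = (\<Sum>E\<in>T. \<Sum>i\<in>UNIV. \<Sum>k=1..8. \<Sum>j\<in>UNIV. g i j E k)" by (rule sum.swap)
      also have "\<dots> = (\<Sum>E\<in>T. \<Sum>k=1..8. \<Sum>i\<in>UNIV. \<Sum>j\<in>UNIV. g i j E k)"
        by (intro sum.cong refl sum.swap)
      finally show ?thesis .
    qed
    then show ?thesis .
  qed
  also have "\<dots> = (\<Sum>E\<in>T. measure lebesgue E / 8 * (\<Sum>k=1..8. ?B E k
      (\<Sum>j\<in>UNIV. z $ j *\<^sub>R ?V j E k) \<bullet> (\<Sum>j\<in>UNIV. z $ j *\<^sub>R ?V j E k)))"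
    unfolding sum_distrib_left
  proof (intro sum.cong refl)
    fix E and k :: nat
    show "(\<Sum>i\<in>UNIV. \<Sum>j\<in>UNIV. z $ i * (measure lebesgue E / 8 * (?B E k (?V j E k) \<bullet> ?V i E k) * z $ j)) =
      measure lebesgue E / 8 * (?B E k (\<Sum>j\<in>UNIV. z $ j *\<^sub>R ?V j E k) \<bullet> (\<Sum>j\<in>UNIV. z $ j *\<^sub>R ?V j E k))"
      by (simp add: blinfun.sum_right blinfun.scaleR_right inner_sum_left inner_sum_right sum_distrib_left sum_divide_distrib mult_ac)
  qed
  finally show ?thesis .
qed

end

lemma card_node_fibre:
  fixes node :: "'w::finite \<Rightarrow> (real^3) \<times> 3"
  assumes "bij_betw node UNIV (X \<times> UNIV)" "x \<in> X"
  shows "card {k. fst (node k) = x} = 3"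
proof -
  have "node ` {k. fst (node k) = x} = {d \<in> range node. fst d = x}" by auto
  also have "\<dots> = {x} \<times> UNIV" using assms(2) unfolding bij_betw_imp_surj_on[OF assms(1)] by auto
  finally have "card (node ` {k. fst (node k) = x}) = card ({x} \<times> (UNIV :: 3 set))" by simp
  then show ?thesis
    using card_image[OF inj_on_subset[OF bij_betw_imp_inj_on[OF assms(1)] subset_UNIV], of "{k. fst (node k) = x}"]
    by (simp add: card_cartesian_product)
qed

text \<open>At a given vertex only its own three nodal functions are nonzero, and their values there
  are the linearly independent \<open>S s\<close>.\<close>

lemma nodal_coefficients_zero:
  fixes node :: "'w::finite \<Rightarrow> (real^3) \<times> 3" and S :: "3 \<Rightarrow> real^3^3"
  assumes node: "bij_betw node UNIV (X \<times> UNIV)" and S: "inj S" "independent (range S)"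
    and zero: "\<And>x. x \<in> X \<Longrightarrow> (\<Sum>k\<in>UNIV. y k *\<^sub>R (if x = fst (node k) then S (snd (node k)) else 0)) = 0"
  shows "y k0 = 0"
proof -
  let ?x = "fst (node k0)"
  have x: "?x \<in> X" using bij_betw_apply[OF node, of k0] by (auto simp: mem_Times_iff)
  \<comment> \<open>Index of the nodal function at the fixed vertex with skew direction
    \<open>s\<close>.\<close>
  define \<kappa> where "\<kappa> s = inv_into UNIV node (?x, s)" for s
  have node_\<kappa>: "node (\<kappa> s) = (?x, s)" for s
    unfolding \<kappa>_def by (rule f_inv_into_f) (use bij_betw_imp_surj_on[OF node] x in auto)
  have inj_node: "inj node" by (rule bij_betw_imp_inj_on[OF node])
  have inj_\<kappa>: "inj \<kappa>" by (rule injI) (metis node_\<kappa> prod.inject)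
  have fibre: "{k. ?x = fst (node k)} = range \<kappa>"
  proof (intro equalityI subsetI)
    fix k assume "k \<in> {k. ?x = fst (node k)}"
    then have "node k = node (\<kappa> (snd (node k)))" by (simp add: node_\<kappa> prod_eq_iff)
    then have "k = \<kappa> (snd (node k))" by (rule injD[OF inj_node])
    then show "k \<in> range \<kappa>" by blast
  next
    fix k assume "k \<in> range \<kappa>"
    then show "k \<in> {k. ?x = fst (node k)}" by (auto simp: node_\<kappa>)
  qed
  have "(\<Sum>k\<in>UNIV. if ?x = fst (node k) then y k *\<^sub>R S (snd (node k)) else 0) =
      (\<Sum>k\<in>UNIV. y k *\<^sub>R (if ?x = fst (node k) then S (snd (node k)) else 0))"
    by (intro sum.cong refl) simp
  then have "0 = (\<Sum>k\<in>UNIV. if ?x = fst (node k) then y k *\<^sub>R S (snd (node k)) else 0)"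
    by (simp only: zero[OF x])
  also have "\<dots> = (\<Sum>k\<in>{k. ?x = fst (node k)}. y k *\<^sub>R S (snd (node k)))"
    using sum.inter_filter[of UNIV "\<lambda>k. y k *\<^sub>R S (snd (node k))" "\<lambda>k. ?x = fst (node k)"] by simp
  also have "\<dots> = (\<Sum>s\<in>UNIV. y (\<kappa> s) *\<^sub>R S s)"
    unfolding fibre by (simp add: sum.reindex[OF inj_\<kappa>] node_\<kappa>)
  also have "\<dots> = (\<Sum>m\<in>range S. y (\<kappa> (inv S m)) *\<^sub>R m)"
    by (simp add: sum.reindex[OF S(1)] inv_f_f[OF S(1)])
  finally have sum0: "(\<Sum>m\<in>range S. y (\<kappa> (inv S m)) *\<^sub>R m) = 0" by simp
  have "y (\<kappa> (inv S (S (snd (node k0))))) = 0"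
    by (rule independentD[OF S(2) _ order_refl sum0]) auto
  moreover have "\<kappa> (snd (node k0)) = k0"
    by (rule injD[OF inj_node]) (simp add: node_\<kappa>)
  ultimately show ?thesis by (simp add: inv_f_f[OF S(1)])
qed

text \<open>Block sizes are stated as sizes of the fibres of the labelling. The two invertibility
  conjuncts guarantee that \<open>matrix_inv\<close>, defined by choice, denotes an actual inverse
  wherever it occurs.\<close>

theorem mainTheorem4:
  fixes \<Omega> \<Gamma>\<^sub>D \<Gamma>\<^sub>N :: "(real^3) set"
    and T :: "(real^3) set set"
    and r :: "(real^3) set \<Rightarrow> nat \<Rightarrow> real^3"
    and n :: "(real^3) set \<Rightarrow> real^3"
    and \<kappa> :: real
    and A :: "real^3 \<Rightarrow> (real^3^3) \<Rightarrow>\<^sub>L (real^3^3)"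
    and dof :: "'d::finite \<Rightarrow> (real^3) set \<times> (real^3) \<times> 3"
    and node :: "'w::finite \<Rightarrow> (real^3) \<times> 3"
    and S :: "3 \<Rightarrow> real^3^3"
    and \<tau> :: "'d \<Rightarrow> real^3 \<Rightarrow> real^3^3"
    and v :: "'v::finite \<Rightarrow> real^3 \<Rightarrow> real^3"
    and w :: "'w \<Rightarrow> real^3 \<Rightarrow> real^3^3"
    and A\<^sub>\<sigma>\<^sub>\<sigma> :: "real^'d^'d" and A\<^sub>\<sigma>\<^sub>u :: "real^'d^'v" and A\<^sub>\<sigma>\<^sub>\<gamma> :: "real^'d^'w"
  assumes domain: "open \<Omega>" "connected \<Omega>" "simply_connected \<Omega>" "bounded \<Omega>" "\<Omega> \<noteq> {}"
    and mesh: "conforming_mesh \<Omega> T" "shape_regular \<kappa> T" "\<forall>E\<in>T. cuboid (r E) E"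
    and boundary: "frontier \<Omega> = \<Gamma>\<^sub>D \<union> \<Gamma>\<^sub>N" "\<Gamma>\<^sub>D \<noteq> {}"
      "\<exists>F. F \<subseteq> mesh_faces T \<and> \<Gamma>\<^sub>D = \<Union>F" "\<exists>F. F \<subseteq> mesh_faces T \<and> \<Gamma>\<^sub>N = \<Union>F"
    and normals: "\<forall>f\<in>mesh_faces T. unit_normal f (n f)"
    and compliance: "compliance_tensor \<Omega> T A"
    and A1: "\<forall>E\<in>T. card {f. f facet_of E \<and> f \<subseteq> \<Gamma>\<^sub>N} \<le> 1"
    and A2: "agglomerable \<Omega> T"
    and dofs: "bij_betw dof UNIV (dof_set \<Gamma>\<^sub>N T)"
    and stress_basis: "is_basis (Xh \<Omega> \<Gamma>\<^sub>N T r) \<tau>"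
      "\<forall>i j. dof_value T n (dof i) (\<tau> j) (if i = j then 1 else 0)"
    and displacement_basis: "is_basis (Vh T) v"
    and nodes: "bij_betw node UNIV (mesh_vertices T r \<times> UNIV)"
    and skew_basis: "inj S" "independent (range S)" "span (range S) = skew_matrices"
    and rotation_basis: "is_basis (Wh1 \<Omega> T r) w"
      "\<forall>k. \<forall>x\<in>mesh_vertices T r. w k x = (if x = fst (node k) then S (snd (node k)) else 0)"
    and matrices: "A\<^sub>\<sigma>\<^sub>\<sigma> = (\<chi> i j. quad_A T r A (\<tau> j) (\<tau> i))"
      "A\<^sub>\<sigma>\<^sub>u = (\<chi> i j. L2_inner \<Omega> (the_div \<Omega> (\<tau> j)) (v i))"
      "A\<^sub>\<sigma>\<^sub>\<gamma> = (\<chi> i j. quad T r (\<tau> j) (w i))"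
  shows "invertible A\<^sub>\<sigma>\<^sub>\<sigma> \<and>
    block_diagonal (\<lambda>i. dof_vertex (dof i)) A\<^sub>\<sigma>\<^sub>\<sigma> \<and>
    (\<forall>x \<in> mesh_vertices T r \<inter> \<Omega>. card {i. dof_vertex (dof i) = x} = 36) \<and>
    block_diagonal (\<lambda>k. fst (node k)) (A\<^sub>\<sigma>\<^sub>\<gamma> ** matrix_inv A\<^sub>\<sigma>\<^sub>\<sigma> ** transpose A\<^sub>\<sigma>\<^sub>\<gamma>) \<and>
    (\<forall>x \<in> mesh_vertices T r. card {k. fst (node k) = x} = 3) \<and>
    sym_pos_def (block_matrix
      (A\<^sub>\<sigma>\<^sub>u ** matrix_inv A\<^sub>\<sigma>\<^sub>\<sigma> ** transpose A\<^sub>\<sigma>\<^sub>u) (A\<^sub>\<sigma>\<^sub>u ** matrix_inv A\<^sub>\<sigma>\<^sub>\<sigma> ** transpose A\<^sub>\<sigma>\<^sub>\<gamma>)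
      (A\<^sub>\<sigma>\<^sub>\<gamma> ** matrix_inv A\<^sub>\<sigma>\<^sub>\<sigma> ** transpose A\<^sub>\<sigma>\<^sub>u) (A\<^sub>\<sigma>\<^sub>\<gamma> ** matrix_inv A\<^sub>\<sigma>\<^sub>\<sigma> ** transpose A\<^sub>\<sigma>\<^sub>\<gamma>)) \<and>
    invertible (A\<^sub>\<sigma>\<^sub>\<gamma> ** matrix_inv A\<^sub>\<sigma>\<^sub>\<sigma> ** transpose A\<^sub>\<sigma>\<^sub>\<gamma>) \<and>
    sym_pos_def
      (A\<^sub>\<sigma>\<^sub>u ** matrix_inv A\<^sub>\<sigma>\<^sub>\<sigma> ** transpose A\<^sub>\<sigma>\<^sub>u -
       A\<^sub>\<sigma>\<^sub>u ** matrix_inv A\<^sub>\<sigma>\<^sub>\<sigma> ** transpose A\<^sub>\<sigma>\<^sub>\<gamma> **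
       matrix_inv (A\<^sub>\<sigma>\<^sub>\<gamma> ** matrix_inv A\<^sub>\<sigma>\<^sub>\<sigma> ** transpose A\<^sub>\<sigma>\<^sub>\<gamma>) **
       (A\<^sub>\<sigma>\<^sub>\<gamma> ** matrix_inv A\<^sub>\<sigma>\<^sub>\<sigma> ** transpose A\<^sub>\<sigma>\<^sub>u))"
proof -
  interpret cuboid_mesh \<Omega> T r
    by unfold_locales (use domain mesh in blast)+
  have n: "unit_normal f (n f)" if "f \<in> mesh_faces T" for f using normals that by blast
  have \<Gamma>: "\<Gamma>\<^sub>N \<subseteq> frontier \<Omega>" using boundary(1) by blast
  have \<tau>X: "\<tau> i \<in> Xh \<Omega> \<Gamma>\<^sub>N T r" for i using stress_basis(1) unfolding is_basis_def by blast
  have vV: "v i \<in> Vh T" for i using displacement_basis unfolding is_basis_def by blast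
  have wW: "w k \<in> Wh1 \<Omega> T r" for k using rotation_basis(1) unfolding is_basis_def by blast
  have inj_dof: "inj dof" and ran_dof: "range dof = dof_set \<Gamma>\<^sub>N T"
    using dofs by (auto simp: bij_betw_def)
  have dof_ex: "\<exists>i. dof i = (f, x, c)" if "f \<in> mesh_faces T" "\<not> f \<subseteq> \<Gamma>\<^sub>N" "x extreme_point_of f" for f x c
  proof -
    have "(f, x, c) \<in> range dof" unfolding ran_dof using that by (simp add: dof_set_def)
    then show ?thesis by (metis rangeE)
  qed
  \<comment> \<open>Extends duality to all facets: on those in \<open>\<Gamma>\<^sub>N\<close> the
    normal value is zero by the boundary condition, and no degree of freedom sits there.\<close>
  have dual: "(from_within E (\<tau> i) x *v n f) $ c = (if (f, x, c) = dof i then 1 else 0)"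
    if E: "E \<in> T" and f: "f facet_of E" and x: "x extreme_point_of f" for E i f x c
  proof (cases "f \<subseteq> \<Gamma>\<^sub>N")
    case True
    have xf: "x \<in> f" using x by (simp add: extreme_point_of_def)
    have mf: "f \<in> mesh_faces T" using E f by (auto simp: mesh_faces_def)
    have "\<forall>E\<in>T. \<forall>f n. f facet_of E \<and> f \<subseteq> \<Gamma>\<^sub>N \<and> unit_normal f n \<longrightarrow> (\<forall>x\<in>f. from_within E (\<tau> i) x *v n = 0)"
      using \<tau>X[of i] unfolding Xh_def mem_Collect_eq by (elim conjE)
    then have "from_within E (\<tau> i) x *v n f = 0" using E f True n[OF mf] xf by blast
    moreover have "(f, x, c) \<noteq> dof i"
    proof
      assume "(f, x, c) = dof i"
      then have "(f, x, c) \<in> dof_set \<Gamma>\<^sub>N T" using ran_dof by (metis rangeI)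
      then show False using True by (simp add: dof_set_def)
    qed
    ultimately show ?thesis by simp
  next
    case False
    have mf: "f \<in> mesh_faces T" using E f by (auto simp: mesh_faces_def)
    obtain k where k: "dof k = (f, x, c)" using dof_ex[OF mf False x] by blast
    have "dof_value T n (dof k) (\<tau> i) (if k = i then 1 else 0)" using stress_basis(2) by blast
    then have "(from_within E (\<tau> i) x *v n f) $ c = (if k = i then 1 else 0)"
      using E f unfolding dof_value_def k by simp
    moreover have "(k = i) = ((f, x, c) = dof i)" unfolding k[symmetric] by (rule inj_eq[OF inj_dof, symmetric])
    ultimately show ?thesis by simp
  qed
  \<comment> \<open>At any other vertex all normal components of the basis field vanish, and these
    determine the matrix.\<close>
  have vanish: "from_within E (\<tau> i) (r E k) = 0" if E: "E \<in> T" "k \<in> {1..8}" and ne: "r E k \<noteq> dof_vertex (dof i)" for E k i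
  proof (rule vertex_matrix_zero[OF n E])
    fix f assume f: "f facet_of E" "r E k extreme_point_of f"
    have "(f, r E k, c) \<noteq> dof i" for c
    proof
      assume eq: "(f, r E k, c) = dof i"
      have "dof_vertex (dof i) = r E k" unfolding eq[symmetric] dof_vertex_def by simp
      then show False using ne by simp
    qed
    then show "from_within E (\<tau> i) (r E k) *v n f = 0" by (simp add: vec_eq_iff dual[OF E(1) f])
  qed
  obtain \<alpha> where \<alpha>: "\<alpha> > 0"
    and pos: "\<And>E x \<tau>. E \<in> T \<Longrightarrow> x \<in> E \<Longrightarrow> blinfun_apply (from_within E A x) \<tau> \<bullet> \<tau> \<ge> \<alpha> * (norm \<tau>)\<^sup>2"
    and symA: "\<And>E x \<sigma> \<tau>. E \<in> T \<Longrightarrow> x \<in> E \<Longrightarrow>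
      blinfun_apply (from_within E A x) \<sigma> \<bullet> \<tau> = \<sigma> \<bullet> blinfun_apply (from_within E A x) \<tau>"
    using compliance_within[OF compliance] by blast
  have vmem: "r E k \<in> E" if "E \<in> T" "k \<in> {1..8}" for E k by (rule cuboid_vertex_mem[OF cuboid[OF that(1)] that(2)])
  have measure_pos: "measure lebesgue E > 0" if "E \<in> T" for E
    using cuboid_J_pos[OF cuboid[OF that]] cuboid_measure[OF cuboid[OF that]] by simp
  have spd: "sym_pos_def A\<^sub>\<sigma>\<^sub>\<sigma>"
    unfolding sym_pos_def_def
  proof (intro conjI allI impI)
    have "quad_A T r A (\<tau> i) (\<tau> j) = quad_A T r A (\<tau> j) (\<tau> i)" for i j
      unfolding quad_A_def
    proof (intro sum.cong refl arg_cong2[where f = "(*)"])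
      fix E k assume "E \<in> T" "k \<in> {1..8::nat}"
      from symA[OF this(1) vmem[OF this]]
      show "blinfun_apply (from_within E A (r E k)) (from_within E (\<tau> i) (r E k)) \<bullet> from_within E (\<tau> j) (r E k) =
        blinfun_apply (from_within E A (r E k)) (from_within E (\<tau> j) (r E k)) \<bullet> from_within E (\<tau> i) (r E k)"
        by (simp only: inner_commute)
    qed
    then show "transpose A\<^sub>\<sigma>\<^sub>\<sigma> = A\<^sub>\<sigma>\<^sub>\<sigma>" by (simp add: matrices(1) transpose_def)
    fix z :: "real^'d" assume z: "z \<noteq> 0"
    define Y where "Y E k = (\<Sum>j\<in>UNIV. z $ j *\<^sub>R from_within E (\<tau> j) (r E k))" for E k
    define q where "q E k = blinfun_apply (from_within E A (r E k)) (Y E k) \<bullet> Y E k" for E k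
    have q_ge: "q E k \<ge> \<alpha> * (norm (Y E k))\<^sup>2" if "E \<in> T" "k \<in> {1..8}" for E k
      unfolding q_def by (rule pos[OF that(1) vmem[OF that]])
    have q0: "q E k \<ge> 0" if "E \<in> T" "k \<in> {1..8}" for E k
      using q_ge[OF that] \<alpha> by (smt (verit) mult_nonneg_nonneg zero_le_power2)
    have eq: "z \<bullet> (A\<^sub>\<sigma>\<^sub>\<sigma> *v z) = (\<Sum>E\<in>T. measure lebesgue E / 8 * (\<Sum>k=1..8. q E k))"
      unfolding matrices(1) stress_matrix_inner q_def Y_def ..
    have inner0: "(\<Sum>k=1..8. q E k) \<ge> 0" if "E \<in> T" for E by (rule sum_nonneg) (rule q0[OF that])
    show "z \<bullet> (A\<^sub>\<sigma>\<^sub>\<sigma> *v z) > 0"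
    proof (rule ccontr)
      assume "\<not> ?thesis"
      then have le: "(\<Sum>E\<in>T. measure lebesgue E / 8 * (\<Sum>k=1..8. q E k)) \<le> 0" using eq by simp
      have nonneg: "measure lebesgue E / 8 * (\<Sum>k=1..8. q E k) \<ge> 0" if "E \<in> T" for E
        using inner0[OF that] by simp
      have tot: "(\<Sum>E\<in>T. measure lebesgue E / 8 * (\<Sum>k=1..8. q E k)) = 0"
        by (rule antisym[OF le sum_nonneg[OF nonneg]])
      have mz: "measure lebesgue E / 8 * (\<Sum>k=1..8. q E k) = 0" if "E \<in> T" for E
        by (rule sum_nonneg_0[where f = "\<lambda>E. measure lebesgue E / 8 * (\<Sum>k=1..8. q E k)", OF finite_T nonneg tot that])
      have sum0: "(\<Sum>k=1..8. q E k) = 0" if "E \<in> T" for E using mz[OF that] measure_pos[OF that] by simp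
      have Y0: "Y E k = 0" if "E \<in> T" "k \<in> {1..8}" for E k
      proof -
        have "q E k = 0"
          by (rule sum_nonneg_0[where f = "q E", OF finite_atLeastAtMost q0[OF that(1)] sum0[OF that(1)] that(2)])
        then have "\<alpha> * (norm (Y E k))\<^sup>2 \<le> 0" using q_ge[OF that] by simp
        then show ?thesis using \<alpha> by (simp add: mult_le_0_iff)
      qed
      \<comment> \<open>Evaluating degree of freedom \<open>i\<close> on the vanishing combination
        returns the coefficient \<open>z $ i\<close>.\<close>
      have "z $ i = 0" for i
      proof -
        obtain f x c where d: "dof i = (f, x, c)" by (metis prod_cases3)
        have "(f, x, c) \<in> dof_set \<Gamma>\<^sub>N T" using ran_dof d by (metis rangeI)
        then have f: "f \<in> mesh_faces T" "x extreme_point_of f" by (auto simp: dof_set_def)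
        then obtain E where E: "E \<in> T" "f facet_of E" by (auto simp: mesh_faces_def)
        have "x extreme_point_of E" using extreme_point_of_face[of f E x] E(2) f(2) by (simp add: facet_of_def)
        then obtain k where k: "k \<in> {1..8}" "x = r E k" using cuboid_extreme_point_vertex[OF cuboid[OF E(1)]] by blast
        have "(Y E k *v n f) $ c = (\<Sum>j\<in>UNIV. z $ j * (from_within E (\<tau> j) (r E k) *v n f) $ c)"
          by (simp add: Y_def matrix_vector_mult_def sum_distrib_left sum_distrib_right mult.assoc)
             (rule sum.swap)
        also have "\<dots> = (\<Sum>j\<in>UNIV. z $ j * (if (f, x, c) = dof j then 1 else 0))"
          by (simp only: k(2)[symmetric] dual[OF E f(2)])
        also have "\<dots> = (\<Sum>j\<in>UNIV. if j = i then z $ i else 0)"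
        proof (intro sum.cong refl)
          fix j
          have "((f, x, c) = dof j) = (j = i)" unfolding d[symmetric] by (metis inj_dof inj_eq)
          then show "z $ j * (if (f, x, c) = dof j then 1 else 0) = (if j = i then z $ i else 0)" by simp
        qed
        finally show ?thesis using Y0[OF E(1) k(1)] by simp
      qed
      then show False using z by (simp add: vec_eq_iff)
    qed
  qed
  have inv: "invertible A\<^sub>\<sigma>\<^sub>\<sigma>" by (rule sym_pos_def_invertible[OF spd])
  note spd_inv = sym_pos_def_matrix_inv[OF spd]
  have bd: "block_diagonal (\<lambda>i. dof_vertex (dof i)) A\<^sub>\<sigma>\<^sub>\<sigma>"
    unfolding block_diagonal_def
  proof (intro allI impI)
    fix i j assume ne: "dof_vertex (dof i) \<noteq> dof_vertex (dof j)"
    have "blinfun_apply (from_within E A (r E k)) (from_within E (\<tau> j) (r E k)) \<bullet> from_within E (\<tau> i) (r E k) = 0"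
      if "E \<in> T" "k \<in> {1..8}" for E k
    proof (cases "r E k = dof_vertex (dof i)")
      case True
      then show ?thesis using vanish[OF that, of j] ne by simp
    next
      case False
      then show ?thesis using vanish[OF that, of i] by simp
    qed
    then show "A\<^sub>\<sigma>\<^sub>\<sigma> $ i $ j = 0" by (simp add: matrices(1) quad_A_def)
  qed
  have w_vert: "from_within E (w k) (r E i) = (if r E i = fst (node k) then S (snd (node k)) else 0)"
    if "E \<in> T" "i \<in> {1..8}" for E i k
  proof -
    have "r E i \<in> mesh_vertices T r" using that unfolding mesh_vertices_def by blast
    then show ?thesis using rotation_basis(2) Wh1_from_within[OF wW that(1) vmem[OF that]] by simp
  qed
  \<comment> \<open>A basis stress and a nodal rotation interact only when they belong to the same
    vertex.\<close>
  have C: "fst (node k) = dof_vertex (dof j)" if "A\<^sub>\<sigma>\<^sub>\<gamma> $ k $ j \<noteq> 0" for k j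
  proof (rule ccontr)
    assume ne: "fst (node k) \<noteq> dof_vertex (dof j)"
    have "from_within E (\<tau> j) (r E i) \<bullet> from_within E (w k) (r E i) = 0" if "E \<in> T" "i \<in> {1..8}" for E i
      using vanish[OF that, of j] w_vert[OF that, of k] ne by (cases "r E i = dof_vertex (dof j)") auto
    then have "A\<^sub>\<sigma>\<^sub>\<gamma> $ k $ j = 0" by (simp add: matrices(3) quad_def)
    then show False using that by simp
  qed
  have bd_\<gamma>: "block_diagonal (\<lambda>k. fst (node k)) (A\<^sub>\<sigma>\<^sub>\<gamma> ** matrix_inv A\<^sub>\<sigma>\<^sub>\<sigma> ** transpose A\<^sub>\<sigma>\<^sub>\<gamma>)"
    by (rule block_diagonal_congruence[OF block_diagonal_matrix_inv[OF bd inv] C])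
  have kernel: "x = 0 \<and> y = 0" if xy: "transpose A\<^sub>\<sigma>\<^sub>u *v x + transpose A\<^sub>\<sigma>\<^sub>\<gamma> *v y = 0" for x :: "real^'v" and y :: "real^'w"
  proof -
    \<comment> \<open>The element values and vertex values of the discrete displacement and rotation
      with coefficients \<open>x\<close> and \<open>y\<close>.\<close>
    define u where "u E = (\<Sum>i\<in>UNIV. x $ i *\<^sub>R v i (box_center (r E)))" for E
    define W where "W p = (\<Sum>k\<in>UNIV. y $ k *\<^sub>R w k p)" for p
    let ?k = "\<lambda>E i j. (2 * ref_vertex i $ j - 1) * elem_J (r E) / (4 * (edge (r E) j \<bullet> edge (r E) j))"
    \<comment> \<open>Component \<open>l\<close> of the assumed equation, written with vertex
      values.\<close>
    have form: "(\<Sum>E\<in>T. \<Sum>i=1..8. \<Sum>j\<in>UNIV. ?k E i j * ((from_within E (\<tau> l) (r E i) *v edge (r E) j) \<bullet> u E)) +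
        (\<Sum>E\<in>T. elem_J (r E) / 8 * (\<Sum>i=1..8. from_within E (\<tau> l) (r E i) \<bullet> W (r E i))) = 0" for l
    proof -
      have "(\<Sum>E\<in>T. \<Sum>i=1..8. \<Sum>j\<in>UNIV. ?k E i j * ((from_within E (\<tau> l) (r E i) *v edge (r E) j) \<bullet> u E)) =
          (\<Sum>m\<in>UNIV. x $ m * L2_inner \<Omega> (the_div \<Omega> (\<tau> l)) (v m))"
      proof -
        let ?s = "\<lambda>E i j. from_within E (\<tau> l) (r E i) *v edge (r E) j"
        have "(\<Sum>m\<in>UNIV. x $ m * L2_inner \<Omega> (the_div \<Omega> (\<tau> l)) (v m)) =
            (\<Sum>m\<in>UNIV. \<Sum>E\<in>T. \<Sum>i=1..8. \<Sum>j\<in>UNIV. x $ m * (?k E i j * (?s E i j \<bullet> v m (box_center (r E)))))"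
          unfolding divergence_form[OF \<tau>X vV] sum_distrib_left ..
        also have "\<dots> = (\<Sum>E\<in>T. \<Sum>m\<in>UNIV. \<Sum>i=1..8. \<Sum>j\<in>UNIV. x $ m * (?k E i j * (?s E i j \<bullet> v m (box_center (r E)))))"
          by (rule sum.swap)
        also have "\<dots> = (\<Sum>E\<in>T. \<Sum>i=1..8. \<Sum>m\<in>UNIV. \<Sum>j\<in>UNIV. x $ m * (?k E i j * (?s E i j \<bullet> v m (box_center (r E)))))"
          by (intro sum.cong refl sum.swap)
        also have "\<dots> = (\<Sum>E\<in>T. \<Sum>i=1..8. \<Sum>j\<in>UNIV. \<Sum>m\<in>UNIV. x $ m * (?k E i j * (?s E i j \<bullet> v m (box_center (r E)))))"
          by (intro sum.cong refl sum.swap)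
        also have "\<dots> = (\<Sum>E\<in>T. \<Sum>i=1..8. \<Sum>j\<in>UNIV. ?k E i j * (?s E i j \<bullet> u E))"
          unfolding u_def inner_sum_right inner_scaleR_right sum_distrib_left
          by (intro sum.cong refl) (simp only: mult.left_commute)
        finally show ?thesis by (rule sym)
      qed
      moreover have "(\<Sum>E\<in>T. elem_J (r E) / 8 * (\<Sum>i=1..8. from_within E (\<tau> l) (r E i) \<bullet> W (r E i))) =
          (\<Sum>k\<in>UNIV. y $ k * quad T r (\<tau> l) (w k))"
      proof -
        have "(\<Sum>k\<in>UNIV. y $ k * quad T r (\<tau> l) (w k)) =
            (\<Sum>k\<in>UNIV. \<Sum>E\<in>T. \<Sum>i=1..8. y $ k * (elem_J (r E) / 8 * (from_within E (\<tau> l) (r E i) \<bullet> w k (r E i))))"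
          unfolding quad_def sum_distrib_left
          by (intro sum.cong refl)
             (simp add: cuboid_measure[OF cuboid] Wh1_from_within[OF wW _ vmem])
        also have "\<dots> = (\<Sum>E\<in>T. \<Sum>k\<in>UNIV. \<Sum>i=1..8. y $ k * (elem_J (r E) / 8 * (from_within E (\<tau> l) (r E i) \<bullet> w k (r E i))))"
          by (rule sum.swap)
        also have "\<dots> = (\<Sum>E\<in>T. \<Sum>i=1..8. \<Sum>k\<in>UNIV. y $ k * (elem_J (r E) / 8 * (from_within E (\<tau> l) (r E i) \<bullet> w k (r E i))))"
          by (intro sum.cong refl sum.swap)
        also have "\<dots> = (\<Sum>E\<in>T. elem_J (r E) / 8 * (\<Sum>i=1..8. from_within E (\<tau> l) (r E i) \<bullet> W (r E i)))"
          unfolding W_def inner_sum_right inner_scaleR_right sum_distrib_left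
          by (intro sum.cong refl) (simp only: mult.left_commute)
        finally show ?thesis by (rule sym)
      qed
      moreover have "(\<Sum>m\<in>UNIV. x $ m * L2_inner \<Omega> (the_div \<Omega> (\<tau> l)) (v m)) + (\<Sum>k\<in>UNIV. y $ k * quad T r (\<tau> l) (w k)) =
          (transpose A\<^sub>\<sigma>\<^sub>u *v x + transpose A\<^sub>\<sigma>\<^sub>\<gamma> *v y) $ l"
        by (simp add: matrices(2,3) matrix_vector_mult_def transpose_def mult.commute del: transpose_matrix_vector)
      ultimately show ?thesis by (simp only: xy zero_index)
    qed
    \<comment> \<open>The three degrees of freedom at one facet and vertex supply the three
      components of a vector equation.\<close>
    have H: "(\<Sum>E\<in>{E \<in> T. f facet_of E}. facet_weight (r E) E f (n f) *\<^sub>R (u E + W p *v facet_offset (r E) E f)) = 0"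
      if f: "f \<in> mesh_faces T" "\<not> f \<subseteq> \<Gamma>\<^sub>N" "p extreme_point_of f" for f p
    proof (subst vec_eq_iff, rule allI)
      fix c
      obtain l where l: "dof l = (f, p, c)" using dof_ex[OF f] by blast
      have "(from_within E (\<tau> l) x *v n f') $ c' = (if (f', x, c') = (f, p, c) then 1 else 0)"
        if "E \<in> T" "f' facet_of E" "x extreme_point_of f'" for E f' x c'
        using dual[OF that, of l c'] unfolding l .
      from basis_field_form[where \<sigma> = "\<lambda>E. from_within E (\<tau> l)" and u = u and W = W, OF n f(3) this] form[of l]
      show "(\<Sum>E\<in>{E \<in> T. f facet_of E}. facet_weight (r E) E f (n f) *\<^sub>R (u E + W p *v facet_offset (r E) E f)) $ c = 0 $ c"
        by simp
    qed
    have skew: "transpose (W p) = - W p" for p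
    proof -
      have "transpose (w k p) = - w k p" for k
        using wW[of k] unfolding Wh1_def skew_matrices_def by blast
      then have wt: "w k p $ i $ j = - w k p $ j $ i" for k i j
        by (metis (no_types, lifting) transpose_def vec_lambda_beta vector_uminus_component)
      have Wt: "W p $ j $ i = - W p $ i $ j" for i j
      proof -
        have "W p $ j $ i = (\<Sum>k\<in>UNIV. y $ k * w k p $ j $ i)" by (simp add: W_def)
        also have "\<dots> = (\<Sum>k\<in>UNIV. - (y $ k * w k p $ i $ j))"
          by (intro sum.cong refl) (subst wt, rule mult_minus_right)
        also have "\<dots> = - W p $ i $ j" by (simp add: W_def sum_negf)
        finally show ?thesis .
      qed
      show ?thesis
        by (simp only: vec_eq_iff transpose_def vec_lambda_beta vector_uminus_component) (intro allI Wt)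
    qed
    have "(\<forall>E\<in>T. u E = 0) \<and> (\<forall>p\<in>mesh_vertices T r. W p = 0)"
      by (rule discrete_kernel_trivial[OF n \<Gamma> bspec[OF A1] skew H])
    then have u0: "\<And>E. E \<in> T \<Longrightarrow> u E = 0" and W0: "\<And>p. p \<in> mesh_vertices T r \<Longrightarrow> W p = 0" by auto
    \<comment> \<open>Linear independence in \<open>is_basis\<close> refers to all points; off the
      element interiors every field of \<open>Vh\<close> is zero.\<close>
    have "(\<Sum>i\<in>UNIV. x $ i *\<^sub>R v i p) = 0" for p
    proof (cases "p \<in> (\<Union>E\<in>T. interior E)")
      case True
      then obtain E where "E \<in> T" "p \<in> interior E" by blast
      then show ?thesis using u0[of E] Vh_interior[OF vV] by (simp add: u_def)
    next
      case False
      then show ?thesis using Vh_outside[OF vV] by simp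
    qed
    then have "x $ i = 0" for i using displacement_basis unfolding is_basis_def by blast
    moreover have "y $ k = 0" for k
    proof (rule nodal_coefficients_zero[OF nodes skew_basis(1,2)])
      fix p assume p: "p \<in> mesh_vertices T r"
      show "(\<Sum>k\<in>UNIV. y $ k *\<^sub>R (if p = fst (node k) then S (snd (node k)) else 0)) = 0"
        using W0[OF p] rotation_basis(2) p by (simp add: W_def)
    qed
    ultimately show ?thesis by (simp add: vec_eq_iff)
  qed
  have spd_\<gamma>: "sym_pos_def (A\<^sub>\<sigma>\<^sub>\<gamma> ** matrix_inv A\<^sub>\<sigma>\<^sub>\<sigma> ** transpose A\<^sub>\<sigma>\<^sub>\<gamma>)"
  proof (rule sym_pos_def_congruence[OF spd_inv])
    fix y assume "transpose A\<^sub>\<sigma>\<^sub>\<gamma> *v y = 0"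
    then have "transpose A\<^sub>\<sigma>\<^sub>u *v 0 + transpose A\<^sub>\<sigma>\<^sub>\<gamma> *v y = 0" by (simp del: transpose_matrix_vector)
    then show "y = 0" using kernel by blast
  qed
  have card36: "card {i. dof_vertex (dof i) = x} = 36" if "x \<in> mesh_vertices T r \<inter> \<Omega>" for x
    by (rule card_dofs_at_interior_vertex[OF _ _ n \<Gamma> dofs]) (use that in auto)
  have card3: "card {k. fst (node k) = x} = 3" if "x \<in> mesh_vertices T r" for x
    by (rule card_node_fibre[OF nodes that])
  show ?thesis
    by (intro conjI ballI inv bd card36 bd_\<gamma> card3 sym_pos_def_invertible[OF spd_\<gamma>]
        sym_pos_def_block_congruence[OF spd_inv kernel] sym_pos_def_Schur_complement[OF spd_inv kernel])
qed

end
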